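(* Let $(R,\lambda)$ be as in the context, of relative dimension $d$, let $\theta:S=\mathcal{O}[[y_1,\dots,y_d]]\to R$ satisfy (P), let $(\widetilde{R},I,\varphi)$ satisfy (CI), and let $\widetilde{\theta}:S\to\widetilde{R}$ be a continuous $\mathcal{O}$-algebra map with $\varphi\circ\widetilde{\theta}=\theta$ making $\widetilde{R}$ a finite free $S$-module; identify $S$ with its images. Let $\widetilde{R}_\theta=\widetilde{R}/(y_1,\dots,y_d)$ with quotient map $\pi_\theta:\widetilde{R}\to\widetilde{R}_\theta$, $R_\theta=R/(y_1,\dots,y_d)$, $\varphi_\theta:\widetilde{R}_\theta\to R_\theta$ the induced map, $I_\theta=\ker\varphi_\theta$, $\widetilde{\lambda}=\lambda\circ\varphi$ and $\widetilde{\lambda}_\theta:\widetilde{R}_\theta\to\mathcal{O}$ the induced augmentation. Then (1) $\widetilde{R}_\theta[I_\theta]=\pi_\theta(\widetilde{R}[I])$; (2) $\mathrm{Fitt}_{\widetilde{R}_\theta}(I_\theta)=\pi_\theta(\mathrm{Fitt}_{\widetilde{R}}(I))$. In particular \[C_{1,\lambda_\theta}(R_\theta):=\widetilde{\lambda}_\theta(\widetilde{R}_\theta[I_\theta])/\widetilde{\lambda}_\theta(\mathrm{Fitt}(I_\theta))=\widetilde{\lambda}(\widetilde{R}[I])/\widetilde{\lambda}(\mathrm{Fitt}(I)),\] which depends only on $\widetilde{R}$, $R$ and $\widetilde{\lambda}$, not on $\theta$.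
   Context: $E/\mathbf{Q}_p$ finite, $\mathcal{O}$ its ring of integers, $\varpi$ a uniformizer, $k$ residue field; all complete Noetherian local $\mathcal{O}$-algebras have residue field $k$. An augmentation is a surjective $\mathcal{O}$-algebra map to $\mathcal{O}$. For an ideal $J$ of a ring $A$, $A[J]$ is the annihilator of $J$; $\mathrm{Fitt}$ is the $0$-th Fitting ideal. $R$ is a complete Noetherian local $\mathcal{O}$-algebra, flat over $\mathcal{O}$, Cohen–Macaulay, of relative dimension $d$ over $\mathcal{O}$, with augmentation $\lambda$ such that $\mathrm{Spec}\,R[1/\varpi]$ is formally smooth at the point of $\lambda$. Property (P) for $\theta:S\to R$: $\theta$ is a continuous $\mathcal{O}$-algebra map making $R$ a finite free $S$-module, $\theta(y_i)\in\ker\lambda$ for all $i$, and, with $R_\theta=R/(\theta(y_1),\dots,\theta(y_d))$ and $\lambda_\theta$ induced by $\lambda$, the module $\ker\lambda_\theta/(\ker\lambda_\theta)^2$ is finite. Property (CI) for $(\widetilde{R},I,\varphi)$: $\widetilde{R}$ is a complete Noetherian local $\mathcal{O}$-algebra, flat and equidimensional over $\mathcal{O}$ of relative dimension $d$, and a complete intersection; $\varphi:\widetilde{R}\to R$ is a continuous surjection of $\mathcal{O}$-algebras with kernel $I$; and the point of $\lambda\circ\varphi$ in $\mathrm{Spec}\,\widetilde{R}[1/\varpi]$ is formally smooth. *)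

theory Defs
  imports
    Complex_Main
    "HOL-Library.Extended_Nat"
    "HOL-Library.Multiset"
    "HOL-Combinatorics.Permutations"
    "HOL-Algebra.Algebra"
    "HOL-Algebra.Free_Abelian_Groups"
begin

section \<open>Finite extensions of the p-adic numbers and their integers\<close>

definition padic_val :: "nat \<Rightarrow> rat \<Rightarrow> int" where
  "padic_val p x =
     int (multiplicity (int p) (fst (quotient_of x))) - int (multiplicity (int p) (snd (quotient_of x)))"

definition padic_abs :: "nat \<Rightarrow> rat \<Rightarrow> real" where
  "padic_abs p x = (if x = 0 then 0 else real p powi (- padic_val p x))"

definition padic_cauchy_ring :: "nat \<Rightarrow> (nat \<Rightarrow> rat) ring" where
  "padic_cauchy_ring p =
     \<lparr> carrier = {x. \<forall>e>0. \<exists>N. \<forall>m\<ge>N. \<forall>n\<ge>N. padic_abs p (x m - x n) < e},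
       monoid.mult = (\<lambda>x y n. x n * y n), one = (\<lambda>n. 1),
       ring.zero = (\<lambda>n. 0), add = (\<lambda>x y n. x n + y n) \<rparr>"

definition padic_null :: "nat \<Rightarrow> (nat \<Rightarrow> rat) set" where
  "padic_null p = {x. (\<lambda>n. padic_abs p (x n)) \<longlonglongrightarrow> 0}"

definition padic_field :: "nat \<Rightarrow> (nat \<Rightarrow> rat) set ring" where
  "padic_field p = padic_cauchy_ring p Quot padic_null p"

definition padic_integers :: "nat \<Rightarrow> (nat \<Rightarrow> rat) set set" where
  "padic_integers p = {U \<in> carrier (padic_field p). \<exists>x\<in>U. \<forall>n. padic_abs p (x n) \<le> 1}"

definition finite_padic_extension ::
    "nat \<Rightarrow> 'e ring \<Rightarrow> ((nat \<Rightarrow> rat) set \<Rightarrow> 'e) \<Rightarrow> bool" where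
  "finite_padic_extension p E \<iota> \<longleftrightarrow>
     Factorial_Ring.prime p \<and> field E \<and> \<iota> \<in> ring_hom (padic_field p) E \<and>
     ring.finite_dimension E (\<iota> ` carrier (padic_field p)) (carrier E)"

text \<open>The polynomials of HOL-Algebra are coefficient lists, leading coefficient first.\<close>

definition integral_over :: "'e ring \<Rightarrow> 'e set \<Rightarrow> 'e \<Rightarrow> bool" where
  "integral_over E Z x \<longleftrightarrow>
     (\<exists>f. f \<noteq> [] \<and> hd f = \<one>\<^bsub>E\<^esub> \<and> set f \<subseteq> Z \<and> ring.eval E f x = \<zero>\<^bsub>E\<^esub>)"

definition ring_of_integers :: "nat \<Rightarrow> 'e ring \<Rightarrow> ((nat \<Rightarrow> rat) set \<Rightarrow> 'e) \<Rightarrow> 'e ring" where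
  "ring_of_integers p E \<iota> =
     E\<lparr> carrier := {x \<in> carrier E. integral_over E (\<iota> ` padic_integers p) x} \<rparr>"

text \<open>A uniformizer is a nonzero generator of the maximal ideal, which in the (local) ring of
  integers is the set of nonunits.\<close>

definition uniformizer :: "('a, 'm) ring_scheme \<Rightarrow> 'a \<Rightarrow> bool" where
  "uniformizer A \<pi> \<longleftrightarrow>
     \<pi> \<in> carrier A \<and> \<pi> \<noteq> \<zero>\<^bsub>A\<^esub> \<and> carrier A - Units A = PIdl\<^bsub>A\<^esub> \<pi>"


section \<open>Quotients, annihilators, powers of ideals\<close>

text \<open>The map \<open>A/J \<rightarrow> B\<close> induced by \<open>f\<close>, applied to a coset \<open>U\<close>; meaningful if \<open>f\<close> vanishes on \<open>J\<close>.\<close>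

definition induced_map :: "('a \<Rightarrow> 'b) \<Rightarrow> 'a set \<Rightarrow> 'b" where
  "induced_map f U = the_elem (f ` U)"

text \<open>The map \<open>A/J \<rightarrow> B/K\<close> induced by \<open>f\<close>; meaningful if \<open>f\<close> maps \<open>J\<close> into \<open>K\<close>.\<close>

definition induced_quot_map :: "('b, 'm) ring_scheme \<Rightarrow> 'b set \<Rightarrow> ('a \<Rightarrow> 'b) \<Rightarrow> 'a set \<Rightarrow> 'b set" where
  "induced_quot_map B K f = induced_map (\<lambda>x. K +>\<^bsub>B\<^esub> f x)"

definition annihilator :: "('a, 'm) ring_scheme \<Rightarrow> 'a set \<Rightarrow> 'a set" where
  "annihilator A J = {a \<in> carrier A. \<forall>j\<in>J. a \<otimes>\<^bsub>A\<^esub> j = \<zero>\<^bsub>A\<^esub>}"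

primrec ideal_pow :: "('a, 'm) ring_scheme \<Rightarrow> 'a set \<Rightarrow> nat \<Rightarrow> 'a set" where
  "ideal_pow A J 0 = carrier A"
| "ideal_pow A J (Suc n) = ideal_prod A (ideal_pow A J n) J"


section \<open>Modules: finite freeness, flatness, Fitting ideals\<close>

definition ideal_module :: "('a, 'm) ring_scheme \<Rightarrow> 'a set \<Rightarrow> ('a, 'a) module" where
  "ideal_module A J =
     \<lparr> carrier = J, monoid.mult = monoid.mult A, one = \<one>\<^bsub>A\<^esub>, ring.zero = \<zero>\<^bsub>A\<^esub>, add = add A, smult = monoid.mult A \<rparr>"

definition restrict_scalars :: "('s \<Rightarrow> 'r) \<Rightarrow> ('r, 'm) ring_scheme \<Rightarrow> ('s, 'r) module" where
  "restrict_scalars f R =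
     \<lparr> carrier = carrier R, monoid.mult = monoid.mult R, one = \<one>\<^bsub>R\<^esub>, ring.zero = \<zero>\<^bsub>R\<^esub>, add = add R,
       smult = (\<lambda>s x. f s \<otimes>\<^bsub>R\<^esub> x) \<rparr>"

text \<open>The quotient \<open>N/D\<close> of ideals \<open>D \<subseteq> N\<close> of \<open>A\<close>, as an \<open>A\<close>-module. Only its module
  structure matters; the ring fields that the module record inherits carry no meaning here.\<close>

definition ideal_quotient :: "('a, 'm) ring_scheme \<Rightarrow> 'a set \<Rightarrow> 'a set \<Rightarrow> ('a, 'a set) module" where
  "ideal_quotient A N D =
     \<lparr> carrier = (\<lambda>x. D +>\<^bsub>A\<^esub> x) ` N, monoid.mult = rcoset_mult A D, one = D +>\<^bsub>A\<^esub> \<one>\<^bsub>A\<^esub>,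
       ring.zero = D, add = set_add A, smult = (\<lambda>a U. \<Union>x\<in>U. D +>\<^bsub>A\<^esub> (a \<otimes>\<^bsub>A\<^esub> x)) \<rparr>"

definition finite_free :: "('a, 'm) ring_scheme \<Rightarrow> ('a, 'x, 'n) module_scheme \<Rightarrow> bool" where
  "finite_free A M \<longleftrightarrow>
     module A M \<and>
     (\<exists>B. finite B \<and> B \<subseteq> carrier M \<and>
        (\<forall>x\<in>carrier M. \<exists>!c. c \<in> B \<rightarrow>\<^sub>E carrier A \<and> x = (\<Oplus>\<^bsub>M\<^esub>b\<in>B. c b \<odot>\<^bsub>M\<^esub> b)))"

text \<open>\<open>N \<otimes>\<^sub>A M\<close> is the free abelian group on \<open>N \<times> M\<close> modulo the following subgroup.\<close>

definition tensor_relations ::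
    "('a, 'm) ring_scheme \<Rightarrow> ('a, 'x, 'k) module_scheme \<Rightarrow> ('a, 'y, 'l) module_scheme
      \<Rightarrow> ('x \<times> 'y \<Rightarrow>\<^sub>0 int) set" where
  "tensor_relations A N M =
     generate (free_Abelian_group (carrier N \<times> carrier M))
      ({frag_of (x \<oplus>\<^bsub>N\<^esub> x', y) - frag_of (x, y) - frag_of (x', y) | x x' y.
          x \<in> carrier N \<and> x' \<in> carrier N \<and> y \<in> carrier M} \<union>
       {frag_of (x, y \<oplus>\<^bsub>M\<^esub> y') - frag_of (x, y) - frag_of (x, y') | x y y'.
          x \<in> carrier N \<and> y \<in> carrier M \<and> y' \<in> carrier M} \<union>
       {frag_of (a \<odot>\<^bsub>N\<^esub> x, y) - frag_of (x, a \<odot>\<^bsub>M\<^esub> y) | a x y.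
          a \<in> carrier A \<and> x \<in> carrier N \<and> y \<in> carrier M})"

text \<open>Flatness: for every submodule \<open>H\<close> of a module \<open>N\<close>, the map \<open>H \<otimes> M \<rightarrow> N \<otimes> M\<close> is injective,
  i.e. an element of the free group on \<open>H \<times> M\<close> which dies in \<open>N \<otimes> M\<close> already dies in \<open>H \<otimes> M\<close>.
  By passage to direct limits it is enough to test finitely generated \<open>N\<close>; those are
  quotients of some \<open>A\<^sup>n\<close>, and the type of \<open>N\<close> below has room for all of them.\<close>

definition flat_module :: "('a, 'm) ring_scheme \<Rightarrow> ('a, 'y, 'l) module_scheme \<Rightarrow> bool" where
  "flat_module A M \<longleftrightarrow>
     module A M \<and>
     (\<forall>(N :: ('a, (nat \<Rightarrow> 'a) set) module) H. module A N \<and> submodule H A N \<longrightarrow>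
        carrier (free_Abelian_group (H \<times> carrier M)) \<inter> tensor_relations A N M
          \<subseteq> tensor_relations A (N\<lparr>carrier := H\<rparr>) M)"

definition generating_family ::
    "('a, 'm) ring_scheme \<Rightarrow> ('a, 'x, 'n) module_scheme \<Rightarrow> nat \<Rightarrow> (nat \<Rightarrow> 'x) \<Rightarrow> bool" where
  "generating_family A M n x \<longleftrightarrow>
     x \<in> {..<n} \<rightarrow> carrier M \<and>
     (\<forall>m\<in>carrier M. \<exists>c. c \<in> {..<n} \<rightarrow> carrier A \<and> m = (\<Oplus>\<^bsub>M\<^esub>i\<in>{..<n}. c i \<odot>\<^bsub>M\<^esub> x i))"

definition ring_det :: "('a, 'm) ring_scheme \<Rightarrow> nat \<Rightarrow> (nat \<Rightarrow> nat \<Rightarrow> 'a) \<Rightarrow> 'a" where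
  "ring_det A n U =
     (\<Oplus>\<^bsub>A\<^esub>\<sigma>\<in>{\<sigma>. \<sigma> permutes {..<n}}.
        (if evenperm \<sigma> then \<Otimes>\<^bsub>A\<^esub>i\<in>{..<n}. U i (\<sigma> i)
         else \<ominus>\<^bsub>A\<^esub> (\<Otimes>\<^bsub>A\<^esub>i\<in>{..<n}. U i (\<sigma> i))))"

text \<open>The 0-th Fitting ideal of a finitely generated module: the ideal generated by the
  \<open>n \<times> n\<close> minors of the matrix of all relations between \<open>n\<close> generators. By Fitting's lemma this
  ideal is the same for every finite generating family; collecting the minors for all of
  them avoids a choice.\<close>

definition fitting_ideal :: "('a, 'm) ring_scheme \<Rightarrow> ('a, 'x, 'n) module_scheme \<Rightarrow> 'a set" where
  "fitting_ideal A M =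
     Idl\<^bsub>A\<^esub> {ring_det A n U | n x U.
       generating_family A M n x \<and>
       (\<forall>i<n. U i \<in> {..<n} \<rightarrow> carrier A \<and> (\<Oplus>\<^bsub>M\<^esub>j\<in>{..<n}. U i j \<odot>\<^bsub>M\<^esub> x j) = \<zero>\<^bsub>M\<^esub>)}"


section \<open>Local rings\<close>

definition local_ring :: "('a, 'm) ring_scheme \<Rightarrow> bool" where
  "local_ring A \<longleftrightarrow> cring A \<and> (\<exists>!M. maximalideal M A)"

definition max_ideal :: "('a, 'm) ring_scheme \<Rightarrow> 'a set" where
  "max_ideal A = (THE M. maximalideal M A)"

text \<open>Bijectivity of \<open>A \<rightarrow> lim A/J\<^sup>n\<close>.\<close>

definition adically_complete :: "('a, 'm) ring_scheme \<Rightarrow> 'a set \<Rightarrow> bool" where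
  "adically_complete A J \<longleftrightarrow>
     (\<Inter>n. ideal_pow A J n) = {\<zero>\<^bsub>A\<^esub>} \<and>
     (\<forall>x. (\<forall>n. x n \<in> carrier A \<and> x (Suc n) \<ominus>\<^bsub>A\<^esub> x n \<in> ideal_pow A J n) \<longrightarrow>
        (\<exists>a\<in>carrier A. \<forall>n. a \<ominus>\<^bsub>A\<^esub> x n \<in> ideal_pow A J n))"

text \<open>Continuity of a homomorphism of local rings for the topologies given by their maximal ideals.\<close>

definition adic_continuous ::
    "('a, 'm) ring_scheme \<Rightarrow> ('b, 'n) ring_scheme \<Rightarrow> ('a \<Rightarrow> 'b) \<Rightarrow> bool" where
  "adic_continuous A B f \<longleftrightarrow>
     (\<forall>n. \<exists>m. f ` ideal_pow A (max_ideal A) m \<subseteq> ideal_pow B (max_ideal B) n)"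

definition krull_dim :: "('a, 'm) ring_scheme \<Rightarrow> enat" where
  "krull_dim A =
     Sup {enat n | n. \<exists>P. (\<forall>i\<le>n. primeideal (P i) A) \<and> (\<forall>i<n. P i \<subset> P (Suc i))}"

definition regular_sequence :: "('a, 'm) ring_scheme \<Rightarrow> 'a list \<Rightarrow> bool" where
  "regular_sequence A xs \<longleftrightarrow>
     set xs \<subseteq> carrier A \<and> Idl\<^bsub>A\<^esub> (set xs) \<noteq> carrier A \<and>
     (\<forall>i<length xs. \<forall>a\<in>carrier A.
        xs ! i \<otimes>\<^bsub>A\<^esub> a \<in> Idl\<^bsub>A\<^esub> (set (take i xs)) \<longrightarrow> a \<in> Idl\<^bsub>A\<^esub> (set (take i xs)))"

definition depth :: "('a, 'm) ring_scheme \<Rightarrow> enat" where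
  "depth A = Sup {enat (length xs) | xs. regular_sequence A xs \<and> set xs \<subseteq> max_ideal A}"

definition cohen_macaulay :: "('a, 'm) ring_scheme \<Rightarrow> bool" where
  "cohen_macaulay A \<longleftrightarrow> local_ring A \<and> noetherian_ring A \<and> depth A = krull_dim A"

definition minimal_prime :: "('a, 'm) ring_scheme \<Rightarrow> 'a set \<Rightarrow> bool" where
  "minimal_prime A q \<longleftrightarrow> primeideal q A \<and> (\<forall>q'. primeideal q' A \<and> q' \<subseteq> q \<longrightarrow> q' = q)"

text \<open>A ring which is flat over a discrete valuation ring has relative dimension \<open>d\<close> if it has
  Krull dimension \<open>d + 1\<close>; equidimensional means that this holds on each irreducible component.\<close>

definition relative_dimension :: "('a, 'm) ring_scheme \<Rightarrow> nat \<Rightarrow> bool" where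
  "relative_dimension A d \<longleftrightarrow> krull_dim A = enat (d + 1)"

definition equidimensional :: "('a, 'm) ring_scheme \<Rightarrow> nat \<Rightarrow> bool" where
  "equidimensional A d \<longleftrightarrow> (\<forall>q. minimal_prime A q \<longrightarrow> relative_dimension (A Quot q) d)"


section \<open>Complete Noetherian local algebras\<close>

text \<open>An algebra over \<open>\<O>\<close> is a ring \<open>A\<close> with a structure map \<open>\<alpha>\<close> from \<open>\<O>\<close>. The last two
  conditions say that \<open>A\<close> has the same residue field as \<open>\<O>\<close>.\<close>

definition cnl_algebra :: "'o ring \<Rightarrow> ('a, 'm) ring_scheme \<Rightarrow> ('o \<Rightarrow> 'a) \<Rightarrow> bool" where
  "cnl_algebra \<O> A \<alpha> \<longleftrightarrow>
     local_ring A \<and> noetherian_ring A \<and> adically_complete A (max_ideal A) \<and>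
     \<alpha> \<in> ring_hom \<O> A \<and> \<alpha> ` max_ideal \<O> \<subseteq> max_ideal A \<and>
     induced_quot_map A (max_ideal A) \<alpha> \<in> ring_iso (\<O> Quot max_ideal \<O>) (A Quot max_ideal A)"

definition algebra_hom ::
    "'o ring \<Rightarrow> ('a, 'm) ring_scheme \<Rightarrow> ('o \<Rightarrow> 'a) \<Rightarrow> ('b, 'n) ring_scheme \<Rightarrow> ('o \<Rightarrow> 'b)
      \<Rightarrow> ('a \<Rightarrow> 'b) \<Rightarrow> bool" where
  "algebra_hom \<O> A \<alpha> B \<beta> f \<longleftrightarrow> f \<in> ring_hom A B \<and> (\<forall>a\<in>carrier \<O>. f (\<alpha> a) = \<beta> a)"

definition augmentation ::
    "'o ring \<Rightarrow> ('a, 'm) ring_scheme \<Rightarrow> ('o \<Rightarrow> 'a) \<Rightarrow> ('a \<Rightarrow> 'o) \<Rightarrow> bool" where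
  "augmentation \<O> A \<alpha> lam \<longleftrightarrow>
     algebra_hom \<O> A \<alpha> \<O> (\<lambda>a. a) lam \<and> lam ` carrier A = carrier \<O>"

text \<open>\<open>\<O>[[y\<^sub>0, \<dots>, y\<^sub>d\<^sub>-\<^sub>1]]\<close>. As for the indexed polynomials of HOL-Algebra, a monomial is the
  multiset of the indices of its variables.\<close>

definition power_series_ring :: "'o ring \<Rightarrow> nat \<Rightarrow> (nat multiset \<Rightarrow> 'o) ring" where
  "power_series_ring \<O> d =
     \<lparr> carrier = {F. \<forall>m. F m \<in> carrier \<O> \<and> (\<not> set_mset m \<subseteq> {..<d} \<longrightarrow> F m = \<zero>\<^bsub>\<O>\<^esub>)},
       monoid.mult = (\<lambda>F G m. \<Oplus>\<^bsub>\<O>\<^esub>a\<in>{a. a \<subseteq># m}. F a \<otimes>\<^bsub>\<O>\<^esub> G (m - a)),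
       one = (\<lambda>m. if m = {#} then \<one>\<^bsub>\<O>\<^esub> else \<zero>\<^bsub>\<O>\<^esub>),
       ring.zero = (\<lambda>m. \<zero>\<^bsub>\<O>\<^esub>),
       add = (\<lambda>F G m. F m \<oplus>\<^bsub>\<O>\<^esub> G m) \<rparr>"

definition ps_const :: "'o ring \<Rightarrow> 'o \<Rightarrow> nat multiset \<Rightarrow> 'o" where
  "ps_const \<O> a = (\<lambda>m. if m = {#} then a else \<zero>\<^bsub>\<O>\<^esub>)"

definition ps_var :: "'o ring \<Rightarrow> nat \<Rightarrow> nat multiset \<Rightarrow> 'o" where
  "ps_var \<O> i = (\<lambda>m. if m = {#i#} then \<one>\<^bsub>\<O>\<^esub> else \<zero>\<^bsub>\<O>\<^esub>)"

text \<open>Complete intersection: the quotient of a regular local ring by a regular sequence. A complete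
  Noetherian local \<open>\<O>\<close>-algebra with the residue field of \<open>\<O>\<close> is a quotient of some power series
  ring over \<open>\<O>\<close>, and this is the regular ring that is used.\<close>

definition complete_intersection :: "'o ring \<Rightarrow> ('a, 'm) ring_scheme \<Rightarrow> ('o \<Rightarrow> 'a) \<Rightarrow> bool" where
  "complete_intersection \<O> A \<alpha> \<longleftrightarrow>
     (\<exists>n fs \<psi>.
        regular_sequence (power_series_ring \<O> n) fs \<and>
        algebra_hom \<O> (power_series_ring \<O> n) (ps_const \<O>) A \<alpha> \<psi> \<and>
        \<psi> ` carrier (power_series_ring \<O> n) = carrier A \<and>
        a_kernel (power_series_ring \<O> n) A \<psi> = Idl\<^bsub>power_series_ring \<O> n\<^esub> (set fs))"


section \<open>Localization and formal smoothness at a point of the generic fibre\<close>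

text \<open>\<open>fraction A M a s\<close> is the class of all pairs representing \<open>a/s\<close> in the localization at \<open>M\<close>.\<close>

definition fraction :: "('a, 'm) ring_scheme \<Rightarrow> 'a set \<Rightarrow> 'a \<Rightarrow> 'a \<Rightarrow> ('a \<times> 'a) set" where
  "fraction A M a s =
     {(b, t). b \<in> carrier A \<and> t \<in> M \<and> (\<exists>u\<in>M. u \<otimes>\<^bsub>A\<^esub> (a \<otimes>\<^bsub>A\<^esub> t) = u \<otimes>\<^bsub>A\<^esub> (b \<otimes>\<^bsub>A\<^esub> s))}"

definition localization :: "('a, 'm) ring_scheme \<Rightarrow> 'a set \<Rightarrow> ('a \<times> 'a) set ring" where
  "localization A M =
     \<lparr> carrier = {fraction A M a s | a s. a \<in> carrier A \<and> s \<in> M},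
       monoid.mult = (\<lambda>U V. \<Union>(a, s)\<in>U. \<Union>(b, t)\<in>V. fraction A M (a \<otimes>\<^bsub>A\<^esub> b) (s \<otimes>\<^bsub>A\<^esub> t)),
       one = fraction A M \<one>\<^bsub>A\<^esub> \<one>\<^bsub>A\<^esub>,
       ring.zero = fraction A M \<zero>\<^bsub>A\<^esub> \<one>\<^bsub>A\<^esub>,
       add = (\<lambda>U V. \<Union>(a, s)\<in>U. \<Union>(b, t)\<in>V.
                fraction A M ((a \<otimes>\<^bsub>A\<^esub> t) \<oplus>\<^bsub>A\<^esub> (b \<otimes>\<^bsub>A\<^esub> s)) (s \<otimes>\<^bsub>A\<^esub> t)) \<rparr>"

definition powers :: "('a, 'm) ring_scheme \<Rightarrow> 'a \<Rightarrow> 'a set" where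
  "powers A x = {x [^]\<^bsub>A\<^esub> n | n :: nat. True}"

text \<open>\<open>B\<close>, with the \<open>J\<close>-adic topology, is formally smooth over \<open>A\<close> (EGA 0-IV, 19.3.1): continuous
  homomorphisms from \<open>B\<close> to a discrete \<open>A\<close>-algebra \<open>C/N\<close> with \<open>N\<^sup>2 = 0\<close> lift to continuous ones to
  \<open>C\<close>. A lifting problem can be replaced by one in the subring of \<open>C\<close> generated by the image of
  \<open>A\<close> and by representatives of the image of \<open>B\<close>. So if \<open>B\<close> is infinite and has at least the
  cardinality of \<open>A\<close>, as below, then no generality is lost by taking \<open>C\<close> on the type of \<open>B\<close>.\<close>

definition formally_smooth ::
    "('a, 'm) ring_scheme \<Rightarrow> ('a \<Rightarrow> 'b) \<Rightarrow> 'b ring \<Rightarrow> 'b set \<Rightarrow> bool" where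
  "formally_smooth A f B J \<longleftrightarrow>
     (\<forall>(C :: 'b ring) N g u.
        cring C \<and> ideal N C \<and> ideal_prod C N N = {\<zero>\<^bsub>C\<^esub>} \<and> g \<in> ring_hom A C \<and>
        u \<in> ring_hom B (C Quot N) \<and> (\<exists>n. u ` ideal_pow B J n \<subseteq> {\<zero>\<^bsub>C Quot N\<^esub>}) \<and>
        (\<forall>a\<in>carrier A. u (f a) = N +>\<^bsub>C\<^esub> g a) \<longrightarrow>
        (\<exists>v \<in> ring_hom B C. (\<exists>n. v ` ideal_pow B J n \<subseteq> {\<zero>\<^bsub>C\<^esub>}) \<and>
           (\<forall>a\<in>carrier A. v (f a) = g a) \<and> (\<forall>b\<in>carrier B. u b = N +>\<^bsub>C\<^esub> v b)))"

definition generic_fibre :: "('a, 'm) ring_scheme \<Rightarrow> 'a \<Rightarrow> ('a \<times> 'a) set ring" where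
  "generic_fibre R w = localization R (powers R w)"

text \<open>Here \<open>w\<close> is the image of the uniformizer in \<open>R\<close>. The prime of \<open>R[1/w]\<close> given by an
  augmentation is the kernel of \<open>lam[1/w] : R[1/w] \<rightarrow> E\<close>.\<close>

definition generic_point ::
    "'o ring \<Rightarrow> ('a, 'm) ring_scheme \<Rightarrow> 'a \<Rightarrow> ('a \<Rightarrow> 'o) \<Rightarrow> ('a \<times> 'a) set set" where
  "generic_point \<O> R w lam =
     {fraction R (powers R w) x s | x s. x \<in> a_kernel R \<O> lam \<and> s \<in> powers R w}"

definition generic_stalk ::
    "'o ring \<Rightarrow> ('a, 'm) ring_scheme \<Rightarrow> 'a \<Rightarrow> ('a \<Rightarrow> 'o)
      \<Rightarrow> (('a \<times> 'a) set \<times> ('a \<times> 'a) set) set ring" where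
  "generic_stalk \<O> R w lam =
     localization (generic_fibre R w) (carrier (generic_fibre R w) - generic_point \<O> R w lam)"

text \<open>The structure map of the stalk as an \<open>E\<close>-algebra: an element \<open>e = a/\<pi>\<^sup>n\<close> of \<open>E\<close>, with
  \<open>a\<close> in \<open>\<O>\<close>, goes to \<open>\<alpha> a/(\<alpha> \<pi>)\<^sup>n\<close>.\<close>

definition stalk_structure_map ::
    "'o ring \<Rightarrow> 'o ring \<Rightarrow> 'o \<Rightarrow> ('a, 'm) ring_scheme \<Rightarrow> ('o \<Rightarrow> 'a) \<Rightarrow> ('a \<Rightarrow> 'o)
      \<Rightarrow> 'o \<Rightarrow> (('a \<times> 'a) set \<times> ('a \<times> 'a) set) set" where
  "stalk_structure_map E \<O> \<pi> R \<alpha> lam e =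
     (THE U. \<exists>a\<in>carrier \<O>. \<exists>n :: nat. a = e \<otimes>\<^bsub>E\<^esub> \<pi> [^]\<^bsub>E\<^esub> n \<and>
        U = fraction (generic_fibre R (\<alpha> \<pi>))
              (carrier (generic_fibre R (\<alpha> \<pi>)) - generic_point \<O> R (\<alpha> \<pi>) lam)
              (fraction R (powers R (\<alpha> \<pi>)) (\<alpha> a) (\<alpha> \<pi> [^]\<^bsub>R\<^esub> n))
              \<one>\<^bsub>generic_fibre R (\<alpha> \<pi>)\<^esub>)"

definition generically_smooth_at ::
    "'o ring \<Rightarrow> 'o ring \<Rightarrow> 'o \<Rightarrow> ('a, 'm) ring_scheme \<Rightarrow> ('o \<Rightarrow> 'a) \<Rightarrow> ('a \<Rightarrow> 'o) \<Rightarrow> bool" where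
  "generically_smooth_at E \<O> \<pi> R \<alpha> lam \<longleftrightarrow>
     formally_smooth E (stalk_structure_map E \<O> \<pi> R \<alpha> lam)
       (generic_stalk \<O> R (\<alpha> \<pi>) lam) (max_ideal (generic_stalk \<O> R (\<alpha> \<pi>) lam))"


section \<open>The properties (P) and (CI) and the invariant\<close>

definition variable_ideal ::
    "'o ring \<Rightarrow> nat \<Rightarrow> ('a, 'm) ring_scheme \<Rightarrow> ((nat multiset \<Rightarrow> 'o) \<Rightarrow> 'a) \<Rightarrow> 'a set" where
  "variable_ideal \<O> d A \<theta> = Idl\<^bsub>A\<^esub> {\<theta> (ps_var \<O> i) | i. i < d}"

definition variable_quotient ::
    "'o ring \<Rightarrow> nat \<Rightarrow> ('a, 'm) ring_scheme \<Rightarrow> ((nat multiset \<Rightarrow> 'o) \<Rightarrow> 'a) \<Rightarrow> 'a set ring" where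
  "variable_quotient \<O> d A \<theta> = A Quot variable_ideal \<O> d A \<theta>"

text \<open>A continuous \<open>\<O>\<close>-algebra map from \<open>S = \<O>[[y\<^sub>0, \<dots>, y\<^sub>d\<^sub>-\<^sub>1]]\<close> making \<open>A\<close> a finite free \<open>S\<close>-module.\<close>

definition finite_free_map ::
    "'o ring \<Rightarrow> nat \<Rightarrow> ('a, 'm) ring_scheme \<Rightarrow> ('o \<Rightarrow> 'a) \<Rightarrow> ((nat multiset \<Rightarrow> 'o) \<Rightarrow> 'a) \<Rightarrow> bool" where
  "finite_free_map \<O> d A \<alpha> \<theta> \<longleftrightarrow>
     algebra_hom \<O> (power_series_ring \<O> d) (ps_const \<O>) A \<alpha> \<theta> \<and>
     adic_continuous (power_series_ring \<O> d) A \<theta> \<and>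
     finite_free (power_series_ring \<O> d) (restrict_scalars \<theta> A)"

definition property_P ::
    "'o ring \<Rightarrow> nat \<Rightarrow> ('a, 'm) ring_scheme \<Rightarrow> ('o \<Rightarrow> 'a) \<Rightarrow> ('a \<Rightarrow> 'o)
      \<Rightarrow> ((nat multiset \<Rightarrow> 'o) \<Rightarrow> 'a) \<Rightarrow> bool" where
  "property_P \<O> d R \<alpha> lam \<theta> \<longleftrightarrow>
     finite_free_map \<O> d R \<alpha> \<theta> \<and>
     (\<forall>i<d. \<theta> (ps_var \<O> i) \<in> a_kernel R \<O> lam) \<and>
     (let R\<theta> = variable_quotient \<O> d R \<theta>; K = a_kernel R\<theta> \<O> (induced_map lam)
      in finite (carrier (ideal_quotient R\<theta> K (ideal_prod R\<theta> K K))))"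

definition property_CI ::
    "'o ring \<Rightarrow> 'o ring \<Rightarrow> 'o \<Rightarrow> nat \<Rightarrow> ('r, 'm) ring_scheme \<Rightarrow> ('o \<Rightarrow> 'r) \<Rightarrow> ('r \<Rightarrow> 'o)
      \<Rightarrow> ('q, 'n) ring_scheme \<Rightarrow> ('o \<Rightarrow> 'q) \<Rightarrow> 'q set \<Rightarrow> ('q \<Rightarrow> 'r) \<Rightarrow> bool" where
  "property_CI E \<O> \<pi> d R \<alpha> lam Rt \<alpha>t I \<phi> \<longleftrightarrow>
     cnl_algebra \<O> Rt \<alpha>t \<and> flat_module \<O> (restrict_scalars \<alpha>t Rt) \<and> equidimensional Rt d \<and>
     complete_intersection \<O> Rt \<alpha>t \<and>
     algebra_hom \<O> Rt \<alpha>t R \<alpha> \<phi> \<and> adic_continuous Rt R \<phi> \<and> \<phi> ` carrier Rt = carrier R \<and>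
     I = a_kernel Rt R \<phi> \<and>
     generically_smooth_at E \<O> \<pi> Rt \<alpha>t (lam \<circ> \<phi>)"

text \<open>\<open>lam(A[I]) / lam(Fitt(I))\<close>\<close>

definition C1_module :: "'o ring \<Rightarrow> ('a, 'm) ring_scheme \<Rightarrow> 'a set \<Rightarrow> ('a \<Rightarrow> 'o) \<Rightarrow> ('o, 'o set) module" where
  "C1_module \<O> A I lam =
     ideal_quotient \<O> (lam ` annihilator A I) (lam ` fitting_ideal A (ideal_module A I))"

text \<open>The invariant \<open>C\<^sub>1\<close> of \<open>R\<^sub>\<theta>\<close>, computed from \<open>\<theta>\<close> and its lift \<open>\<theta>t\<close> to \<open>Rt\<close>.\<close>

definition C1_theta ::
    "'o ring \<Rightarrow> nat \<Rightarrow> ('r, 'm) ring_scheme \<Rightarrow> ('r \<Rightarrow> 'o) \<Rightarrow> ('q, 'n) ring_scheme \<Rightarrow> ('q \<Rightarrow> 'r)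
      \<Rightarrow> ((nat multiset \<Rightarrow> 'o) \<Rightarrow> 'r) \<Rightarrow> ((nat multiset \<Rightarrow> 'o) \<Rightarrow> 'q) \<Rightarrow> ('o, 'o set) module" where
  "C1_theta \<O> d R lam Rt \<phi> \<theta> \<theta>t =
     C1_module \<O> (variable_quotient \<O> d Rt \<theta>t)
       (a_kernel (variable_quotient \<O> d Rt \<theta>t) (variable_quotient \<O> d R \<theta>)
          (induced_quot_map R (variable_ideal \<O> d R \<theta>) \<phi>))
       (induced_map (lam \<circ> \<phi>))"

end

(* Write A for Rt, S for O[[y_1, ..., y_d]] and m for the maximal ideal of S. Both A and R are finite
   free over S, and A is the quotient of P = O[[x_1, ..., x_n]] by a regular sequence. Appending lifts
   of y_1, ..., y_d and pi to it gives a regular sequence z of P with P/(z) = A/mA. Adding the elements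
   of z one at a time and following the Koszul cohomology of P/(z_1, ..., z_j) with respect to the
   generators x_1, ..., x_n, pi of the maximal ideal of P shows that the socle of A/mA is at most
   one-dimensional. The maximal ideal of A is nilpotent modulo mA, so every nonzero ideal of A/mA
   contains the socle, and an S-linear functional L on A which is a unit on a socle element gives a
   form L(ab) that is nondegenerate modulo m, hence perfect.

   Let e be the S-linear map A -> A obtained by composing phi with an S-linear section of phi. If a I
   lies in (y)A, then x |-> L(a e(x)) vanishes on I and therefore equals x |-> L(a'x) for some a' in
   A[I]; moreover L((a - a')x) = L(a(x - e(x))) lies in (y)S for all x, so a - a' lies in (y)A. This
   is (1). For (2), the map 1 - e is S-linear, maps A to I and fixes I, so I meets (y)A in (y)I.
   Hence, with Nakayama's lemma, generators of I_theta and their relations lift to generators of I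
   and their relations. *)

theory Submission
  imports Defs
begin

text \<open>Statement (1) is relative duality. A perfect form identifies A with Hom_S(A, S), and
  A[I] then becomes the functionals that vanish on I, that is Hom_S(R, S); because R is free over S,
  this module commutes with reduction modulo y. For a general finite free A the annihilator of
  I_theta can exceed the image of A[I]; the form is where the complete intersection property enters.
  The obstacle is that the length of the regular sequence presenting A is not given. Instead of
  dimension theory, the Koszul complex treats every length: if z is shorter than the list of
  generators of the maximal ideal of P, the socle of P/(z) is zero; if the lengths agree, it embeds
  in the top cohomology of P, which is the residue field; a longer z is excluded by exchanging the
  roles of the two sequences. The residue field never appears as a ring. One-dimensionality of the
  socle is a relation between any two of its elements in which some coefficient is a unit, and
  linear algebra over the residue field is elimination with entries in the local ring, which yields
  perfectness over S at once.\<close>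

section \<open>Ideals\<close>

context cring
begin

lemma ideal_zero: "ideal J R \<Longrightarrow> \<zero> \<in> J"
  by (simp add: additive_subgroup.zero_closed ideal.axioms(1))

lemma ideal_carr: "ideal J R \<Longrightarrow> a \<in> J \<Longrightarrow> a \<in> carrier R"
  by (rule ideal.Icarr)

lemma ideal_add: "ideal J R \<Longrightarrow> a \<in> J \<Longrightarrow> b \<in> J \<Longrightarrow> a \<oplus> b \<in> J"
  by (simp add: additive_subgroup.a_closed ideal.axioms(1))

lemma ideal_neg: "ideal J R \<Longrightarrow> a \<in> J \<Longrightarrow> \<ominus> a \<in> J"
  by (simp add: additive_subgroup.a_inv_closed ideal.axioms(1))

lemma ideal_diff: "ideal J R \<Longrightarrow> a \<in> J \<Longrightarrow> b \<in> J \<Longrightarrow> a \<ominus> b \<in> J"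
  by (simp add: minus_eq ideal_add ideal_neg)

lemma ideal_mult: "ideal J R \<Longrightarrow> a \<in> J \<Longrightarrow> c \<in> carrier R \<Longrightarrow> c \<otimes> a \<in> J"
  by (rule ideal.I_l_closed)

lemmas ideal_rules = ideal_zero ideal_add ideal_neg ideal_diff ideal_mult

lemma ideal_closureI:
  assumes "K \<subseteq> carrier R" "\<zero> \<in> K" "\<And>a b. a \<in> K \<Longrightarrow> b \<in> K \<Longrightarrow> a \<oplus> b \<in> K"
    and m: "\<And>a c. a \<in> K \<Longrightarrow> c \<in> carrier R \<Longrightarrow> c \<otimes> a \<in> K"
  shows "ideal K R"
proof (rule idealI[OF ring_axioms])
  have K: "a \<in> carrier R" if "a \<in> K" for a using assms(1) that by blast
  show "subgroup K (add_monoid R)"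
  proof (rule add.subgroupI)
    show "\<ominus> a \<in> K" if "a \<in> K" for a using m[OF that, of "\<ominus> \<one>"] K[OF that] by (simp add: l_minus)
  qed (use assms in auto)
  show "\<And>a c. a \<in> K \<Longrightarrow> c \<in> carrier R \<Longrightarrow> c \<otimes> a \<in> K" by (rule m)
  show "a \<otimes> c \<in> K" if "a \<in> K" "c \<in> carrier R" for a c
    using m[OF that] m_comm[OF K[OF that(1)] that(2)] by simp
qed

lemma colon_ideal:
  assumes "ideal J R" "x \<in> carrier R"
  shows "ideal {r \<in> carrier R. r \<otimes> x \<in> J} R"
  using assms ideal_zero[OF assms(1)]
  by (intro ideal_closureI) (auto simp: l_distr m_assoc intro: ideal_add ideal_mult)

text \<open>This form lets inductions along a sequence pass from the ideal of its first elements to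
  the ideal with one more.\<close>

lemma Idl_insert:
  assumes "a \<in> carrier R" "Y \<subseteq> carrier R"
  shows "x \<in> Idl (insert a Y) \<longleftrightarrow> (\<exists>j\<in>Idl Y. \<exists>r\<in>carrier R. x = j \<oplus> r \<otimes> a)"
proof -
  have "Idl (Idl Y \<union> PIdl a) = Idl Y <+> PIdl a"
    using union_genideal[OF genideal_ideal[OF assms(2)] cgenideal_ideal[OF assms(1)]] .
  moreover have "Idl (Idl Y \<union> PIdl a) = Idl (insert a Y)"
  proof (rule antisym)
    have *: "insert a Y \<subseteq> carrier R" using assms by auto
    have "Idl Y \<subseteq> Idl (insert a Y)"
      using genideal_minimal[OF genideal_ideal[OF *]] genideal_self[OF *] by auto
    moreover have "PIdl a \<subseteq> Idl (insert a Y)"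
      using cgenideal_minimal[OF genideal_ideal[OF *]] genideal_self[OF *] by auto
    ultimately show "Idl (Idl Y \<union> PIdl a) \<subseteq> Idl (insert a Y)"
      using genideal_minimal[OF genideal_ideal[OF *]] by auto
    have **: "Idl Y \<union> PIdl a \<subseteq> carrier R"
      using genideal_ideal[OF assms(2)] cgenideal_ideal[OF assms(1)]
      by (meson Un_least additive_subgroup.a_subset ideal_def)
    have "insert a Y \<subseteq> Idl Y \<union> PIdl a"
      using genideal_self[OF assms(2)] cgenideal_self[OF assms(1)] by auto
    then show "Idl (insert a Y) \<subseteq> Idl (Idl Y \<union> PIdl a)"
      using genideal_minimal[OF genideal_ideal[OF **]] genideal_self[OF **] by (meson dual_order.trans)
  qed
  ultimately have "Idl (insert a Y) = Idl Y <+> PIdl a" by simp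
  then show ?thesis
    by (auto simp: set_add_def' cgenideal_def)
qed

lemma Idl_empty: "Idl {} = {\<zero>}"
  using genideal_minimal[OF zeroideal, of "{}"] genideal_ideal[of "{}"]
  by (simp add: additive_subgroup.zero_closed ideal.axioms(1) subset_antisym)

end

section \<open>The Koszul complex as an iterated mapping cone\<close>

section \<open>Koszul cohomology\<close>

text \<open>A cochain assigns a coefficient to each set of indices; only its values on subsets of \<open>{..<n}\<close>
  matter. The recursion is the mapping cone of multiplication by \<open>t n\<close>.\<close>

primrec koszul_d :: "('a, 'm) ring_scheme \<Rightarrow> (nat \<Rightarrow> 'a) \<Rightarrow> nat \<Rightarrow> (nat set \<Rightarrow> 'a) \<Rightarrow> nat set \<Rightarrow> 'a" where
  "koszul_d R t 0 x = (\<lambda>A. \<zero>\<^bsub>R\<^esub>)"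
| "koszul_d R t (Suc n) x = (\<lambda>A.
     if n \<in> A then t n \<otimes>\<^bsub>R\<^esub> x (A - {n}) \<ominus>\<^bsub>R\<^esub> koszul_d R t n (\<lambda>B. x (insert n B)) (A - {n})
     else koszul_d R t n x A)"

text \<open>Degrees are integers so that \<open>p - 1\<close> makes sense at \<open>p = 0\<close>,
  where it leaves only the zero cochain. Values off the subsets of \<open>{..<n}\<close> are still
  required to lie in the ring, which spares side conditions in computations.\<close>

definition koszul_homogeneous :: "('a, 'm) ring_scheme \<Rightarrow> nat \<Rightarrow> int \<Rightarrow> (nat set \<Rightarrow> 'a) \<Rightarrow> bool" where
  "koszul_homogeneous R n p x \<longleftrightarrow>
     (\<forall>A. x A \<in> carrier R) \<and> (\<forall>A\<subseteq>{..<n}. int (card A) \<noteq> p \<longrightarrow> x A = \<zero>\<^bsub>R\<^esub>)"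

text \<open>Needed because identities for \<open>x (insert n B)\<close> typically hold only when
  \<open>n\<close> is not in \<open>B\<close>; the recursion visits no other
  \<open>B\<close>.\<close>

lemma koszul_d_cong: "(\<And>B. B \<subseteq> A \<Longrightarrow> x B = y B) \<Longrightarrow> koszul_d R t n x A = koszul_d R t n y A"
proof (induction n arbitrary: x y A)
  case (Suc n)
  show ?case
  proof (cases "n \<in> A")
    case True
    have "koszul_d R t n (\<lambda>B. x (insert n B)) (A - {n}) = koszul_d R t n (\<lambda>B. y (insert n B)) (A - {n})"
      using True by (intro Suc.IH Suc.prems) auto
    then show ?thesis using True Suc.prems[of "A - {n}"] by auto
  next
    case False
    have "koszul_d R t n x A = koszul_d R t n y A" by (intro Suc.IH Suc.prems)
    then show ?thesis using False by simp
  qed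
qed simp

locale koszul = cring +
  fixes t :: "nat \<Rightarrow> 'a"
  assumes t_closed [simp]: "\<And>i. t i \<in> carrier R"
begin

abbreviation kd where "kd \<equiv> koszul_d R t"
abbreviation homog where "homog \<equiv> koszul_homogeneous R"



text \<open>The differential has coefficients in the ring, so the complex descends to the quotient
  by \<open>J\<close>. The unit ideal gives closedness, and the zero ideal gives vanishing on zero
  cochains.\<close>

lemma koszul_d_ideal:
  assumes "ideal J R"
  shows "(\<And>B. B \<subseteq> A \<Longrightarrow> x B \<in> J) \<Longrightarrow> kd n x A \<in> J"
proof (induction n arbitrary: x A)
  case 0 then show ?case using assms by (simp add: additive_subgroup.zero_closed ideal.axioms(1))
next
  case (Suc n)
  show ?case
  proof (cases "n \<in> A")
    case True
    have "kd n (\<lambda>B. x (insert n B)) (A - {n}) \<in> J"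
      using True by (intro Suc.IH Suc.prems) auto
    moreover have "t n \<otimes> x (A - {n}) \<in> J" using Suc.prems[of "A - {n}"] assms
      by (auto intro: ideal_rules)
    ultimately show ?thesis using True assms by (auto intro: ideal_rules)
  qed (use Suc in simp)
qed

lemma koszul_d_closed [simp]: "(\<And>A. x A \<in> carrier R) \<Longrightarrow> kd n x A \<in> carrier R"
  using koszul_d_ideal[OF oneideal] by blast

lemma koszul_d_add:
  "(\<And>A. x A \<in> carrier R) \<Longrightarrow> (\<And>A. y A \<in> carrier R) \<Longrightarrow>
     kd n (\<lambda>A. x A \<oplus> y A) A = kd n x A \<oplus> kd n y A"
proof (induction n arbitrary: x y A)
  case (Suc n)
  define a b c d where "a = x (A - {n})" "b = y (A - {n})" "c = kd n (\<lambda>B. x (insert n B)) (A - {n})"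
    "d = kd n (\<lambda>B. y (insert n B)) (A - {n})"
  have "a \<in> carrier R" "b \<in> carrier R" "c \<in> carrier R" "d \<in> carrier R"
    using Suc.prems by (auto simp: a_b_c_d_def)
  then have "t n \<otimes> (a \<oplus> b) \<ominus> (c \<oplus> d) = (t n \<otimes> a \<ominus> c) \<oplus> (t n \<otimes> b \<ominus> d)"
    using t_closed[of n] by algebra
  then show ?case using Suc by (simp add: a_b_c_d_def)
qed simp

lemma koszul_d_smult:
  "c \<in> carrier R \<Longrightarrow> (\<And>A. x A \<in> carrier R) \<Longrightarrow> kd n (\<lambda>A. c \<otimes> x A) A = c \<otimes> kd n x A"
proof (induction n arbitrary: x A)
  case (Suc n)
  define a b where "a = x (A - {n})" "b = kd n (\<lambda>B. x (insert n B)) (A - {n})"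
  have "a \<in> carrier R" "b \<in> carrier R"
    using Suc.prems by (auto simp: a_b_def)
  then have "t n \<otimes> (c \<otimes> a) \<ominus> c \<otimes> b = c \<otimes> (t n \<otimes> a \<ominus> b)"
    using t_closed[of n] Suc.prems(1) by algebra
  then show ?case using Suc by (simp add: a_b_def)
qed simp

lemma koszul_d_diff:
  assumes "\<And>A. x A \<in> carrier R" "\<And>A. y A \<in> carrier R"
  shows "kd n (\<lambda>A. x A \<ominus> y A) A = kd n x A \<ominus> kd n y A"
proof -
  have "kd n (\<lambda>A. \<ominus> y A) A = kd n (\<lambda>A. (\<ominus> \<one>) \<otimes> y A) A"
    using assms by (simp add: l_minus)
  also have "\<dots> = \<ominus> kd n y A"
    using assms by (subst koszul_d_smult) (auto simp: l_minus)
  finally show ?thesis unfolding minus_eq using assms by (subst koszul_d_add) auto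
qed

text \<open>In a component that contains the last index, \<open>t n\<close> times the lower
  differential of \<open>x\<close> occurs twice with opposite signs; what remains is the square of
  the lower differential.\<close>

lemma koszul_d_d: "(\<And>A. x A \<in> carrier R) \<Longrightarrow> kd n (kd n x) A = \<zero>"
proof (induction n arbitrary: x A)
  case (Suc n)
  show ?case
  proof (cases "n \<in> A")
    case False
    have "kd n (kd (Suc n) x) A = kd n (kd n x) A"
      by (rule koszul_d_cong) (use False in auto)
    then show ?thesis using Suc False by simp
  next
    case True
    let ?x1 = "\<lambda>B. x (insert n B)" and ?A = "A - {n}"
    have "kd n (\<lambda>B. kd (Suc n) x (insert n B)) ?A = kd n (\<lambda>B. t n \<otimes> x B \<ominus> kd n ?x1 B) ?A"
      by (rule koszul_d_cong) (simp add: insert_Diff_if subset_Diff_insert)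
    also have "\<dots> = t n \<otimes> kd n x ?A \<ominus> kd n (kd n ?x1) ?A"
      using Suc.prems by (simp add: koszul_d_diff koszul_d_smult)
    also have "\<dots> = t n \<otimes> kd n x ?A"
      using Suc by (simp add: minus_eq)
    finally show ?thesis using True Suc.prems by (simp add: r_neg minus_eq)
  qed
qed simp

lemma homogD:
  "homog n p x \<Longrightarrow> A \<subseteq> {..<n} \<Longrightarrow> int (card A) \<noteq> p \<Longrightarrow> x A = \<zero>"
  "homog n p x \<Longrightarrow> x A \<in> carrier R"
  unfolding koszul_homogeneous_def by blast+

text \<open>The two components of an element of the mapping cone; the one carrying the index
  \<open>n\<close> loses a degree.\<close>

lemma homog_Suc:
  assumes "homog (Suc n) p x"
  shows "homog n p x" "homog n (p - 1) (\<lambda>B. x (insert n B))"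
proof -
  show "homog n p x"
    unfolding koszul_homogeneous_def
  proof (intro conjI allI impI)
    fix A assume "A \<subseteq> {..<n}" "int (card A) \<noteq> p"
    then show "x A = \<zero>" by (intro homogD(1)[OF assms]) auto
  qed (rule homogD[OF assms])
  show "homog n (p - 1) (\<lambda>B. x (insert n B))"
    unfolding koszul_homogeneous_def
  proof (intro conjI allI impI)
    fix B assume B: "B \<subseteq> {..<n}" "int (card B) \<noteq> p - 1"
    then have "n \<notin> B" "finite B" by (auto intro: finite_subset)
    moreover have "insert n B \<subseteq> {..<Suc n}" using B by auto
    ultimately show "x (insert n B) = \<zero>" using B(2)
      by (intro homogD(1)[OF assms]) auto
  qed (rule homogD[OF assms])
qed

lemma subset_lessThan_Suc_cases:
  assumes "A \<subseteq> {..<Suc n}"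
  obtains "A \<subseteq> {..<n}" "n \<notin> A" | B where "A = insert n B" "B \<subseteq> {..<n}" "n \<notin> B" "card A = Suc (card B)"
proof (cases "n \<in> A")
  case True
  then have "A = insert n (A - {n})" "A - {n} \<subseteq> {..<n}" "card A = Suc (card (A - {n}))"
    using assms card_Suc_Diff1[of A n] finite_subset[OF assms] by (auto simp: less_Suc_eq)
  then show ?thesis using that(2) by blast
next
  case False
  then have "A \<subseteq> {..<n}" using assms by (auto simp: less_Suc_eq)
  then show ?thesis using False that(1) by blast
qed

lemma kd_homog:
  assumes "homog n p x"
  shows "homog n (p + 1) (kd n x)"
proof -
  have "homog n p x \<Longrightarrow> int (card A) \<noteq> p + 1 \<Longrightarrow> A \<subseteq> {..<n} \<Longrightarrow> kd n x A = \<zero>" for A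
  proof (induction n arbitrary: x A p)
    case (Suc n)
    note h = homog_Suc[OF Suc.prems(1)]
    from Suc.prems(3) show ?case
    proof (cases rule: subset_lessThan_Suc_cases)
      case 1 then show ?thesis using Suc.IH[OF h(1)] Suc.prems by simp
    next
      case (2 B)
      then have "kd n (\<lambda>B. x (insert n B)) B = \<zero>" "x B = \<zero>"
        using Suc.IH[OF h(2)] homogD(1)[OF h(1)] Suc.prems by auto
      then show ?thesis using 2 by (simp add: minus_eq)
    qed
  qed simp
  then show ?thesis unfolding koszul_homogeneous_def[of R n "p + 1"]
    using assms homogD(2)[OF assms] by simp
qed

end

text \<open>Reassembles a cochain from its two mapping cone components, inverse to the splitting in
  \<open>homog_Suc\<close>.\<close>

definition koszul_glue :: "nat \<Rightarrow> (nat set \<Rightarrow> 'a) \<Rightarrow> (nat set \<Rightarrow> 'a) \<Rightarrow> nat set \<Rightarrow> 'a" where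
  "koszul_glue n u v = (\<lambda>A. if n \<in> A then v (A - {n}) else u A)"

context cring
begin

lemma Idl_subset_carrier: "Y \<subseteq> carrier R \<Longrightarrow> x \<in> Idl Y \<Longrightarrow> x \<in> carrier R"
  using ideal_carr genideal_ideal by blast

lemma Idl_memI: "Y \<subseteq> carrier R \<Longrightarrow> x \<in> Y \<Longrightarrow> x \<in> Idl Y"
  using genideal_self by blast

end

context koszul
begin


lemma koszul_glue_homog:
  assumes "homog n p u" "homog n (p - 1) v"
  shows "homog (Suc n) p (koszul_glue n u v)"
  unfolding koszul_homogeneous_def
proof (intro conjI allI impI)
  fix A show "koszul_glue n u v A \<in> carrier R"
    using homogD(2)[OF assms(1)] homogD(2)[OF assms(2)]
    by (simp add: koszul_glue_def)
next
  fix A assume A: "A \<subseteq> {..<Suc n}" "int (card A) \<noteq> p"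
  from A(1) show "koszul_glue n u v A = \<zero>"
  proof (cases rule: subset_lessThan_Suc_cases)
    case 1 then show ?thesis using homogD(1)[OF assms(1)] A by (simp add: koszul_glue_def)
  next
    case (2 B) then show ?thesis using homogD(1)[OF assms(2), of B] A by (simp add: koszul_glue_def)
  qed
qed

lemma koszul_d_glue:
  assumes "\<And>A. u A \<in> carrier R" "\<And>A. v A \<in> carrier R" "n \<notin> B"
  shows "kd (Suc n) (koszul_glue n u v) B = kd n u B"
    "kd (Suc n) (koszul_glue n u v) (insert n B) = t n \<otimes> u B \<ominus> kd n v B"
proof -
  have "kd n (koszul_glue n u v) B = kd n u B"
    by (rule koszul_d_cong) (use assms(3) in \<open>auto simp: koszul_glue_def\<close>)
  then show "kd (Suc n) (koszul_glue n u v) B = kd n u B" using assms(3) by simp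
  have "kd n (\<lambda>C. koszul_glue n u v (insert n C)) B = kd n v B"
  proof (rule koszul_d_cong)
    fix C assume "C \<subseteq> B"
    then have "n \<notin> C" using assms(3) by blast
    then show "koszul_glue n u v (insert n C) = v C" by (simp add: koszul_glue_def)
  qed
  then show "kd (Suc n) (koszul_glue n u v) (insert n B) = t n \<otimes> u B \<ominus> kd n v B"
    using assms(3) by (simp add: koszul_glue_def)
qed

section \<open>Cohomology of the Koszul complex of a regular sequence\<close>

lemma card_top: "A \<subseteq> {..<n::nat} \<Longrightarrow> A \<noteq> {..<n} \<Longrightarrow> card A \<noteq> n"
  by (metis card_lessThan card_subset_eq finite_lessThan)

text \<open>Together with \<open>koszul_top_exact\<close> this computes the top cohomology as the
  ring modulo the ideal of the \<open>t i\<close>.\<close>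

lemma koszul_top_in_Idl:
  assumes "\<And>A. x A \<in> carrier R"
  shows "kd n x {..<n} \<in> Idl (t ` {..<n})"
  using assms
proof (induction n arbitrary: x)
  case (Suc n)
  have "{..<Suc n} - {n} = {..<n}" by auto
  then have "kd (Suc n) x {..<Suc n} = t n \<otimes> x {..<n} \<ominus> kd n (\<lambda>B. x (insert n B)) {..<n}" by simp
  also have "\<dots> = (\<ominus> kd n (\<lambda>B. x (insert n B)) {..<n}) \<oplus> x {..<n} \<otimes> t n"
    using Suc.prems by (simp add: minus_eq a_comm m_comm)
  finally have "kd (Suc n) x {..<Suc n} = \<ominus> kd n (\<lambda>B. x (insert n B)) {..<n} \<oplus> x {..<n} \<otimes> t n" .
  moreover have "\<ominus> kd n (\<lambda>B. x (insert n B)) {..<n} \<in> Idl (t ` {..<n})"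
    by (rule ideal_neg[OF genideal_ideal]) (use Suc in auto)
  then have "\<ominus> kd n (\<lambda>B. x (insert n B)) {..<n} \<oplus> x {..<n} \<otimes> t n \<in> Idl (insert (t n) (t ` {..<n}))"
    using Suc.prems by (subst Idl_insert) auto
  ultimately show ?case by (simp only: lessThan_Suc image_insert)
qed (simp add: Idl_empty)

lemma koszul_top_exact:
  "a \<in> Idl (t ` {..<n}) \<Longrightarrow>
    \<exists>u. homog n (int n - 1) u \<and> kd n u {..<n} = a"
proof (induction n arbitrary: a)
  case 0 then show ?case
    by (intro exI[of _ "\<lambda>A. \<zero>"]) (simp add: Idl_empty koszul_homogeneous_def)
next
  case (Suc n)
  have sub: "t ` {..<n} \<subseteq> carrier R" by auto
  have "t ` {..<Suc n} = insert (t n) (t ` {..<n})" by (simp add: lessThan_Suc)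
  then obtain j r where jr: "j \<in> Idl (t ` {..<n})" "r \<in> carrier R" "a = j \<oplus> r \<otimes> t n"
    using Suc.prems Idl_insert[OF t_closed sub] by auto
  \<comment> \<open>The value is the negative of \<open>j\<close> because the glued differential
    subtracts that of \<open>v\<close>.\<close>
  obtain v where v: "homog n (int n - 1) v" "kd n v {..<n} = \<ominus> j"
    using Suc.IH[OF ideal_neg[OF genideal_ideal[OF sub] jr(1)]] by blast
  define u where "u = (\<lambda>A. if A = {..<n} then r else \<zero>)"
  have u: "homog n (int n) u"
    using jr(2) by (auto simp: koszul_homogeneous_def u_def)
  have "homog (Suc n) (int (Suc n) - 1) (koszul_glue n u v)"
    using u v by (intro koszul_glue_homog) auto
  moreover have "kd (Suc n) (koszul_glue n u v) {..<Suc n} = a"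
    using koszul_d_glue(2)[of u v n "{..<n}"] homogD(2)[OF u] homogD(2)[OF v(1)]
      v(2) jr Idl_subset_carrier[OF sub jr(1)]
    by (simp add: lessThan_Suc u_def m_comm minus_eq a_comm)
  ultimately show ?case by blast
qed

text \<open>Induction along the mapping cone. The component without the last index is a cocycle of
  the shorter complex, so it bounds some \<open>u\<close>; the other component is then corrected by
  a cocycle of degree \<open>p - 1\<close>, which bounds as well.\<close>

lemma koszul_acyclic:
  assumes reg: "\<And>i a. i < n \<Longrightarrow> a \<in> carrier R \<Longrightarrow> t i \<otimes> a \<in> Idl (t ` {..<i}) \<Longrightarrow> a \<in> Idl (t ` {..<i})"
    and "p < int n" "homog n p x" "\<And>A. A \<subseteq> {..<n} \<Longrightarrow> kd n x A = \<zero>"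
  shows "\<exists>u. homog n (p - 1) u \<and> (\<forall>A\<subseteq>{..<n}. kd n u A = x A)"
  using assms
proof (induction n arbitrary: p x)
  case 0
  then have "x {} = \<zero>" by (auto simp: koszul_homogeneous_def)
  then show ?case by (intro exI[of _ "\<lambda>A. \<zero>"]) (simp add: koszul_homogeneous_def)
next
  case (Suc n)
  note h = homog_Suc[OF Suc.prems(3)]
  let ?x1 = "\<lambda>B. x (insert n B)"
  have xc [simp]: "x A \<in> carrier R" for A using homogD(2)[OF Suc.prems(3)] .
  have d0: "kd n x A = \<zero>" if "A \<subseteq> {..<n}" for A
  proof -
    have "n \<notin> A" "A \<subseteq> {..<Suc n}" using that by auto
    then show ?thesis using Suc.prems(4)[of A] by simp
  qed
  have d1: "t n \<otimes> x A = kd n ?x1 A" if "A \<subseteq> {..<n}" for A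
  proof -
    have "n \<notin> A" "insert n A \<subseteq> {..<Suc n}" using that by auto
    then show ?thesis using Suc.prems(4)[of "insert n A"] by simp
  qed
  have "\<exists>u. homog n (p - 1) u \<and> (\<forall>A\<subseteq>{..<n}. kd n u A = x A)"
  proof (cases "p < int n")
    case True
    then show ?thesis using Suc.IH[OF Suc.prems(1) True h(1) d0] by simp
  next
    case False
    then have p: "p = int n" using Suc.prems(2) by simp
    \<comment> \<open>This is the top degree of the shorter complex, so induction does not apply.
      There the cohomology is the ring modulo the earlier \<open>t i\<close>, on which
      \<open>t n\<close> is injective.\<close>
    have "t n \<otimes> x {..<n} \<in> Idl (t ` {..<n})"
      unfolding d1[OF order_refl] by (rule koszul_top_in_Idl) simp
    then have "x {..<n} \<in> Idl (t ` {..<n})" using Suc.prems(1) by simp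
    then obtain u where u: "homog n (int n - 1) u" "kd n u {..<n} = x {..<n}"
      using koszul_top_exact by blast
    moreover have "kd n u A = x A" if "A \<subseteq> {..<n}" for A
    proof (cases "A = {..<n}")
      case False
      then have "int (card A) \<noteq> int n" using card_top[OF that] by simp
      then show ?thesis
        using homogD(1)[OF kd_homog[OF u(1)] that] homogD(1)[OF h(1) that] p
        by simp
    qed (use u in simp)
    ultimately show ?thesis using p by blast
  qed
  then obtain u where u: "homog n (p - 1) u" "\<And>A. A \<subseteq> {..<n} \<Longrightarrow> kd n u A = x A" by blast
  note uc [simp] = homogD(2)[OF u(1)]
  \<comment> \<open>What the component with index \<open>n\<close> still lacks once \<open>u\<close>
    is chosen. The cocycle condition on \<open>x\<close> makes it a cocycle.\<close>
  define y where "y = (\<lambda>A. t n \<otimes> u A \<ominus> ?x1 A)"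
  have y: "homog n (p - 1) y"
    using homogD(1)[OF u(1)] homogD(1)[OF h(2)]
    by (auto simp: koszul_homogeneous_def y_def minus_eq)
  have "kd n y A = \<zero>" if "A \<subseteq> {..<n}" for A
    unfolding y_def using d1[OF that] u(2)[OF that]
    by (subst koszul_d_diff) (auto simp: koszul_d_smult minus_eq r_neg)
  then obtain v where v: "homog n (p - 1 - 1) v" "\<And>A. A \<subseteq> {..<n} \<Longrightarrow> kd n v A = y A"
    using Suc.IH[OF Suc.prems(1) _ y] Suc.prems(2) by auto
  note vc [simp] = homogD(2)[OF v(1)]
  have "homog (Suc n) (p - 1) (koszul_glue n u v)"
    using u v by (intro koszul_glue_homog) auto
  moreover have "kd (Suc n) (koszul_glue n u v) A = x A" if "A \<subseteq> {..<Suc n}" for A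
    using that
  proof (cases rule: subset_lessThan_Suc_cases)
    case 1 then show ?thesis using koszul_d_glue(1)[of u v n A] u(2) by simp
  next
    case (2 B)
    moreover have "t n \<otimes> a \<ominus> (t n \<otimes> a \<ominus> b) = b" if "a \<in> carrier R" "b \<in> carrier R" for a b
      using that t_closed[of n] by algebra
    ultimately show ?thesis using koszul_d_glue(2)[of u v n B] v(2) by (simp add: y_def)
  qed
  ultimately show ?case by blast
qed

section \<open>Coefficients in R/J and the long exact sequence\<close>

text \<open>Cochains with values in \<open>R/J\<close> are represented by cochains with values in \<open>R\<close>.\<close>

definition cocycle :: "nat \<Rightarrow> 'a set \<Rightarrow> int \<Rightarrow> (nat set \<Rightarrow> 'a) \<Rightarrow> bool" where
  "cocycle n J p x \<longleftrightarrow> homog n p x \<and> (\<forall>A\<subseteq>{..<n}. kd n x A \<in> J)"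

definition coboundary :: "nat \<Rightarrow> 'a set \<Rightarrow> int \<Rightarrow> (nat set \<Rightarrow> 'a) \<Rightarrow> bool" where
  "coboundary n J p x \<longleftrightarrow>
     (\<exists>u. homog n (p - 1) u \<and> (\<forall>A\<subseteq>{..<n}. x A \<ominus> kd n u A \<in> J))"

lemma homog_lin:
  assumes "homog n p x" "homog n p y" "c \<in> carrier R" "d \<in> carrier R"
  shows "homog n p (\<lambda>A. c \<otimes> x A \<oplus> d \<otimes> y A)"
  using homogD[OF assms(1)] homogD[OF assms(2)] assms(3,4)
  unfolding koszul_homogeneous_def by simp

lemma koszul_d_lin:
  assumes "homog n p x" "homog n p y" "c \<in> carrier R" "d \<in> carrier R"
  shows "kd n (\<lambda>A. c \<otimes> x A \<oplus> d \<otimes> y A) A = c \<otimes> kd n x A \<oplus> d \<otimes> kd n y A"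
  using homogD(2)[OF assms(1)] homogD(2)[OF assms(2)] assms(3,4)
  by (subst koszul_d_add) (auto simp: koszul_d_smult)

text \<open>The connecting homomorphism for \<open>0 \<rightarrow> R/J \<rightarrow> R/J \<rightarrow> R/(J, z) \<rightarrow> 0\<close>.\<close>

lemma koszul_connecting:
  assumes J: "ideal J R" and z: "z \<in> carrier R"
    and J': "\<And>a. a \<in> J' \<longleftrightarrow> (\<exists>j\<in>J. \<exists>r\<in>carrier R. a = j \<oplus> r \<otimes> z)"
    and reg: "\<And>a. a \<in> carrier R \<Longrightarrow> z \<otimes> a \<in> J \<Longrightarrow> a \<in> J"
    and x: "cocycle n J' p x"
  obtains w where "cocycle n J (p + 1) w" "\<And>A. A \<subseteq> {..<n} \<Longrightarrow> kd n x A \<ominus> z \<otimes> w A \<in> J"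
proof -
  have xh: "homog n p x" using x by (simp add: cocycle_def)
  note xc [simp] = homogD(2)[OF xh]
  have "\<exists>r\<in>carrier R. kd n x A \<ominus> z \<otimes> r \<in> J" if "A \<subseteq> {..<n}" for A
  proof -
    have "kd n x A \<in> J'" using x that by (simp add: cocycle_def)
    then obtain j r where jr: "j \<in> J" "r \<in> carrier R" "kd n x A = j \<oplus> r \<otimes> z"
      using J' by blast
    then have "j \<in> carrier R" using ideal_carr[OF J] by simp
    then have "kd n x A \<ominus> z \<otimes> r = j" unfolding jr(3) using jr(2) z by algebra
    then show ?thesis using jr(1,2) by metis
  qed
  then obtain f where f: "\<And>A. A \<subseteq> {..<n} \<Longrightarrow> f A \<in> carrier R \<and> kd n x A \<ominus> z \<otimes> f A \<in> J"
    by metis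
  \<comment> \<open>Setting \<open>w\<close> to zero off degree \<open>p + 1\<close> is harmless,
    since the differential of \<open>x\<close> vanishes there itself.\<close>
  define w where "w = (\<lambda>A. if A \<subseteq> {..<n} \<and> int (card A) = p + 1 then f A else \<zero>)"
  have wh: "homog n (p + 1) w"
    using f by (auto simp: koszul_homogeneous_def w_def)
  note wc [simp] = homogD(2)[OF wh]
  have diff: "kd n x A \<ominus> z \<otimes> w A \<in> J" if "A \<subseteq> {..<n}" for A
    using f[OF that] that z homogD(1)[OF kd_homog[OF xh] that] ideal_zero[OF J]
    by (auto simp: w_def minus_eq)
  have "kd n w A \<in> J" if A: "A \<subseteq> {..<n}" for A
  proof -
    \<comment> \<open>Applying the differential once more leaves only \<open>z\<close> times that of
      \<open>w\<close>, and \<open>z\<close> can be cancelled modulo \<open>J\<close>.\<close>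
    have "kd n (\<lambda>A. kd n x A \<ominus> z \<otimes> w A) A \<in> J"
      by (rule koszul_d_ideal[OF J]) (use diff A in blast)
    moreover have "kd n (\<lambda>A. kd n x A \<ominus> z \<otimes> w A) A = \<ominus> (z \<otimes> kd n w A)"
      using z by (subst koszul_d_diff) (auto simp: koszul_d_smult koszul_d_d minus_eq)
    ultimately have "z \<otimes> kd n w A \<in> J" using ideal_neg[OF J] z by fastforce
    then show ?thesis using reg by simp
  qed
  then show ?thesis using wh diff that unfolding cocycle_def by blast
qed

text \<open>If \<open>w\<close> is the differential of \<open>v\<close> modulo \<open>J\<close>,
  then \<open>x\<close> minus \<open>z\<close> times \<open>v\<close> is a cocycle modulo
  \<open>J\<close> that agrees with \<open>x\<close> modulo \<open>z\<close>. This is exactness of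
  the long sequence at R/J' when the cohomology of R/J in degree \<open>p\<close> vanishes: the
  connecting map is then injective.\<close>

lemma koszul_connecting_exact:
  assumes J: "ideal J R" and z: "z \<in> carrier R"
    and J': "\<And>a. a \<in> J' \<longleftrightarrow> (\<exists>j\<in>J. \<exists>r\<in>carrier R. a = j \<oplus> r \<otimes> z)"
    and xh: "homog n p x"
    and exact: "\<And>y. cocycle n J p y \<Longrightarrow> coboundary n J p y"
    and wc [simp]: "\<And>A. w A \<in> carrier R"
    and w: "coboundary n J (p + 1) w" "\<And>A. A \<subseteq> {..<n} \<Longrightarrow> kd n x A \<ominus> z \<otimes> w A \<in> J"
  shows "coboundary n J' p x"
proof -
  obtain v where v: "homog n p v" "\<And>A. A \<subseteq> {..<n} \<Longrightarrow> w A \<ominus> kd n v A \<in> J"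
    using w(1) unfolding coboundary_def by auto
  note [simp] = homogD(2)[OF v(1)] homogD(2)[OF xh] 
  define y where "y = (\<lambda>A. \<one> \<otimes> x A \<oplus> (\<ominus> z) \<otimes> v A)"
  have y: "homog n p y"
    unfolding y_def using xh v(1) z by (intro homog_lin) auto
  have "kd n y A \<in> J" if A: "A \<subseteq> {..<n}" for A
  proof -
    define a b c where abc: "a = kd n x A" "b = kd n v A" "c = w A"
    have [simp]: "a \<in> carrier R" "b \<in> carrier R" "c \<in> carrier R" by (auto simp: abc)
    have "kd n y A = \<one> \<otimes> a \<oplus> (\<ominus> z) \<otimes> b"
      unfolding y_def abc by (rule koszul_d_lin) (use xh v z in auto)
    also have "\<dots> = (a \<ominus> z \<otimes> c) \<oplus> z \<otimes> (c \<ominus> b)"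
      using z \<open>a \<in> carrier R\<close> \<open>b \<in> carrier R\<close> \<open>c \<in> carrier R\<close> by algebra
    finally show ?thesis using w(2)[OF A] v(2)[OF A] J z
      by (auto simp: abc intro!: ideal_rules)
  qed
  then have "coboundary n J p y" using exact y by (auto simp: cocycle_def)
  then obtain u where u: "homog n (p - 1) u" "\<And>A. A \<subseteq> {..<n} \<Longrightarrow> y A \<ominus> kd n u A \<in> J"
    unfolding coboundary_def by auto
  note [simp] = homogD(2)[OF u(1)]
  have "x A \<ominus> kd n u A \<in> J'" if A: "A \<subseteq> {..<n}" for A
  proof -
    have c: "x A \<in> carrier R" "v A \<in> carrier R" "kd n u A \<in> carrier R" by auto
    have "x A \<ominus> kd n u A = (y A \<ominus> kd n u A) \<oplus> v A \<otimes> z"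
      unfolding y_def using c z by algebra
    then show ?thesis unfolding J' using u(2)[OF A] c by blast
  qed
  then show ?thesis using u(1) unfolding coboundary_def by blast
qed

lemma set_take_Suc: "j < length zs \<Longrightarrow> set (take (Suc j) zs) = insert (zs ! j) (set (take j zs))"
  by (simp add: take_Suc_conv_app_nth)

section \<open>Degree zero: the socle\<close>

lemma koszul_0_cocycle:
  "homog m 0 x \<Longrightarrow> A \<subseteq> {..<m} \<Longrightarrow>
    kd m x A = (if card A = 1 then t (the_elem A) \<otimes> x {} else \<zero>)"
proof (induction m arbitrary: x A)
  case (Suc m)
  note h = homog_Suc[OF Suc.prems(1)]
  note [simp] = homogD(2)[OF h(1)]
  from Suc.prems(2) show ?case
  proof (cases rule: subset_lessThan_Suc_cases)
    case 1 then show ?thesis using Suc.IH[OF h(1)] by simp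
  next
    case (2 B)
    have z: "x (insert m C) = \<zero>" if "C \<subseteq> B" for C
    proof -
      have "finite C" using that 2 finite_subset finite_lessThan by metis
      moreover have "insert m C \<subseteq> {..<Suc m}" using that 2 by auto
      moreover have "card (insert m C) \<noteq> 0" using \<open>finite C\<close> by simp
      ultimately show ?thesis by (intro homogD(1)[OF Suc.prems(1)]) simp_all
    qed
    have "kd m (\<lambda>C. x (insert m C)) B \<in> {\<zero>}"
      by (rule koszul_d_ideal[OF zeroideal]) (use z in auto)
    moreover have "x B = (if B = {} then x {} else \<zero>)"
      using homogD(1)[OF h(1), of B] 2 finite_subset[of B "{..<m}"] by auto
    ultimately show ?thesis using 2 finite_subset[of B "{..<m}"] by (auto simp: minus_eq)
  qed
qed simp

text \<open>A degree 0 cochain is its value at the empty set, and its differential consists of the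
  products with the single \<open>t i\<close>; cocycles are therefore the elements that all
  \<open>t i\<close> kill modulo \<open>K\<close>.\<close>

lemma koszul_0_cocycle_iff:
  assumes "ideal K R" "homog n 0 x"
  shows "cocycle n K 0 x \<longleftrightarrow> (\<forall>i<n. t i \<otimes> x {} \<in> K)"
proof
  assume *: "cocycle n K 0 x"
  show "\<forall>i<n. t i \<otimes> x {} \<in> K"
  proof (intro allI impI)
    fix i assume "i < n"
    then have "kd n x {i} \<in> K" using * by (simp add: cocycle_def)
    then show "t i \<otimes> x {} \<in> K" using koszul_0_cocycle[OF assms(2), of "{i}"] \<open>i < n\<close> by simp
  qed
next
  assume *: "\<forall>i<n. t i \<otimes> x {} \<in> K"
  show "cocycle n K 0 x"
    unfolding cocycle_def
  proof (intro conjI allI impI assms(2))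
    fix A assume A: "A \<subseteq> {..<n}"
    show "kd n x A \<in> K"
      unfolding koszul_0_cocycle[OF assms(2) A]
      using * A ideal_zero[OF assms(1)] by (auto simp: card_1_singleton_iff)
  qed
qed

text \<open>There are no nonzero cochains of degree -1, so the cohomology in degree 0 is the socle
  itself.\<close>

lemma koszul_0_coboundary_iff:
  assumes "ideal K R" "homog n 0 x"
  shows "coboundary n K 0 x \<longleftrightarrow> x {} \<in> K"
proof -
  have z: "kd n u A = \<zero>" if "homog n (0 - 1) u" "A \<subseteq> {..<n}" for u A
  proof -
    have "kd n u A \<in> {\<zero>}"
      by (rule koszul_d_ideal[OF zeroideal]) (use that homogD(1)[OF that(1)] in auto)
    then show ?thesis by simp
  qed
  note [simp] = homogD(2)[OF assms(2)]
  show ?thesis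
  proof
    assume "coboundary n K 0 x"
    then show "x {} \<in> K" unfolding coboundary_def using z[of _ "{}"] by (auto simp: minus_eq)
  next
    assume x: "x {} \<in> K"
    show "coboundary n K 0 x"
      unfolding coboundary_def
    proof (intro exI conjI allI impI)
      show "homog n (0 - 1) (\<lambda>A. \<zero>)" by (simp add: koszul_homogeneous_def)
      fix A assume A: "A \<subseteq> {..<n}"
      have "x A \<in> K" using x homogD(1)[OF assms(2) A] ideal_zero[OF assms(1)] finite_subset[OF A]
        by (cases "A = {}") auto
      then show "x A \<ominus> kd n (\<lambda>A. \<zero>) A \<in> K"
        using z[OF \<open>homog n (0 - 1) (\<lambda>A. \<zero>)\<close> A] by (simp add: minus_eq)
    qed
  qed
qed

section \<open>Dimension shifting along a second regular sequence\<close>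

context
  fixes n :: nat and zs :: "'a list"
  assumes t_regular: "\<And>i a. i < n \<Longrightarrow> a \<in> carrier R \<Longrightarrow> t i \<otimes> a \<in> Idl (t ` {..<i}) \<Longrightarrow> a \<in> Idl (t ` {..<i})"
    and zs: "regular_sequence R zs"
begin

abbreviation "J j \<equiv> Idl (set (take j zs))"

lemma zs_take_closed: "set (take j zs) \<subseteq> carrier R"
  using zs set_take_subset[of j zs] by (auto simp: regular_sequence_def)

lemma J_ideal: "ideal (J j) R"
  by (rule genideal_ideal[OF zs_take_closed])

lemma J_step:
  assumes "j < length zs"
  shows "zs ! j \<in> carrier R" "a \<in> J (Suc j) \<longleftrightarrow> (\<exists>i\<in>J j. \<exists>r\<in>carrier R. a = i \<oplus> r \<otimes> zs ! j)"
    "a \<in> carrier R \<Longrightarrow> zs ! j \<otimes> a \<in> J j \<Longrightarrow> a \<in> J j"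
proof -
  show z: "zs ! j \<in> carrier R"
    using zs nth_mem[OF assms] unfolding regular_sequence_def by blast
  show "a \<in> J (Suc j) \<longleftrightarrow> (\<exists>i\<in>J j. \<exists>r\<in>carrier R. a = i \<oplus> r \<otimes> zs ! j)"
    unfolding set_take_Suc[OF assms] by (rule Idl_insert[OF z zs_take_closed])
  show "a \<in> carrier R \<Longrightarrow> zs ! j \<otimes> a \<in> J j \<Longrightarrow> a \<in> J j"
    using zs assms by (auto simp: regular_sequence_def)
qed

text \<open>Passing from \<open>J j\<close> to \<open>J (Suc j)\<close> places the cohomology in
  degree \<open>p\<close> between degrees \<open>p\<close> and \<open>p + 1\<close> for
  \<open>J j\<close>. Each element of \<open>zs\<close> thus lowers the vanishing range by one,
  starting from acyclicity of the regular sequence \<open>t\<close>.\<close>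

lemma koszul_vanishing:
  "j \<le> length zs \<Longrightarrow> p + int j < int n \<Longrightarrow> cocycle n (J j) p x \<Longrightarrow> coboundary n (J j) p x"
proof (induction j arbitrary: p x)
  case 0
  then have "homog n p x" "\<And>A. A \<subseteq> {..<n} \<Longrightarrow> kd n x A = \<zero>"
    by (auto simp: cocycle_def Idl_empty)
  then obtain u where "homog n (p - 1) u" "\<forall>A\<subseteq>{..<n}. kd n u A = x A"
    using koszul_acyclic[OF t_regular, of n p x] 0 by auto
  then show ?case using homogD(2)[OF \<open>homog n p x\<close>]
    unfolding coboundary_def by (intro exI[of _ u]) (auto simp: Idl_empty)
next
  case (Suc j)
  then have j: "j < length zs" by simp
  note st = J_step[OF j]
  obtain w where w: "cocycle n (J j) (p + 1) w" "\<And>A. A \<subseteq> {..<n} \<Longrightarrow> kd n x A \<ominus> zs ! j \<otimes> w A \<in> J j"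
    using koszul_connecting[OF J_ideal st(1,2,3) Suc.prems(3)] by blast
  show ?case
  proof (rule koszul_connecting_exact[OF J_ideal st(1,2)])
    show "homog n p x" using Suc.prems(3) by (simp add: cocycle_def)
    show "coboundary n (J j) p y" if "cocycle n (J j) p y" for y
      using Suc.IH[OF _ _ that] Suc.prems by simp
    show "coboundary n (J j) (p + 1) w"
      using Suc.IH[OF _ _ w(1)] Suc.prems by simp
    show "w A \<in> carrier R" for A using w(1) homogD(2) unfolding cocycle_def by blast
  qed (rule w(2))
qed

text \<open>On the edge of the vanishing range the connecting maps are injective, so the cohomology
  embeds in that of the ring itself in degree \<open>n\<close>, which is the ring modulo the
  \<open>t i\<close>. There any two elements are dependent, and the same coefficients serve all the
  way down.\<close>

lemma koszul_dependent:
  assumes t_proper: "\<one> \<notin> Idl (t ` {..<n})"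
  shows "j \<le> length zs \<Longrightarrow> p + int j = int n \<Longrightarrow> cocycle n (J j) p x \<Longrightarrow> cocycle n (J j) p y \<Longrightarrow>
    \<exists>c\<in>carrier R. \<exists>d\<in>carrier R. \<not> (c \<in> Idl (t ` {..<n}) \<and> d \<in> Idl (t ` {..<n})) \<and>
      coboundary n (J j) p (\<lambda>A. c \<otimes> x A \<oplus> d \<otimes> y A)"
proof (induction j arbitrary: p x y)
  case 0
  have hom: "homog n (int n) x" "homog n (int n) y"
    using 0 by (auto simp: cocycle_def)
  note [simp] = hom[THEN homogD(2)]
  have *: "coboundary n (J 0) p (\<lambda>A. c \<otimes> x A \<oplus> d \<otimes> y A)"
    if cd [simp]: "c \<in> carrier R" "d \<in> carrier R" and m: "c \<otimes> x {..<n} \<oplus> d \<otimes> y {..<n} \<in> Idl (t ` {..<n})" for c d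
  proof -
    obtain u where u: "homog n (int n - 1) u"
      "kd n u {..<n} = c \<otimes> x {..<n} \<oplus> d \<otimes> y {..<n}"
      using koszul_top_exact[OF m] by blast
    have "kd n u A = c \<otimes> x A \<oplus> d \<otimes> y A" if A: "A \<subseteq> {..<n}" for A
    proof (cases "A = {..<n}")
      case False
      then have "int (card A) \<noteq> int n" using card_top[OF A] by simp
      then show ?thesis
        using homogD(1)[OF kd_homog[OF u(1)] A] hom[THEN homogD(1), OF A]
        by simp
    qed (use u in simp)
    then show ?thesis using u(1) 0 unfolding coboundary_def
      by (intro exI[of _ u]) (auto simp: Idl_empty)
  qed
  show ?case
  proof (cases "x {..<n} \<in> Idl (t ` {..<n})")
    case True
    then show ?thesis using *[of \<one> \<zero>] t_proper by (intro bexI[of _ \<one>] bexI[of _ \<zero>]) auto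
  next
    case False
    \<comment> \<open>The two top values, exchanged and with one sign, give a relation that holds
      identically; the coefficient coming from \<open>x\<close> is outside the ideal.\<close>
    have "y {..<n} \<otimes> x {..<n} \<oplus> (\<ominus> x {..<n}) \<otimes> y {..<n} = \<zero>"
    proof -
      have "x {..<n} \<in> carrier R" "y {..<n} \<in> carrier R" by auto
      then show ?thesis by algebra
    qed
    moreover have "\<zero> \<in> Idl (t ` {..<n})" by (rule ideal_zero[OF genideal_ideal]) auto
    moreover have "\<ominus> x {..<n} \<notin> Idl (t ` {..<n})"
    proof
      assume m: "\<ominus> x {..<n} \<in> Idl (t ` {..<n})"
      have "t ` {..<n} \<subseteq> carrier R" by auto
      from ideal_neg[OF genideal_ideal[OF this] m] show False using False by simp
    qed
    ultimately show ?thesis using *[of "y {..<n}" "\<ominus> x {..<n}"]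
      by (intro bexI[of _ "y {..<n}"] bexI[of _ "\<ominus> x {..<n}"]) auto
  qed
next
  case (Suc j)
  then have j: "j < length zs" by simp
  note st = J_step[OF j]
  obtain v where v: "cocycle n (J j) (p + 1) v" "\<And>A. A \<subseteq> {..<n} \<Longrightarrow> kd n x A \<ominus> zs ! j \<otimes> v A \<in> J j"
    using koszul_connecting[OF J_ideal st(1,2,3) Suc.prems(3)] by blast
  obtain w where w: "cocycle n (J j) (p + 1) w" "\<And>A. A \<subseteq> {..<n} \<Longrightarrow> kd n y A \<ominus> zs ! j \<otimes> w A \<in> J j"
    using koszul_connecting[OF J_ideal st(1,2,3) Suc.prems(4)] by blast
  obtain c d where cd: "c \<in> carrier R" "d \<in> carrier R"
    "\<not> (c \<in> Idl (t ` {..<n}) \<and> d \<in> Idl (t ` {..<n}))"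
    "coboundary n (J j) (p + 1) (\<lambda>A. c \<otimes> v A \<oplus> d \<otimes> w A)"
    using Suc.IH[OF _ _ v(1) w(1)] Suc.prems by auto
  have hom: "homog n p x" "homog n p y"
    "homog n (p + 1) v" "homog n (p + 1) w"
    using Suc.prems v w by (auto simp: cocycle_def)
  note [simp] = hom[THEN homogD(2)] cd(1,2)
  have "coboundary n (J (Suc j)) p (\<lambda>A. c \<otimes> x A \<oplus> d \<otimes> y A)"
  proof (rule koszul_connecting_exact[OF J_ideal st(1,2) _ _ _ cd(4)])
    show "homog n p (\<lambda>A. c \<otimes> x A \<oplus> d \<otimes> y A)"
      using hom cd by (intro homog_lin)
    \<comment> \<open>Since \<open>p\<close> and \<open>Suc j\<close> add up to \<open>n\<close>,
      degree \<open>p\<close> is still in the vanishing range for \<open>J j\<close>.\<close>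
    show "coboundary n (J j) p y" if "cocycle n (J j) p y" for y
      using koszul_vanishing[OF _ _ that] Suc.prems by simp
    fix A assume A: "A \<subseteq> {..<n}"
    define a b e f where abef: "a = kd n x A" "b = kd n y A" "e = v A" "f = w A"
    have car: "a \<in> carrier R" "b \<in> carrier R" "e \<in> carrier R" "f \<in> carrier R" by (auto simp: abef)
    have "kd n (\<lambda>A. c \<otimes> x A \<oplus> d \<otimes> y A) A = c \<otimes> a \<oplus> d \<otimes> b"
      unfolding abef by (rule koszul_d_lin) (use hom cd in auto)
    then have "kd n (\<lambda>A. c \<otimes> x A \<oplus> d \<otimes> y A) A \<ominus> zs ! j \<otimes> (c \<otimes> v A \<oplus> d \<otimes> w A)
        = (c \<otimes> a \<oplus> d \<otimes> b) \<ominus> zs ! j \<otimes> (c \<otimes> e \<oplus> d \<otimes> f)" by (simp only: abef)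
    also have "\<dots> = c \<otimes> (a \<ominus> zs ! j \<otimes> e) \<oplus> d \<otimes> (b \<ominus> zs ! j \<otimes> f)"
      using car cd(1,2) st(1) by algebra
    also have "\<dots> \<in> J j" unfolding abef
      using v(2)[OF A] w(2)[OF A] cd J_ideal by (intro ideal_add[OF J_ideal] ideal_mult[OF J_ideal])
    finally show "kd n (\<lambda>A. c \<otimes> x A \<oplus> d \<otimes> y A) A \<ominus> zs ! j \<otimes> (c \<otimes> v A \<oplus> d \<otimes> w A) \<in> J j" .
  qed auto
  then show ?case using cd by blast
qed

lemma socle_cocycle:
  assumes "a \<in> carrier R" "\<And>i. i < n \<Longrightarrow> t i \<otimes> a \<in> Idl (set zs)"
  shows "cocycle n (J (length zs)) 0 (\<lambda>A. if A = {} then a else \<zero>)"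
proof -
  have h: "homog n 0 (\<lambda>A. if A = {} then a else \<zero>)"
    using assms(1) by (auto simp: koszul_homogeneous_def)
  show ?thesis using assms koszul_0_cocycle_iff[OF J_ideal[of "length zs"] h] by simp
qed

text \<open>For a sequence shorter than \<open>n\<close> degree 0 lies in the vanishing range: the
  quotient has positive depth.\<close>

lemma socle_trivial:
  assumes "length zs < n" "a \<in> carrier R" "\<And>i. i < n \<Longrightarrow> t i \<otimes> a \<in> Idl (set zs)"
  shows "a \<in> Idl (set zs)"
proof -
  note co = socle_cocycle[OF assms(2,3)]
  then have h: "homog n 0 (\<lambda>A. if A = {} then a else \<zero>)" by (simp add: cocycle_def)
  have "coboundary n (J (length zs)) 0 (\<lambda>A. if A = {} then a else \<zero>)"
    using koszul_vanishing[OF _ _ co] assms(1) by simp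
  then show ?thesis using koszul_0_coboundary_iff[OF J_ideal[of "length zs"] h] by simp
qed

text \<open>The socle \<open>H\<^sup>0(R/(z))\<close> has dimension at most one, because it has dimension
  at most that of \<open>H\<^sup>n(R) = R/(t)\<close>.\<close>

lemma socle_dependent_of_length_eq:
  assumes "\<one> \<notin> Idl (t ` {..<n})" "length zs = n" and a: "a \<in> carrier R" "b \<in> carrier R"
    and "\<And>i. i < n \<Longrightarrow> t i \<otimes> a \<in> Idl (set zs)" "\<And>i. i < n \<Longrightarrow> t i \<otimes> b \<in> Idl (set zs)"
  shows "\<exists>c\<in>carrier R. \<exists>d\<in>carrier R. \<not> (c \<in> Idl (t ` {..<n}) \<and> d \<in> Idl (t ` {..<n})) \<and>
      c \<otimes> a \<oplus> d \<otimes> b \<in> Idl (set zs)"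
proof -
  define x y where xy: "x = (\<lambda>A::nat set. if A = {} then a else \<zero>)" "y = (\<lambda>A::nat set. if A = {} then b else \<zero>)"
  have co: "cocycle n (J (length zs)) 0 x" "cocycle n (J (length zs)) 0 y"
    unfolding xy by (rule socle_cocycle[OF a(1) assms(5)], assumption, rule socle_cocycle[OF a(2) assms(6)])
  then obtain c d where cd: "c \<in> carrier R" "d \<in> carrier R"
    "\<not> (c \<in> Idl (t ` {..<n}) \<and> d \<in> Idl (t ` {..<n}))"
    "coboundary n (J (length zs)) 0 (\<lambda>A. c \<otimes> x A \<oplus> d \<otimes> y A)"
    using koszul_dependent[OF assms(1) _ _ co] assms(2) by auto
  have "homog n 0 (\<lambda>A. c \<otimes> x A \<oplus> d \<otimes> y A)"
    using co cd by (intro homog_lin) (auto simp: cocycle_def)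
  from koszul_0_coboundary_iff[OF J_ideal[of "length zs"] this] cd(4)
  have "c \<otimes> a \<oplus> d \<otimes> b \<in> Idl (set zs)" by (simp add: xy)
  then show ?thesis using cd by blast
qed

end

text \<open>If the sequence \<open>z\<close> were longer than \<open>t\<close>, then by the vanishing of the Koszul cohomology of \<open>z\<close> on
  \<open>R/(t)\<close> no nonzero element of \<open>R/(t)\<close> would be killed by \<open>z\<close>; but \<open>z\<close> kills 1.\<close>

lemma regular_sequence_length_le:
  fixes n :: nat
  assumes t_regular: "\<And>i a. i < n \<Longrightarrow> a \<in> carrier R \<Longrightarrow> t i \<otimes> a \<in> Idl (t ` {..<i}) \<Longrightarrow> a \<in> Idl (t ` {..<i})"
    and t_proper: "\<one> \<notin> Idl (t ` {..<n})"
    and zs: "regular_sequence R zs" "set zs \<subseteq> Idl (t ` {..<n})"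
  shows "length zs \<le> n"
proof (rule ccontr)
  assume len: "\<not> length zs \<le> n"
  \<comment> \<open>Padded by zero because \<open>koszul\<close> asks for an infinite family; only
    the entries of \<open>zs\<close> enter the argument.\<close>
  define s where "s = (\<lambda>i. if i < length zs then zs ! i else \<zero>)"
  have zc: "set zs \<subseteq> carrier R" using zs(1) by (simp add: regular_sequence_def)
  interpret s: koszul R s
    using zc nth_mem by unfold_locales (auto simp: s_def)
  have tc: "t ` {..<n} \<subseteq> carrier R" by auto
  have s_image: "s ` {..<i} = set (take i zs)" if "i \<le> length zs" for i
    using that by (auto simp: s_def nth_image[symmetric] image_iff)
  have t_set: "set (take i (map t [0..<n])) = t ` {..<i}" if "i \<le> n" for i
    using that by (simp add: take_map atLeast0LessThan)
  have "regular_sequence R (map t [0..<n])"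
    unfolding regular_sequence_def
  proof (intro conjI allI impI ballI)
    show "Idl (set (map t [0..<n])) \<noteq> carrier R" using t_proper by (auto simp: atLeast0LessThan)
    fix i a assume "i < length (map t [0..<n])" "a \<in> carrier R"
      "map t [0..<n] ! i \<otimes> a \<in> Idl (set (take i (map t [0..<n])))"
    then show "a \<in> Idl (set (take i (map t [0..<n])))" using t_regular[of i a] t_set[of i] by simp
  qed auto
  moreover have "a \<in> Idl (s ` {..<i})"
    if i: "i < length zs" and "a \<in> carrier R" "s i \<otimes> a \<in> Idl (s ` {..<i})" for i a
    using zs(1) that s_image[of i] by (simp add: regular_sequence_def s_def)
  moreover have "s i \<otimes> \<one> \<in> Idl (set (map t [0..<n]))" if "i < length zs" for i
  proof -
    have "zs ! i \<in> Idl (t ` {..<n})" using zs(2) nth_mem[OF that] by blast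
    then show ?thesis using that Idl_subset_carrier[OF tc] by (simp add: s_def atLeast0LessThan)
  qed
  ultimately have "\<one> \<in> Idl (set (map t [0..<n]))"
    using s.socle_trivial[of "length zs" "map t [0..<n]" \<one>] len by simp
  then show False using t_proper by (simp add: atLeast0LessThan)
qed

text \<open>The length of \<open>zs\<close> is not assumed: a shorter sequence leaves no socle, an
  equal one leaves at most a line, and a longer one cannot exist.\<close>

theorem socle_dependent:
  fixes n :: nat
  assumes t_regular: "\<And>i a. i < n \<Longrightarrow> a \<in> carrier R \<Longrightarrow> t i \<otimes> a \<in> Idl (t ` {..<i}) \<Longrightarrow> a \<in> Idl (t ` {..<i})"
    and t_proper: "\<one> \<notin> Idl (t ` {..<n})"
    and zs: "regular_sequence R zs" "set zs \<subseteq> Idl (t ` {..<n})"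
    and a: "a \<in> carrier R" "b \<in> carrier R"
    and socle: "\<And>i. i < n \<Longrightarrow> t i \<otimes> a \<in> Idl (set zs)" "\<And>i. i < n \<Longrightarrow> t i \<otimes> b \<in> Idl (set zs)"
  shows "\<exists>c\<in>carrier R. \<exists>d\<in>carrier R. \<not> (c \<in> Idl (t ` {..<n}) \<and> d \<in> Idl (t ` {..<n})) \<and>
      c \<otimes> a \<oplus> d \<otimes> b \<in> Idl (set zs)"
proof (cases "length zs = n")
  case True
  then show ?thesis
    using socle_dependent_of_length_eq[OF t_regular zs(1) t_proper True a socle] by blast
next
  case False
  then have "length zs < n" using regular_sequence_length_le[OF t_regular t_proper zs] by linarith
  then have "a \<in> Idl (set zs)" using socle_trivial[OF t_regular zs(1) _ a(1) socle(1)] by blast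
  then show ?thesis using a t_proper by (intro bexI[of _ \<one>] bexI[of _ \<zero>]) auto
qed

end

section \<open>Power series: Cauchy products over multisets\<close>

section \<open>Power series\<close>

lemma (in abelian_monoid) finsum_swap:
  assumes "finite A" "finite B" "\<And>i j. i \<in> A \<Longrightarrow> j \<in> B \<Longrightarrow> f i j \<in> carrier G"
  shows "(\<Oplus>i\<in>A. \<Oplus>j\<in>B. f i j) = (\<Oplus>j\<in>B. \<Oplus>i\<in>A. f i j)"
  using assms(1,3)
proof (induction A)
  case (insert x A)
  have "(\<Oplus>j\<in>B. \<Oplus>i\<in>insert x A. f i j) = (\<Oplus>j\<in>B. f x j \<oplus> (\<Oplus>i\<in>A. f i j))"
    using insert by (intro finsum_cong') auto
  also have "\<dots> = (\<Oplus>j\<in>B. f x j) \<oplus> (\<Oplus>j\<in>B. \<Oplus>i\<in>A. f i j)"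
    using insert by (intro finsum_addf) auto
  finally show ?case using insert by simp
qed (simp add: finsum_zero)

lemma (in abelian_monoid) finsum_mono_neutral:
  assumes "finite B" "A \<subseteq> B" "\<And>i. i \<in> B - A \<Longrightarrow> f i = \<zero>" "f \<in> A \<rightarrow> carrier G"
  shows "(\<Oplus>i\<in>A. f i) = (\<Oplus>i\<in>B. f i)"
  using assms by (intro add.finprod_mono_neutral_cong_left) auto

lemma finite_submultisets: "finite {a. a \<subseteq># m}"
proof (induction m)
  case (add x m)
  have "{a. a \<subseteq># add_mset x m} \<subseteq> {a. a \<subseteq># m} \<union> add_mset x ` {a. a \<subseteq># m}"
  proof
    fix a assume a: "a \<in> {a. a \<subseteq># add_mset x m}"
    show "a \<in> {a. a \<subseteq># m} \<union> add_mset x ` {a. a \<subseteq># m}"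
    proof (cases "x \<in># a")
      case True
      then obtain b where "a = add_mset x b" by (metis insert_DiffM)
      then show ?thesis using a by auto
    next
      case False
      have "count a y \<le> count m y" for y
        using a False mset_subset_eq_count[of a "add_mset x m" y] by (cases "y = x") (auto simp: not_in_iff)
      then show ?thesis by (simp add: subseteq_mset_def)
    qed
  qed
  then show ?case using add finite_subset by blast
qed simp

lemma double_diff_mset: "a \<subseteq># m \<Longrightarrow> m - (m - a) = a"
  by (rule multiset_eqI) (simp add: mset_subset_eq_count)

text \<open>Makes the recursion for the coefficients of an inverse series well founded.\<close>

lemma size_Diff_less:
  assumes "a \<subseteq># m" "a \<noteq> {#}"
  shows "size (m - a) < size m"
proof -
  have "size m = size a + size (m - a)" using assms(1) by (metis size_union subset_mset.add_diff_inverse)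
  moreover have "size a > 0" using assms(2) by (simp add: nonempty_has_size)
  ultimately show ?thesis by simp
qed

locale power_series = cring R for R :: "'a ring" (structure) + fixes n :: nat
begin

abbreviation "P \<equiv> power_series_ring R n"

lemma ps_simps:
  "F \<oplus>\<^bsub>P\<^esub> G = (\<lambda>m. F m \<oplus> G m)" "\<zero>\<^bsub>P\<^esub> = (\<lambda>m. \<zero>)" "\<one>\<^bsub>P\<^esub> = (\<lambda>m. if m = {#} then \<one> else \<zero>)"
  "F \<otimes>\<^bsub>P\<^esub> G = (\<lambda>m. \<Oplus>a\<in>{a. a \<subseteq># m}. F a \<otimes> G (m - a))"
  by (simp_all add: power_series_ring_def)

lemma ps_carrier: "F \<in> carrier P \<longleftrightarrow> (\<forall>m. F m \<in> carrier R \<and> (\<not> set_mset m \<subseteq> {..<n} \<longrightarrow> F m = \<zero>))"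
  by (simp add: power_series_ring_def)

lemma ps_coeff [simp]: "F \<in> carrier P \<Longrightarrow> F m \<in> carrier R"
  by (simp add: ps_carrier)

lemma ps_mult_closed:
  assumes "F \<in> carrier P" "G \<in> carrier P"
  shows "F \<otimes>\<^bsub>P\<^esub> G \<in> carrier P"
  unfolding ps_carrier
proof (intro allI conjI impI)
  fix m
  show "(F \<otimes>\<^bsub>P\<^esub> G) m \<in> carrier R" using assms by (auto simp: ps_simps intro!: finsum_closed)
  assume m: "\<not> set_mset m \<subseteq> {..<n}"
  have "(F \<otimes>\<^bsub>P\<^esub> G) m = (\<Oplus>a\<in>{a. a \<subseteq># m}. \<zero>)"
    unfolding ps_simps
  proof (rule finsum_cong')
    fix a assume "a \<in> {a. a \<subseteq># m}"
    then have "m = a + (m - a)" by simp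
    then have "set_mset m = set_mset a \<union> set_mset (m - a)" by (metis set_mset_union)
    then have "\<not> set_mset a \<subseteq> {..<n} \<or> \<not> set_mset (m - a) \<subseteq> {..<n}" using m by auto
    then show "F a \<otimes> G (m - a) = \<zero>" using assms by (auto simp: ps_carrier)
  qed auto
  then show "(F \<otimes>\<^bsub>P\<^esub> G) m = \<zero>" by (simp add: finsum_zero)
qed

lemma ps_mult_comm:
  assumes "F \<in> carrier P" "G \<in> carrier P"
  shows "F \<otimes>\<^bsub>P\<^esub> G = G \<otimes>\<^bsub>P\<^esub> F"
proof
  fix m :: "nat multiset"
  have inj: "inj_on (\<lambda>a. m - a) {a. a \<subseteq># m}"
    by (rule inj_on_inverseI[of _ "\<lambda>a. m - a"]) (simp add: double_diff_mset)
  have im: "(\<lambda>a. m - a) ` {a. a \<subseteq># m} = {a. a \<subseteq># m}"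
  proof (intro equalityI subsetI)
    fix a assume "a \<in> {a. a \<subseteq># m}"
    then have "a = m - (m - a)" "m - a \<subseteq># m" by (auto simp: double_diff_mset)
    then show "a \<in> (\<lambda>a. m - a) ` {a. a \<subseteq># m}" by blast
  qed auto
  have "(F \<otimes>\<^bsub>P\<^esub> G) m = (\<Oplus>a\<in>(\<lambda>a. m - a) ` {a. a \<subseteq># m}. F a \<otimes> G (m - a))"
    unfolding im by (simp add: ps_simps)
  also have "\<dots> = (\<Oplus>a\<in>{a. a \<subseteq># m}. F (m - a) \<otimes> G (m - (m - a)))"
    using assms inj by (subst finsum_reindex) auto
  also have "\<dots> = (\<Oplus>a\<in>{a. a \<subseteq># m}. G a \<otimes> F (m - a))"
    using assms by (intro finsum_cong') (auto simp: m_comm double_diff_mset)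
  finally show "(F \<otimes>\<^bsub>P\<^esub> G) m = (G \<otimes>\<^bsub>P\<^esub> F) m" by (simp add: ps_simps)
qed

lemma ps_mult_assoc:
  assumes "F \<in> carrier P" "G \<in> carrier P" "H \<in> carrier P"
  shows "(F \<otimes>\<^bsub>P\<^esub> G) \<otimes>\<^bsub>P\<^esub> H = F \<otimes>\<^bsub>P\<^esub> (G \<otimes>\<^bsub>P\<^esub> H)"
proof
  fix m :: "nat multiset"
  let ?S = "{a. a \<subseteq># m}"
  note [simp] = assms finite_submultisets
  \<comment> \<open>Extended by zero to pairs with \<open>a\<close> not below \<open>b\<close>, so
    that both iterated sums run over the same square of submultisets and can be exchanged.\<close>
  define f where "f b a = (if a \<subseteq># b then F a \<otimes> G (b - a) \<otimes> H (m - b) else \<zero>)" for b a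
  have f [simp]: "f b a \<in> carrier R" for a b by (simp add: f_def)
  have "((F \<otimes>\<^bsub>P\<^esub> G) \<otimes>\<^bsub>P\<^esub> H) m = (\<Oplus>b\<in>?S. \<Oplus>a\<in>?S. f b a)"
    unfolding ps_simps
  proof (rule finsum_cong')
    fix b assume b: "b \<in> ?S"
    have "(\<Oplus>a\<in>{a. a \<subseteq># b}. F a \<otimes> G (b - a)) \<otimes> H (m - b)
        = (\<Oplus>a\<in>{a. a \<subseteq># b}. F a \<otimes> G (b - a) \<otimes> H (m - b))"
      by (rule finsum_ldistr) auto
    also have "\<dots> = (\<Oplus>a\<in>{a. a \<subseteq># b}. f b a)" by (rule finsum_cong') (auto simp: f_def)
    also have "\<dots> = (\<Oplus>a\<in>?S. f b a)"
      using b by (intro finsum_mono_neutral) (auto simp: f_def)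
    finally show "(\<Oplus>a\<in>{a. a \<subseteq># b}. F a \<otimes> G (b - a)) \<otimes> H (m - b) = (\<Oplus>a\<in>?S. f b a)" .
  qed auto
  also have "\<dots> = (\<Oplus>a\<in>?S. \<Oplus>b\<in>?S. f b a)" by (rule finsum_swap) auto
  also have "\<dots> = (F \<otimes>\<^bsub>P\<^esub> (G \<otimes>\<^bsub>P\<^esub> H)) m"
    unfolding ps_simps
  proof (rule finsum_cong')
    fix a assume a: "a \<in> ?S"
    \<comment> \<open>For fixed \<open>a\<close> the surviving \<open>b\<close> are those of the
      form \<open>a + c\<close>.\<close>
    have "(\<Oplus>b\<in>?S. f b a) = (\<Oplus>b\<in>(+) a ` {c. c \<subseteq># m - a}. f b a)"
    proof (rule finsum_mono_neutral[symmetric])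
      show "(+) a ` {c. c \<subseteq># m - a} \<subseteq> ?S"
        using a by (auto simp: subset_mset.le_diff_conv2 add.commute)
      fix b assume b: "b \<in> ?S - (+) a ` {c. c \<subseteq># m - a}"
      show "f b a = \<zero>"
      proof (cases "a \<subseteq># b")
        case True
        then have "b = a + (b - a)" "b - a \<subseteq># m - a" using b by (auto simp: subseteq_mset_def diff_le_mono)
        then have "b \<in> (+) a ` {c. c \<subseteq># m - a}" by blast
        then show ?thesis using b by simp
      qed (simp add: f_def)
    qed auto
    also have "\<dots> = (\<Oplus>c\<in>{c. c \<subseteq># m - a}. f (a + c) a)"
      by (subst finsum_reindex) auto
    also have "\<dots> = (\<Oplus>c\<in>{c. c \<subseteq># m - a}. F a \<otimes> (G c \<otimes> H (m - a - c)))"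
      by (rule finsum_cong') (auto simp: f_def m_assoc diff_diff_add_mset)
    also have "\<dots> = F a \<otimes> (\<Oplus>c\<in>{c. c \<subseteq># m - a}. G c \<otimes> H (m - a - c))"
      by (rule finsum_rdistr[symmetric]) auto
    finally show "(\<Oplus>b\<in>?S. f b a) = F a \<otimes> (\<Oplus>c\<in>{c. c \<subseteq># m - a}. G c \<otimes> H (m - a - c))" .
  qed (auto intro!: finsum_closed)
  finally show "((F \<otimes>\<^bsub>P\<^esub> G) \<otimes>\<^bsub>P\<^esub> H) m = (F \<otimes>\<^bsub>P\<^esub> (G \<otimes>\<^bsub>P\<^esub> H)) m" .
qed

text \<open>The instances used are the unit, the variables and the constants.\<close>

lemma ps_mult_monom:
  assumes "F \<in> carrier P" "c \<in> carrier R"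
  shows "((\<lambda>m. if m = b then c else \<zero>) \<otimes>\<^bsub>P\<^esub> F) m = (if b \<subseteq># m then c \<otimes> F (m - b) else \<zero>)"
proof -
  have "((\<lambda>m. if m = b then c else \<zero>) \<otimes>\<^bsub>P\<^esub> F) m
      = (\<Oplus>a\<in>{a. a \<subseteq># m} \<inter> {b}. (if a = b then c else \<zero>) \<otimes> F (m - a))"
    unfolding ps_simps using assms
    by (intro finsum_mono_neutral[symmetric]) (auto simp: finite_submultisets)
  also have "\<dots> = (if b \<subseteq># m then c \<otimes> F (m - b) else \<zero>)"
    using assms by auto
  finally show ?thesis .
qed

lemma ps_one: "\<one>\<^bsub>P\<^esub> \<in> carrier P"
  by (simp add: ps_simps ps_carrier)

lemma ps_cring: "cring P"
proof (rule cringI)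
  show "abelian_group P"
  proof (rule abelian_groupI)
    fix F assume "F \<in> carrier P"
    then show "\<exists>G\<in>carrier P. G \<oplus>\<^bsub>P\<^esub> F = \<zero>\<^bsub>P\<^esub>"
      by (intro bexI[of _ "\<lambda>m. \<ominus> F m"]) (auto simp: ps_simps ps_carrier l_neg)
  qed (auto simp: ps_simps ps_carrier a_ac)
  show "Group.comm_monoid P"
  proof (rule comm_monoidI)
    fix F assume "F \<in> carrier P"
    then show "\<one>\<^bsub>P\<^esub> \<otimes>\<^bsub>P\<^esub> F = F"
      using ps_mult_monom[of F \<one> "{#}"] by (auto simp: ps_simps(3))
  qed (auto intro: ps_one ps_mult_closed ps_mult_comm ps_mult_assoc)
  fix F G H assume FGH: "F \<in> carrier P" "G \<in> carrier P" "H \<in> carrier P"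
  show "(F \<oplus>\<^bsub>P\<^esub> G) \<otimes>\<^bsub>P\<^esub> H = F \<otimes>\<^bsub>P\<^esub> H \<oplus>\<^bsub>P\<^esub> G \<otimes>\<^bsub>P\<^esub> H"
  proof
    fix m
    have "(\<Oplus>a\<in>{a. a \<subseteq># m}. (F a \<oplus> G a) \<otimes> H (m - a))
        = (\<Oplus>a\<in>{a. a \<subseteq># m}. F a \<otimes> H (m - a) \<oplus> G a \<otimes> H (m - a))"
      using FGH by (intro finsum_cong') (auto simp: l_distr)
    also have "\<dots> = (\<Oplus>a\<in>{a. a \<subseteq># m}. F a \<otimes> H (m - a)) \<oplus> (\<Oplus>a\<in>{a. a \<subseteq># m}. G a \<otimes> H (m - a))"
      using FGH by (intro finsum_addf) auto
    finally show "((F \<oplus>\<^bsub>P\<^esub> G) \<otimes>\<^bsub>P\<^esub> H) m = (F \<otimes>\<^bsub>P\<^esub> H \<oplus>\<^bsub>P\<^esub> G \<otimes>\<^bsub>P\<^esub> H) m"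
      by (simp add: ps_simps)
  qed
qed

sublocale P: cring P by (rule ps_cring)

section \<open>Ideals of variables, units, and the maximal ideal\<close>

lemma ps_var_closed: "i < n \<Longrightarrow> ps_var R i \<in> carrier P"
  by (auto simp: ps_var_def ps_carrier)

lemma ps_const_closed: "c \<in> carrier R \<Longrightarrow> ps_const R c \<in> carrier P"
  by (auto simp: ps_const_def ps_carrier)

lemma ps_var_mult:
  "F \<in> carrier P \<Longrightarrow> (ps_var R i \<otimes>\<^bsub>P\<^esub> F) m = (if i \<in># m then F (m - {#i#}) else \<zero>)"
  using ps_mult_monom[of F \<one> "{#i#}" m] by (simp add: ps_var_def)

lemma ps_const_mult:
  "F \<in> carrier P \<Longrightarrow> c \<in> carrier R \<Longrightarrow> (ps_const R c \<otimes>\<^bsub>P\<^esub> F) m = c \<otimes> F m"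
  using ps_mult_monom[of F c "{#}" m] by (simp add: ps_const_def)

text \<open>The ideal of the first \<open>i\<close> variables, described by supports, so that
  regularity can be checked on coefficients.\<close>

definition ps_ideal :: "nat \<Rightarrow> (nat multiset \<Rightarrow> 'a) set" where
  "ps_ideal i = {F \<in> carrier P. \<forall>m. set_mset m \<inter> {..<i} = {} \<longrightarrow> F m = \<zero>}"

lemma ps_minus: "F \<in> carrier P \<Longrightarrow> \<ominus>\<^bsub>P\<^esub> F = (\<lambda>m. \<ominus> F m)"
  by (rule P.minus_equality) (auto simp: ps_simps ps_carrier l_neg)

lemma ps_ideal_ideal: "ideal (ps_ideal i) P"
proof (rule P.ideal_closureI)
  show "\<zero>\<^bsub>P\<^esub> \<in> ps_ideal i" by (simp add: ps_ideal_def) (simp add: ps_simps)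
  show "F \<oplus>\<^bsub>P\<^esub> G \<in> ps_ideal i" if "F \<in> ps_ideal i" "G \<in> ps_ideal i" for F G
    using that by (simp add: ps_ideal_def) (simp add: ps_simps(1))
  fix F G assume FG: "F \<in> ps_ideal i" "G \<in> carrier P"
  then have F: "F \<in> carrier P" by (simp add: ps_ideal_def)
  have "(G \<otimes>\<^bsub>P\<^esub> F) m = \<zero>" if m: "set_mset m \<inter> {..<i} = {}" for m
  proof -
    have "F (m - a) = \<zero>" for a
    proof -
      have "set_mset (m - a) \<subseteq> set_mset m" by (meson in_diffD subsetI)
      then have "set_mset (m - a) \<inter> {..<i} = {}" using m by blast
      then show ?thesis using FG(1) by (simp add: ps_ideal_def)
    qed
    then have "(\<Oplus>a\<in>{a. a \<subseteq># m}. G a \<otimes> F (m - a)) = (\<Oplus>a\<in>{a. a \<subseteq># m}. \<zero>)"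
      using FG(2) by (intro finsum_cong') auto
    then show ?thesis by (simp add: ps_simps finsum_zero)
  qed
  then show "G \<otimes>\<^bsub>P\<^esub> F \<in> ps_ideal i" using F FG(2) by (simp add: ps_ideal_def ps_mult_closed)
qed (auto simp: ps_ideal_def)

lemma Idl_vars: "i \<le> n \<Longrightarrow> Idl\<^bsub>P\<^esub> (ps_var R ` {..<i}) = ps_ideal i"
proof (rule equalityI)
  assume i: "i \<le> n"
  show "Idl\<^bsub>P\<^esub> (ps_var R ` {..<i}) \<subseteq> ps_ideal i"
  proof (rule P.genideal_minimal[OF ps_ideal_ideal])
    show "ps_var R ` {..<i} \<subseteq> ps_ideal i"
      using i ps_var_closed by (auto simp: ps_ideal_def ps_var_def)
  qed
  have sub: "j \<le> n \<Longrightarrow> ps_var R ` {..<j} \<subseteq> carrier P" for j using ps_var_closed by auto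
  have "i \<le> n \<Longrightarrow> F \<in> ps_ideal i \<Longrightarrow> F \<in> Idl\<^bsub>P\<^esub> (ps_var R ` {..<i})" for F
  proof (induction i arbitrary: F)
    case 0
    then have "F = \<zero>\<^bsub>P\<^esub>" by (auto simp: ps_ideal_def ps_simps)
    then show ?case by (simp add: P.Idl_empty)
  next
    case (Suc i)
    have F: "F \<in> carrier P" using Suc.prems by (simp add: ps_ideal_def)
    \<comment> \<open>The terms of \<open>F\<close> divisible by the variable \<open>i\<close>,
      divided by it. The remainder has no term free of the earlier variables.\<close>
    define G where "G = (\<lambda>m. F (add_mset i m))"
    have G: "G \<in> carrier P"
      using F Suc.prems(1) by (auto simp: G_def ps_carrier)
    have v: "ps_var R i \<in> carrier P" using Suc.prems by (intro ps_var_closed) simp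
    define H where "H = F \<oplus>\<^bsub>P\<^esub> (\<ominus>\<^bsub>P\<^esub> (ps_var R i \<otimes>\<^bsub>P\<^esub> G))"
    have H: "H \<in> carrier P" using F G v by (simp add: H_def)
    have "H m = \<zero>" if m: "set_mset m \<inter> {..<i} = {}" for m
    proof (cases "i \<in># m")
      case True
      then have "(ps_var R i \<otimes>\<^bsub>P\<^esub> G) m = F m" using G by (simp add: ps_var_mult G_def)
      then show ?thesis unfolding H_def using F G v by (simp add: ps_simps(1) ps_minus r_neg)
    next
      case False
      then have "(ps_var R i \<otimes>\<^bsub>P\<^esub> G) m = \<zero>" using G by (simp add: ps_var_mult)
      moreover have "set_mset m \<inter> {..<Suc i} = {}" using m False by (auto simp: less_Suc_eq)
      then have "F m = \<zero>" using Suc.prems by (simp add: ps_ideal_def)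
      ultimately show ?thesis unfolding H_def using F G v by (simp add: ps_simps(1) ps_minus)
    qed
    then have "H \<in> Idl\<^bsub>P\<^esub> (ps_var R ` {..<i})"
      using Suc.IH[of H] Suc.prems H by (simp add: ps_ideal_def)
    moreover have "F = H \<oplus>\<^bsub>P\<^esub> G \<otimes>\<^bsub>P\<^esub> ps_var R i"
      unfolding H_def using F G v by algebra
    ultimately show ?case
      unfolding lessThan_Suc image_insert using P.Idl_insert[OF v sub[of i]] Suc.prems G by auto
  qed
  then show "ps_ideal i \<subseteq> Idl\<^bsub>P\<^esub> (ps_var R ` {..<i})" using i by blast
qed

text \<open>Once the constant term is invertible, the coefficients of the inverse can be solved for
  successively by total degree.\<close>

lemma ps_unit_iff:
  assumes F: "F \<in> carrier P"
  shows "F \<in> Units P \<longleftrightarrow> F {#} \<in> Units R"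
proof
  have const: "(G \<otimes>\<^bsub>P\<^esub> H) {#} = G {#} \<otimes> H {#}" if "G \<in> carrier P" "H \<in> carrier P" for G H
    using that by (simp add: ps_simps)
  {
    assume "F \<in> Units P"
    then obtain G where "G \<in> carrier P" "G \<otimes>\<^bsub>P\<^esub> F = \<one>\<^bsub>P\<^esub>" by (auto simp: Units_def)
    then have "G {#} \<otimes> F {#} = \<one>" using const[of G F] F by (simp add: ps_simps)
    then show "F {#} \<in> Units R"
      using F \<open>G \<in> carrier P\<close> by (auto simp: Units_def m_comm intro!: bexI[of _ "G {#}"])
  }
  assume "F {#} \<in> Units R"
  then obtain u where u: "u \<in> carrier R" "F {#} \<otimes> u = \<one>" by (auto simp: Units_def)
  \<comment> \<open>The equation for the coefficient of the product at \<open>m\<close>, solved for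
    the value of the inverse at \<open>m\<close>. The summand is a restricted function so that only
    values at proper differences \<open>m - a\<close> matter, as well-founded recursion
    demands.\<close>
  define step where "step = (\<lambda>h m. if m = {#} then u
      else if set_mset m \<subseteq> {..<n} then \<ominus> (u \<otimes> finsum R (\<lambda>a\<in>{a. a \<subseteq># m} - {{#}}. F a \<otimes> h (m - a)) ({a. a \<subseteq># m} - {{#}})) else \<zero>)"
  define H where "H = wfrec (measure size) step"
  have H: "H m = step H m" for m
  proof -
    have "H m = step (cut H (measure size) m) m" 
      by (rule def_wfrec[OF eq_reflection[OF H_def] wf_measure])
    also have "\<dots> = step H m"
    proof -
      have "cut H (measure size) m (m - a) = H (m - a)" if "a \<subseteq># m" "a \<noteq> {#}" for a
        using size_Diff_less[OF that] by (simp add: cut_apply)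
      then have "(\<lambda>a\<in>{a. a \<subseteq># m} - {{#}}. F a \<otimes> cut H (measure size) m (m - a))
          = (\<lambda>a\<in>{a. a \<subseteq># m} - {{#}}. F a \<otimes> H (m - a))"
        by (intro restrict_ext) auto
      then show ?thesis unfolding step_def by simp
    qed
    finally show ?thesis .
  qed
  have Hc: "H m \<in> carrier R" for m
  proof (induction m rule: measure_induct_rule[of size])
    case (less m)
    have "(\<lambda>a. F a \<otimes> H (m - a)) \<in> {a. a \<subseteq># m} - {{#}} \<rightarrow> carrier R"
    proof
      fix a assume "a \<in> {a. a \<subseteq># m} - {{#}}"
      then have "size (m - a) < size m" by (intro size_Diff_less) auto
      then show "F a \<otimes> H (m - a) \<in> carrier R" using less F by simp
    qed
    then show ?case using u(1) by (subst H) (auto simp: step_def intro!: finsum_closed)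
  qed
  have HP: "H \<in> carrier P"
    unfolding ps_carrier
  proof (intro allI conjI impI Hc)
    fix m :: "nat multiset" assume "\<not> set_mset m \<subseteq> {..<n}"
    then show "H m = \<zero>" by (subst H) (auto simp: step_def)
  qed
  have "F \<otimes>\<^bsub>P\<^esub> H = \<one>\<^bsub>P\<^esub>"
  proof
    fix m :: "nat multiset"
    show "(F \<otimes>\<^bsub>P\<^esub> H) m = \<one>\<^bsub>P\<^esub> m"
    proof (cases "m = {#}")
      case True
      have "H {#} = u" by (subst H) (simp add: step_def)
      then show ?thesis using True const[OF F HP] u by (simp add: ps_simps)
    next
      case False
      show ?thesis
      proof (cases "set_mset m \<subseteq> {..<n}")
        case True
        let ?s = "\<Oplus>a\<in>{a. a \<subseteq># m} - {{#}}. F a \<otimes> H (m - a)"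
        have s: "?s \<in> carrier R" using F Hc by (auto intro!: finsum_closed)
        have "{a. a \<subseteq># m} = insert {#} ({a. a \<subseteq># m} - {{#}})" by auto
        then have "(\<Oplus>a\<in>{a. a \<subseteq># m}. F a \<otimes> H (m - a)) = (\<Oplus>a\<in>insert {#} ({a. a \<subseteq># m} - {{#}}). F a \<otimes> H (m - a))"
          by simp
        also have "\<dots> = F {#} \<otimes> H m \<oplus> ?s"
          using F Hc finite_submultisets[of m] by (subst finsum_insert) auto
        also have "finsum R (\<lambda>a\<in>{a. a \<subseteq># m} - {{#}}. F a \<otimes> H (m - a)) ({a. a \<subseteq># m} - {{#}}) = ?s"
          using F Hc by (intro finsum_cong') auto
        then have "H m = \<ominus> (u \<otimes> ?s)" using True False by (subst H) (simp add: step_def)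
        also have "F {#} \<otimes> \<ominus> (u \<otimes> ?s) \<oplus> ?s = \<ominus> ((F {#} \<otimes> u) \<otimes> ?s) \<oplus> ?s"
          using F u(1) s by (simp add: r_minus m_assoc)
        also have "\<dots> = \<zero>" unfolding u(2) using s by (simp add: l_neg)
        finally show ?thesis using False by (simp add: ps_simps)
      next
        case m: False
        then show ?thesis using ps_mult_closed[OF F HP] False by (auto simp: ps_carrier ps_simps(3))
      qed
    qed
  qed
  then show "F \<in> Units P" using F HP P.m_comm[OF F HP] by (auto simp: Units_def)
qed

end

text \<open>The system of parameters, variables first and the uniformizer last. Every index from
  \<open>n\<close> on gives the constant, because \<open>koszul\<close> takes an infinite family;
  only index \<open>n\<close> is needed.\<close>

definition ps_param :: "'a ring \<Rightarrow> nat \<Rightarrow> 'a \<Rightarrow> nat \<Rightarrow> nat multiset \<Rightarrow> 'a" where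
  "ps_param R n c i = (if i < n then ps_var R i else ps_const R c)"

locale power_series_uniformizer = power_series +
  fixes c :: 'a
  assumes c_closed: "c \<in> carrier R"
    and c_regular: "\<And>a. a \<in> carrier R \<Longrightarrow> c \<otimes> a = \<zero> \<Longrightarrow> a = \<zero>"
    and c_nonunits: "carrier R - Units R = PIdl c"
begin

abbreviation "t \<equiv> ps_param R n c"

lemma param_closed: "t i \<in> carrier P"
  by (simp add: ps_param_def ps_var_closed ps_const_closed c_closed)

sublocale P: koszul P t
  by (unfold_locales) (rule param_closed)

lemma param_image: "i \<le> n \<Longrightarrow> t ` {..<i} = ps_var R ` {..<i}"
  by (auto simp: ps_param_def)

text \<open>A variable shifts coefficients. Modulo all variables only the constant term survives,
  and \<open>c\<close> is a nonzerodivisor on it.\<close>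

lemma param_regular:
  assumes "i < Suc n" "F \<in> carrier P" "t i \<otimes>\<^bsub>P\<^esub> F \<in> Idl\<^bsub>P\<^esub> (t ` {..<i})"
  shows "F \<in> Idl\<^bsub>P\<^esub> (t ` {..<i})"
proof (cases "i = n")
  case True
  have "F m = \<zero>" if "set_mset m \<inter> {..<n} = {}" for m
  proof (cases "m = {#}")
    case True
    have "c \<otimes> F m = \<zero>"
      using assms(3) that \<open>i = n\<close> ps_const_mult[OF assms(2) c_closed, of m]
      by (simp add: param_image Idl_vars ps_ideal_def ps_param_def)
    then show ?thesis using c_regular assms(2) by simp
  next
    case False
    then have "\<not> set_mset m \<subseteq> {..<n}" using that by fastforce
    then show ?thesis using assms(2) by (simp add: ps_carrier)
  qed
  then show ?thesis using True assms(2) by (simp add: param_image Idl_vars ps_ideal_def)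
next
  case False
  then have i: "i < n" using assms(1) by simp
  have "F m = \<zero>" if m: "set_mset m \<inter> {..<i} = {}" for m
  proof -
    \<comment> \<open>The coefficient of the product at \<open>add_mset i m\<close> is
      \<open>F m\<close>, and adding \<open>i\<close> introduces no smaller index.\<close>
    have "set_mset (add_mset i m) \<inter> {..<i} = {}" using m by auto
    then have "(t i \<otimes>\<^bsub>P\<^esub> F) (add_mset i m) = \<zero>"
      using assms(3) i unfolding param_image[OF less_imp_le[OF i]] Idl_vars[OF less_imp_le[OF i]]
      by (auto simp: ps_ideal_def)
    then show ?thesis using i ps_var_mult[OF assms(2), of i "add_mset i m"] by (simp add: ps_param_def)
  qed
  then show ?thesis using i assms(2) by (simp add: param_image Idl_vars ps_ideal_def)
qed

text \<open>Units and membership in the generated ideal are both decided by the constant term. In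
  particular the nonunits form an ideal, so the power series ring is local.\<close>

lemma Idl_param: "Idl\<^bsub>P\<^esub> (t ` {..<Suc n}) = carrier P - Units P"
proof -
  have im: "t ` {..<Suc n} = insert (ps_const R c) (ps_var R ` {..<n})"
  proof -
    have "t n = ps_const R c" by (simp add: ps_param_def)
    then show ?thesis using param_image[of n] by (simp add: lessThan_Suc)
  qed
  have sub: "ps_var R ` {..<n} \<subseteq> carrier P" using ps_var_closed by auto
  have low: "F \<in> ps_ideal n \<longleftrightarrow> F \<in> carrier P \<and> F {#} = \<zero>" for F
  proof -
    have "F m = \<zero>" if "set_mset m \<inter> {..<n} = {}" "F \<in> carrier P" "F {#} = \<zero>" for m
      using that by (cases "m = {#}") (auto simp: ps_carrier, fastforce)
    then show ?thesis by (auto simp: ps_ideal_def)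
  qed
  have "F \<in> Idl\<^bsub>P\<^esub> (t ` {..<Suc n}) \<longleftrightarrow> F \<in> carrier P \<and> F {#} \<in> PIdl c" for F
  proof
    assume "F \<in> Idl\<^bsub>P\<^esub> (t ` {..<Suc n})"
    then obtain j r where jr: "j \<in> ps_ideal n" "r \<in> carrier P" "F = j \<oplus>\<^bsub>P\<^esub> r \<otimes>\<^bsub>P\<^esub> ps_const R c"
      unfolding im P.Idl_insert[OF ps_const_closed[OF c_closed] sub] Idl_vars[OF order_refl] by blast
    then have "j {#} = \<zero>" "j \<in> carrier P" by (auto simp: low)
    then have "F {#} = r {#} \<otimes> c"
      using jr ps_const_mult[OF jr(2) c_closed, of "{#}"] P.m_comm[OF jr(2) ps_const_closed[OF c_closed]] c_closed
      by (simp add: ps_simps(1) m_comm)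
    then show "F \<in> carrier P \<and> F {#} \<in> PIdl c"
      using jr \<open>j \<in> carrier P\<close> ps_const_closed[OF c_closed] by (auto simp: cgenideal_def)
  next
    assume F: "F \<in> carrier P \<and> F {#} \<in> PIdl c"
    then obtain r where r: "r \<in> carrier R" "F {#} = r \<otimes> c" by (auto simp: cgenideal_def)
    note cl = ps_const_closed[OF c_closed] ps_const_closed[OF r(1)]
    define j where "j = F \<oplus>\<^bsub>P\<^esub> (\<ominus>\<^bsub>P\<^esub> (ps_const R r \<otimes>\<^bsub>P\<^esub> ps_const R c))"
    have "j \<in> ps_ideal n"
      unfolding low
    proof
      show "j \<in> carrier P" unfolding j_def using F cl by simp
      have "(ps_const R r \<otimes>\<^bsub>P\<^esub> ps_const R c) {#} = r \<otimes> c"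
        using ps_const_mult[OF cl(1) r(1), of "{#}"] by (simp add: ps_const_def)
      moreover have "ps_const R r \<otimes>\<^bsub>P\<^esub> ps_const R c \<in> carrier P" using cl by simp
      ultimately show "j {#} = \<zero>" unfolding j_def ps_simps(1) using r c_closed by (simp add: ps_minus r_neg)
    qed
    moreover have "F = j \<oplus>\<^bsub>P\<^esub> ps_const R r \<otimes>\<^bsub>P\<^esub> ps_const R c"
      unfolding j_def using F cl by algebra
    ultimately show "F \<in> Idl\<^bsub>P\<^esub> (t ` {..<Suc n})"
      unfolding im P.Idl_insert[OF cl(1) sub] Idl_vars[OF order_refl] using cl by blast
  qed
  then show ?thesis using ps_unit_iff c_nonunits by auto
qed

end

section \<open>Elimination modulo the maximal ideal\<close>

section \<open>Linear algebra over local rings\<close>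

lemma (in ring) ideal_finsum:
  assumes "ideal J R" "\<And>i. i \<in> A \<Longrightarrow> f i \<in> J"
  shows "(\<Oplus>i\<in>A. f i) \<in> J"
  using assms(2)
proof (induction A rule: infinite_finite_induct)
  case (insert x A)
  then have "f x \<in> carrier R" "f \<in> A \<rightarrow> carrier R" using ideal.Icarr[OF assms(1)] by auto
  then show ?case using insert assms(1) by (simp add: additive_subgroup.a_closed ideal.axioms(1))
qed (use assms(1) in \<open>auto simp: additive_subgroup.zero_closed ideal.axioms(1)\<close>)

lemma (in ring) add_diff_cancel_right:
  assumes "a \<in> carrier R" "b \<in> carrier R"
  shows "(a \<ominus> b) \<oplus> b = a"
  using assms by algebra

text \<open>Gaussian elimination. A row of an independent family has a unit entry, for otherwise the
  row alone would be a relation; clearing its column leaves a smaller independent family.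
  Independence is assumed modulo the maximal ideal while the equations are solved in the ring
  itself, which is how nondegenerate becomes perfect.\<close>

lemma (in cring) independent_spans:
  assumes m: "ideal (carrier R - Units R) R"
    and "finite A" "finite B" "card A = card B" "\<And>i b. i \<in> A \<Longrightarrow> b \<in> B \<Longrightarrow> v i b \<in> carrier R"
    and "\<And>c. c \<in> A \<rightarrow> carrier R \<Longrightarrow> (\<And>b. b \<in> B \<Longrightarrow> (\<Oplus>i\<in>A. c i \<otimes> v i b) \<in> carrier R - Units R) \<Longrightarrow>
        \<forall>i\<in>A. c i \<in> carrier R - Units R"
    and "\<And>b. b \<in> B \<Longrightarrow> w b \<in> carrier R"
  shows "\<exists>c\<in>A \<rightarrow> carrier R. \<forall>b\<in>B. (\<Oplus>i\<in>A. c i \<otimes> v i b) = w b"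
  using assms(2-)
proof (induction A arbitrary: B v w)
  case empty
  then show ?case by auto
next
  case (insert i0 A)
  let ?m = "carrier R - Units R"
  have v [simp]: "i \<in> insert i0 A \<Longrightarrow> b \<in> B \<Longrightarrow> v i b \<in> carrier R" for i b using insert.prems by blast
  have expand: "(\<Oplus>i\<in>insert i0 A. c i \<otimes> v i b) = c i0 \<otimes> v i0 b \<oplus> (\<Oplus>i\<in>A. c i \<otimes> v i b)"
    if "c \<in> insert i0 A \<rightarrow> carrier R" "b \<in> B" for c b
    using that insert.hyps v[OF _ that(2)] by (subst finsum_insert) (auto simp: Pi_iff)
  have "\<exists>b0\<in>B. v i0 b0 \<in> Units R"
  proof (rule ccontr)
    assume "\<not> ?thesis"
    then have n: "v i0 b \<in> ?m" if "b \<in> B" for b using that by simp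
    define c where "c = (\<lambda>i. if i = i0 then \<one> else \<zero>)"
    have "(\<Oplus>i\<in>insert i0 A. c i \<otimes> v i b) \<in> ?m" if b: "b \<in> B" for b
    proof (rule ideal_finsum[OF m])
      fix i assume "i \<in> insert i0 A"
      then show "c i \<otimes> v i b \<in> ?m" using n[OF b] b v[of i b] ideal_zero[OF m] by (auto simp: c_def)
    qed
    then have "\<forall>i\<in>insert i0 A. c i \<in> ?m" by (intro insert.prems(4)) (auto simp: c_def)
    then show False by (simp add: c_def)
  qed
  then obtain b0 where b0: "b0 \<in> B" "v i0 b0 \<in> Units R" by blast
  define u where "u = inv v i0 b0"
  have u: "u \<in> carrier R" "v i0 b0 \<otimes> u = \<one>" using b0 by (auto simp: u_def)
  define B' where "B' = B - {b0}"
  \<comment> \<open>Subtracts the multiple of row \<open>i0\<close> that clears column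
    \<open>b0\<close>.\<close>
  define v' where "v' = (\<lambda>i b. v i b \<ominus> v i b0 \<otimes> u \<otimes> v i0 b)"
  have T': "(\<Oplus>i\<in>A. c i \<otimes> v' i b) = (\<Oplus>i\<in>A. c i \<otimes> v i b) \<ominus> (\<Oplus>i\<in>A. c i \<otimes> v i b0) \<otimes> u \<otimes> v i0 b"
    if c: "c \<in> A \<rightarrow> carrier R" and b: "b \<in> B" for c b
  proof -
    have cc: "c i \<in> carrier R" if "i \<in> A" for i using that c by auto
    have "(\<Oplus>i\<in>A. c i \<otimes> v' i b) = (\<Oplus>i\<in>A. c i \<otimes> v i b \<oplus> c i \<otimes> v i b0 \<otimes> (\<ominus> (u \<otimes> v i0 b)))"
    proof (rule finsum_cong')
      fix i assume i: "i \<in> A"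
      have car: "c i \<in> carrier R" "v i b \<in> carrier R" "v i b0 \<in> carrier R" "v i0 b \<in> carrier R" "u \<in> carrier R"
        using i b b0 cc u by auto
      show "c i \<otimes> v' i b = c i \<otimes> v i b \<oplus> c i \<otimes> v i b0 \<otimes> (\<ominus> (u \<otimes> v i0 b))"
        unfolding v'_def using car by algebra
    qed (use b b0 cc u in auto)
    also have "\<dots> = (\<Oplus>i\<in>A. c i \<otimes> v i b) \<oplus> (\<Oplus>i\<in>A. c i \<otimes> v i b0 \<otimes> (\<ominus> (u \<otimes> v i0 b)))"
      using b b0 cc u by (intro finsum_addf) auto
    also have "(\<Oplus>i\<in>A. c i \<otimes> v i b0 \<otimes> (\<ominus> (u \<otimes> v i0 b))) = (\<Oplus>i\<in>A. c i \<otimes> v i b0) \<otimes> (\<ominus> (u \<otimes> v i0 b))"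
      using b b0 cc u insert.hyps by (intro finsum_ldistr[symmetric]) auto
    finally show ?thesis using b b0 cc u
      by (simp add: minus_eq r_minus m_assoc finsum_closed Pi_iff)
  qed
  have Tc: "(\<Oplus>i\<in>A. c i \<otimes> v i b) \<in> carrier R" if "c \<in> A \<rightarrow> carrier R" "b \<in> B" for c b
    using that by (intro finsum_closed) (auto simp: Pi_iff)
  have upd: "(\<Oplus>i\<in>insert i0 A. (c(i0 := d)) i \<otimes> v i b) = d \<otimes> v i0 b \<oplus> (\<Oplus>i\<in>A. c i \<otimes> v i b)"
    if "c \<in> A \<rightarrow> carrier R" "d \<in> carrier R" "b \<in> B" for c d b
  proof -
    have "(\<Oplus>i\<in>A. (c(i0 := d)) i \<otimes> v i b) = (\<Oplus>i\<in>A. c i \<otimes> v i b)"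
      using that insert.hyps(2) by (intro finsum_cong') (auto simp: Pi_iff)
    then show ?thesis using that by (subst expand) auto
  qed
  have "\<exists>c\<in>A \<rightarrow> carrier R. \<forall>b\<in>B'. (\<Oplus>i\<in>A. c i \<otimes> v' i b) = w b \<ominus> w b0 \<otimes> u \<otimes> v i0 b"
  proof (rule insert.IH)
    show "finite B'" "card A = card B'"
      using insert.hyps insert.prems(1,2) b0 by (auto simp: B'_def)
    show "v' i b \<in> carrier R" if "i \<in> A" "b \<in> B'" for i b
      using that b0 u by (simp add: v'_def B'_def)
    show "w b \<ominus> w b0 \<otimes> u \<otimes> v i0 b \<in> carrier R" if "b \<in> B'" for b
      using that b0 u insert.prems(5) by (simp add: B'_def)
    fix c assume c: "c \<in> A \<rightarrow> carrier R" "\<And>b. b \<in> B' \<Longrightarrow> (\<Oplus>i\<in>A. c i \<otimes> v' i b) \<in> ?m"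
    \<comment> \<open>The coefficient at \<open>i0\<close> that makes the combination vanish in the
      pivot column; in the other columns it reproduces the eliminated rows.\<close>
    define d where "d = \<ominus> ((\<Oplus>i\<in>A. c i \<otimes> v i b0) \<otimes> u)"
    have d: "d \<in> carrier R" using Tc[OF c(1) b0(1)] u by (simp add: d_def)
    have "(\<Oplus>i\<in>insert i0 A. (c(i0 := d)) i \<otimes> v i b) \<in> ?m" if b: "b \<in> B" for b
    proof -
      define x y where xy: "x = (\<Oplus>i\<in>A. c i \<otimes> v i b0)" "y = (\<Oplus>i\<in>A. c i \<otimes> v i b)"
      have car: "x \<in> carrier R" "y \<in> carrier R" "v i0 b \<in> carrier R"
        using Tc[OF c(1)] b b0 by (auto simp: xy)
      have "(\<Oplus>i\<in>insert i0 A. (c(i0 := d)) i \<otimes> v i b) = \<ominus> (x \<otimes> u) \<otimes> v i0 b \<oplus> y"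
        using upd[OF c(1) d b] by (simp add: d_def xy)
      also have "\<dots> = y \<ominus> x \<otimes> u \<otimes> v i0 b" using car u(1) by algebra
      finally have e: "(\<Oplus>i\<in>insert i0 A. (c(i0 := d)) i \<otimes> v i b) = y \<ominus> x \<otimes> u \<otimes> v i0 b" .
      show ?thesis
      proof (cases "b = b0")
        case True
        have "x \<otimes> u \<otimes> v i0 b = x \<otimes> (v i0 b0 \<otimes> u)" unfolding True using car u(1) True by algebra
        then have "y \<ominus> x \<otimes> u \<otimes> v i0 b = \<zero>" unfolding u(2) using car True by (simp add: xy minus_eq r_neg)
        then show ?thesis using e ideal_zero[OF m] by simp
      next
        case False
        then show ?thesis using c(2)[of b] b T'[OF c(1) b] e by (simp add: xy B'_def)
      qed
    qed
    then have "\<forall>i\<in>insert i0 A. (c(i0 := d)) i \<in> ?m"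
      using c(1) d by (intro insert.prems(4)) auto
    then show "\<forall>i\<in>A. c i \<in> ?m" using insert.hyps(2) by (metis fun_upd_other insertI2)
  qed
  then obtain c where c: "c \<in> A \<rightarrow> carrier R"
    "\<And>b. b \<in> B' \<Longrightarrow> (\<Oplus>i\<in>A. c i \<otimes> v' i b) = w b \<ominus> w b0 \<otimes> u \<otimes> v i0 b" by blast
  \<comment> \<open>Chosen so that the pivot column takes the prescribed value; the targets passed
    to the induction were shifted to match.\<close>
  define d where "d = (w b0 \<ominus> (\<Oplus>i\<in>A. c i \<otimes> v i b0)) \<otimes> u"
  have d: "d \<in> carrier R" using Tc[OF c(1) b0(1)] u insert.prems(5) b0 by (simp add: d_def)
  have "(\<Oplus>i\<in>insert i0 A. (c(i0 := d)) i \<otimes> v i b) = w b" if b: "b \<in> B" for b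
  proof -
    define x y where xy: "x = (\<Oplus>i\<in>A. c i \<otimes> v i b0)" "y = (\<Oplus>i\<in>A. c i \<otimes> v i b)"
    have car: "x \<in> carrier R" "y \<in> carrier R" "v i0 b \<in> carrier R" "w b \<in> carrier R" "w b0 \<in> carrier R" "u \<in> carrier R"
      using Tc[OF c(1)] b b0 insert.prems(5) u by (auto simp: xy)
    have e: "(\<Oplus>i\<in>insert i0 A. (c(i0 := d)) i \<otimes> v i b) = (w b0 \<ominus> x) \<otimes> u \<otimes> v i0 b \<oplus> y"
      using upd[OF c(1) d b] by (simp add: d_def xy)
    show ?thesis
    proof (cases "b = b0")
      case True
      have "(w b0 \<ominus> x) \<otimes> u \<otimes> v i0 b \<oplus> y = (w b0 \<ominus> x) \<otimes> (v i0 b0 \<otimes> u) \<oplus> x"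
        unfolding True using car True by (simp add: xy m_assoc m_comm[of u])
      then show ?thesis unfolding e u(2) using car True by (simp add: minus_eq a_assoc l_neg)
    next
      case False
      have "y \<ominus> x \<otimes> u \<otimes> v i0 b = w b \<ominus> w b0 \<otimes> u \<otimes> v i0 b"
        using c(2)[of b] b False T'[OF c(1) b] by (simp add: xy B'_def)
      then have "y = (w b \<ominus> w b0 \<otimes> u \<otimes> v i0 b) \<oplus> x \<otimes> u \<otimes> v i0 b"
        using add_diff_cancel_right[of y "x \<otimes> u \<otimes> v i0 b"] car by simp
      then show ?thesis unfolding e using car by algebra
    qed
  qed
  moreover have "c(i0 := d) \<in> insert i0 A \<rightarrow> carrier R" using c(1) d by auto
  ultimately show ?case by blast
qed

text \<open>If all the rows were independent modulo the maximal ideal, those in \<open>A\<close>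
  would already span row \<open>j\<close>, and that expression is a relation with coefficient minus
  one at \<open>j\<close>.\<close>

lemma (in cring) dependent_of_card_less:
  assumes m: "ideal (carrier R - Units R) R"
    and A: "finite A" "finite B" "card A = card B" "j \<notin> A"
    and v: "\<And>i b. i \<in> insert j A \<Longrightarrow> b \<in> B \<Longrightarrow> v i b \<in> carrier R"
  shows "\<exists>c\<in>insert j A \<rightarrow> carrier R. (\<exists>i\<in>insert j A. c i \<in> Units R) \<and>
     (\<forall>b\<in>B. (\<Oplus>i\<in>insert j A. c i \<otimes> v i b) \<in> carrier R - Units R)"
proof (rule ccontr)
  let ?m = "carrier R - Units R"
  assume "\<not> ?thesis"
  then have indep: "i \<in> insert j A \<Longrightarrow> c i \<notin> Units R"
    if "c \<in> insert j A \<rightarrow> carrier R" "\<And>b. b \<in> B \<Longrightarrow> (\<Oplus>i\<in>insert j A. c i \<otimes> v i b) \<in> ?m" for c i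
    using that by blast
  have upd: "(\<Oplus>i\<in>insert j A. (c(j := d)) i \<otimes> v i b) = d \<otimes> v j b \<oplus> (\<Oplus>i\<in>A. c i \<otimes> v i b)"
    if "c \<in> A \<rightarrow> carrier R" "d \<in> carrier R" "b \<in> B" for c d b
  proof -
    have "(\<Oplus>i\<in>A. (c(j := d)) i \<otimes> v i b) = (\<Oplus>i\<in>A. c i \<otimes> v i b)"
      using that A v by (intro finsum_cong') (auto simp: Pi_iff)
    then show ?thesis using that A v by (subst finsum_insert) (auto simp: Pi_iff)
  qed
  have "\<exists>c\<in>A \<rightarrow> carrier R. \<forall>b\<in>B. (\<Oplus>i\<in>A. c i \<otimes> v i b) = v j b"
  proof (rule independent_spans[OF m A(1-3)])
    fix c assume c: "c \<in> A \<rightarrow> carrier R" "\<And>b. b \<in> B \<Longrightarrow> (\<Oplus>i\<in>A. c i \<otimes> v i b) \<in> ?m"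
    have "(\<Oplus>i\<in>insert j A. (c(j := \<zero>)) i \<otimes> v i b) \<in> ?m" if "b \<in> B" for b
      using upd[OF c(1) _ that, of \<zero>] c(2)[OF that] v that by simp
    then have "(c(j := \<zero>)) i \<notin> Units R" if "i \<in> insert j A" for i
      using c(1) that by (intro indep) auto
    then show "\<forall>i\<in>A. c i \<in> ?m" using c(1) A(4) by (metis DiffI PiE fun_upd_other insertI2)
  qed (use v in auto)
  then obtain c where c: "c \<in> A \<rightarrow> carrier R" "\<And>b. b \<in> B \<Longrightarrow> (\<Oplus>i\<in>A. c i \<otimes> v i b) = v j b" by blast
  have "(\<Oplus>i\<in>insert j A. (c(j := \<ominus> \<one>)) i \<otimes> v i b) \<in> ?m" if "b \<in> B" for b
    using upd[OF c(1) _ that, of "\<ominus> \<one>"] c(2)[OF that] v that ideal_zero[OF m] by (simp add: l_minus l_neg)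
  then have "(c(j := \<ominus> \<one>)) j \<notin> Units R" using c(1) by (intro indep) auto
  then show False using Units_minus_one_closed by simp
qed

section \<open>Finite free algebras: functionals, extended ideals and duality\<close>

section \<open>Finite free algebras\<close>

lemma ex1_eq: "\<exists>!x. P x \<Longrightarrow> P a \<Longrightarrow> P b \<Longrightarrow> a = b"
  by blast

locale free_algebra = ring_hom_cring S A h for S :: "('s, 'm) ring_scheme" and A :: "('a, 'k) ring_scheme" (structure) and h +
  fixes B :: "'a set"
  assumes B_finite: "finite B" and B_closed: "B \<subseteq> carrier A"
    and coords_unique: "\<And>x. x \<in> carrier A \<Longrightarrow>
      \<exists>!c. c \<in> B \<rightarrow>\<^sub>E carrier S \<and> x = (\<Oplus>b\<in>B. h (c b) \<otimes> b)"
begin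

definition coord :: "'a \<Rightarrow> 'a \<Rightarrow> 's" where
  "coord x = (THE c. c \<in> B \<rightarrow>\<^sub>E carrier S \<and> x = (\<Oplus>b\<in>B. h (c b) \<otimes> b))"

lemma B_carrier [simp]: "b \<in> B \<Longrightarrow> b \<in> carrier A"
  using B_closed by blast

lemma coord_props:
  assumes "x \<in> carrier A"
  shows "coord x \<in> B \<rightarrow>\<^sub>E carrier S" "x = (\<Oplus>b\<in>B. h (coord x b) \<otimes> b)"
  using theI'[OF coords_unique[OF assms]] unfolding coord_def by auto

lemma coord_closed [simp]: "x \<in> carrier A \<Longrightarrow> b \<in> B \<Longrightarrow> coord x b \<in> carrier S"
  using coord_props(1) by blast

lemma coord_eqI:
  assumes "\<And>b. b \<in> B \<Longrightarrow> c b \<in> carrier S" "x = (\<Oplus>b\<in>B. h (c b) \<otimes> b)" "b \<in> B"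
  shows "coord x b = c b"
proof -
  have x: "x \<in> carrier A" using assms(1) unfolding assms(2) by (auto intro!: R.finsum_closed S.finsum_closed)
  have "x = (\<Oplus>b\<in>B. h (restrict c B b) \<otimes> b)"
    unfolding assms(2) using assms(1) by (intro S.finsum_cong') auto
  moreover have "restrict c B \<in> B \<rightarrow>\<^sub>E carrier S" using assms(1) by auto
  ultimately have "coord x = restrict c B"
    by (intro ex1_eq[OF coords_unique[OF x]] conjI coord_props[OF x])
  then show ?thesis using assms(3) by simp
qed

text \<open>The elements of the dual Hom_S(A, S).\<close>

definition lin :: "('a \<Rightarrow> 's) \<Rightarrow> bool" where
  "lin L \<longleftrightarrow> (\<forall>x\<in>carrier A. L x \<in> carrier S) \<and>
     (\<forall>x\<in>carrier A. \<forall>y\<in>carrier A. L (x \<oplus> y) = L x \<oplus>\<^bsub>S\<^esub> L y) \<and>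
     (\<forall>s\<in>carrier S. \<forall>x\<in>carrier A. L (h s \<otimes> x) = s \<otimes>\<^bsub>S\<^esub> L x)"

lemma linD:
  assumes "lin L"
  shows "x \<in> carrier A \<Longrightarrow> L x \<in> carrier S"
    "x \<in> carrier A \<Longrightarrow> y \<in> carrier A \<Longrightarrow> L (x \<oplus> y) = L x \<oplus>\<^bsub>S\<^esub> L y"
    "s \<in> carrier S \<Longrightarrow> x \<in> carrier A \<Longrightarrow> L (h s \<otimes> x) = s \<otimes>\<^bsub>S\<^esub> L x"
  using assms unfolding lin_def by auto

lemma lin_zero:
  assumes "lin L" shows "L \<zero> = \<zero>\<^bsub>S\<^esub>"
  using linD(3)[OF assms, of "\<zero>\<^bsub>S\<^esub>" "\<zero>"] linD(1)[OF assms] by simp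

lemma lin_finsum:
  assumes "lin L" "finite T" "\<And>i. i \<in> T \<Longrightarrow> f i \<in> carrier A"
  shows "L (\<Oplus>i\<in>T. f i) = (\<Oplus>\<^bsub>S\<^esub>i\<in>T. L (f i))"
  using assms(2,3)
proof (induction T)
  case (insert i T)
  then have "f \<in> T \<rightarrow> carrier A" "(\<lambda>i. L (f i)) \<in> T \<rightarrow> carrier S" using linD(1)[OF assms(1)] by auto
  then show ?case using insert linD[OF assms(1)] by (simp add: S.finsum_closed)
qed (simp add: lin_zero[OF assms(1)])

lemma lin_expand:
  assumes L: "lin L" and x: "x \<in> carrier A"
  shows "L x = (\<Oplus>\<^bsub>S\<^esub>b\<in>B. coord x b \<otimes>\<^bsub>S\<^esub> L b)"
proof -
  have "L x = L (\<Oplus>b\<in>B. h (coord x b) \<otimes> b)" using coord_props(2)[OF x] by simp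
  also have "\<dots> = (\<Oplus>\<^bsub>S\<^esub>b\<in>B. L (h (coord x b) \<otimes> b))"
    using x by (intro lin_finsum[OF L B_finite]) auto
  also have "\<dots> = (\<Oplus>\<^bsub>S\<^esub>b\<in>B. coord x b \<otimes>\<^bsub>S\<^esub> L b)"
    using x linD[OF L] by (intro R.finsum_cong') auto
  finally show ?thesis .
qed

lemma coord_lin:
  assumes b: "b \<in> B"
  shows "lin (\<lambda>x. coord x b)"
  unfolding lin_def
proof (intro conjI ballI)
  fix x assume x: "x \<in> carrier A"
  show "coord x b \<in> carrier S" using x b by simp
  {
    fix y assume y: "y \<in> carrier A"
    show "coord (x \<oplus> y) b = coord x b \<oplus>\<^bsub>S\<^esub> coord y b"
    proof (rule coord_eqI[OF _ _ b])
      have "x \<oplus> y = (\<Oplus>b\<in>B. h (coord x b) \<otimes> b) \<oplus> (\<Oplus>b\<in>B. h (coord y b) \<otimes> b)"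
        using coord_props(2)[OF x] coord_props(2)[OF y] by simp
      also have "\<dots> = (\<Oplus>b\<in>B. h (coord x b) \<otimes> b \<oplus> h (coord y b) \<otimes> b)"
        using x y by (intro S.finsum_addf[symmetric]) auto
      also have "\<dots> = (\<Oplus>b\<in>B. h (coord x b \<oplus>\<^bsub>S\<^esub> coord y b) \<otimes> b)"
        using x y by (intro S.finsum_cong') (auto simp: S.l_distr)
      finally show "x \<oplus> y = (\<Oplus>b\<in>B. h (coord x b \<oplus>\<^bsub>S\<^esub> coord y b) \<otimes> b)" .
    qed (use x y in simp)
  }
  fix s assume s: "s \<in> carrier S"
  show "coord (h s \<otimes> x) b = s \<otimes>\<^bsub>S\<^esub> coord x b"
  proof (rule coord_eqI[OF _ _ b])
    have "h s \<otimes> x = h s \<otimes> (\<Oplus>b\<in>B. h (coord x b) \<otimes> b)"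
      using coord_props(2)[OF x] by simp
    also have "\<dots> = (\<Oplus>b\<in>B. h s \<otimes> (h (coord x b) \<otimes> b))"
      using s x by (intro S.finsum_rdistr B_finite) auto
    also have "\<dots> = (\<Oplus>b\<in>B. h (s \<otimes>\<^bsub>S\<^esub> coord x b) \<otimes> b)"
      using s x by (intro S.finsum_cong') (auto simp: S.m_assoc)
    finally show "h s \<otimes> x = (\<Oplus>b\<in>B. h (s \<otimes>\<^bsub>S\<^esub> coord x b) \<otimes> b)" .
  qed (use s x in simp)
qed

lemma coord_basis:
  assumes "b \<in> B" "b' \<in> B"
  shows "coord b b' = (if b = b' then \<one>\<^bsub>S\<^esub> else \<zero>\<^bsub>S\<^esub>)"
proof (rule coord_eqI[OF _ _ assms(2)])
  have "(\<Oplus>b'\<in>B. h (if b = b' then \<one>\<^bsub>S\<^esub> else \<zero>\<^bsub>S\<^esub>) \<otimes> b') = (\<Oplus>b'\<in>B. if b = b' then b' else \<zero>)"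
    using assms by (intro S.finsum_cong') auto
  also have "\<dots> = b" using S.finsum_singleton[OF assms(1) B_finite, of "\<lambda>b. b"] assms B_closed by auto
  finally show "b = (\<Oplus>b'\<in>B. h (if b = b' then \<one>\<^bsub>S\<^esub> else \<zero>\<^bsub>S\<^esub>) \<otimes> b')" by simp
qed auto

text \<open>The ideal \<open>J A\<close>, described by coordinates.\<close>

definition extend :: "'s set \<Rightarrow> 'a set" where
  "extend J = {x \<in> carrier A. \<forall>b\<in>B. coord x b \<in> J}"

lemma lin_extend:
  assumes "ideal J S" "lin L" "x \<in> extend J"
  shows "L x \<in> J"
proof -
  have x: "x \<in> carrier A" using assms(3) by (simp add: extend_def)
  show ?thesis
    unfolding lin_expand[OF assms(2) x]
  proof (rule R.ideal_finsum[OF assms(1)])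
    fix b assume "b \<in> B"
    then show "coord x b \<otimes>\<^bsub>S\<^esub> L b \<in> J"
      using assms x linD[OF assms(2)] by (auto simp: extend_def intro: ideal.I_r_closed)
  qed
qed

text \<open>The action of \<open>A\<close> on its dual.\<close>

lemma lin_mult: "lin L \<Longrightarrow> a \<in> carrier A \<Longrightarrow> lin (\<lambda>x. L (a \<otimes> x))"
  unfolding lin_def by (auto simp: S.r_distr S.m_lcomm[of a "h _"])

text \<open>Multiplication by an element of \<open>A\<close> followed by a coordinate is again a
  functional, hence sends elements with coordinates in \<open>J\<close> into
  \<open>J\<close>.\<close>

lemma extend_ideal:
  assumes J: "ideal J S"
  shows "ideal (extend J) A"
proof (rule S.ideal_closureI)
  show "\<zero> \<in> extend J" using lin_zero[OF coord_lin] R.ideal_zero[OF J] by (simp add: extend_def)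
  show "x \<otimes> a \<in> extend J" if "a \<in> extend J" "x \<in> carrier A" for a x
    using that lin_extend[OF J lin_mult[OF coord_lin that(2)] that(1)] by (auto simp: extend_def)
qed (auto simp: extend_def coord_lin[THEN linD(2)] R.ideal_add[OF J])

lemma hom_extend:
  assumes "ideal J S" "s \<in> J" "a \<in> carrier A"
  shows "h s \<otimes> a \<in> extend J"
  using assms R.ideal_carr[OF assms(1,2)] coord_lin[THEN linD(3)]
  by (auto simp: extend_def intro: ideal.I_r_closed)

text \<open>Frees the coordinate description from the chosen basis and ties it to the ideals
  generated by images of parameters.\<close>

lemma extend_Idl:
  assumes Y: "Y \<subseteq> carrier S"
  shows "extend (Idl\<^bsub>S\<^esub> Y) = Idl (h ` Y)"
proof
  note J = R.genideal_ideal[OF Y]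
  have hY: "h ` Y \<subseteq> carrier A" using Y by auto
  note K = S.genideal_ideal[OF hY]
  show "Idl (h ` Y) \<subseteq> extend (Idl\<^bsub>S\<^esub> Y)"
  proof (rule S.genideal_minimal[OF extend_ideal[OF J]], rule image_subsetI)
    fix y assume "y \<in> Y"
    then have "y \<in> Idl\<^bsub>S\<^esub> Y" "y \<in> carrier S" using R.Idl_memI[OF Y] Y by auto
    then show "h y \<in> extend (Idl\<^bsub>S\<^esub> Y)" using hom_extend[OF J, of y "\<one>"] by simp
  qed
  have "Idl\<^bsub>S\<^esub> Y \<subseteq> {s \<in> carrier S. h s \<in> Idl (h ` Y)}"
  proof (rule R.genideal_minimal)
    show "ideal {s \<in> carrier S. h s \<in> Idl (h ` Y)} S"
      by (rule ring.ideal_vimage[OF K])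
  qed (use Y S.Idl_memI[OF hY] in auto)
  then have hJ: "h s \<in> Idl (h ` Y)" if "s \<in> Idl\<^bsub>S\<^esub> Y" for s using that by blast
  show "extend (Idl\<^bsub>S\<^esub> Y) \<subseteq> Idl (h ` Y)"
  proof
    fix x assume x: "x \<in> extend (Idl\<^bsub>S\<^esub> Y)"
    then have xA: "x \<in> carrier A" by (simp add: extend_def)
    have "(\<Oplus>b\<in>B. h (coord x b) \<otimes> b) \<in> Idl (h ` Y)"
      using x hJ by (intro S.ideal_finsum[OF K] ideal.I_r_closed[OF K]) (auto simp: extend_def)
    then show "x \<in> Idl (h ` Y)" using coord_props(2)[OF xA] by simp
  qed
qed

lemma extend_zero: "extend {\<zero>\<^bsub>S\<^esub>} = {\<zero>}"
  using extend_Idl[of "{}"] by (simp add: R.Idl_empty S.Idl_empty)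

text \<open>By nondegeneracy the rows of the Gram matrix of the form are independent modulo the
  maximal ideal. They therefore reach every unit vector over \<open>S\<close>, and the solutions are
  the basis dual to \<open>B\<close>.\<close>

lemma perfect_pairing:
  assumes m: "ideal (carrier S - Units S) S" (is "ideal ?m S")
    and L: "lin L"
    and nondeg: "\<And>a. a \<in> carrier A \<Longrightarrow> a \<notin> extend (carrier S - Units S) \<Longrightarrow>
      \<exists>x\<in>carrier A. L (a \<otimes> x) \<in> Units S"
  obtains d where "\<And>b. b \<in> B \<Longrightarrow> d b \<in> carrier A"
    "\<And>b b'. b \<in> B \<Longrightarrow> b' \<in> B \<Longrightarrow> L (b' \<otimes> d b) = (if b' = b then \<one>\<^bsub>S\<^esub> else \<zero>\<^bsub>S\<^esub>)"
proof -
  have sumL: "L ((\<Oplus>i\<in>B. h (c i) \<otimes> i) \<otimes> b) = (\<Oplus>\<^bsub>S\<^esub>i\<in>B. c i \<otimes>\<^bsub>S\<^esub> L (i \<otimes> b))"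
    if c: "c \<in> B \<rightarrow> carrier S" and b: "b \<in> carrier A" for c b
  proof -
    have cc: "i \<in> B \<Longrightarrow> c i \<in> carrier S" for i using c by auto
    have "(\<Oplus>i\<in>B. h (c i) \<otimes> i) \<otimes> b = (\<Oplus>i\<in>B. h (c i) \<otimes> i \<otimes> b)"
      using cc b by (intro S.finsum_ldistr B_finite) auto
    then have "L ((\<Oplus>i\<in>B. h (c i) \<otimes> i) \<otimes> b) = (\<Oplus>\<^bsub>S\<^esub>i\<in>B. L (h (c i) \<otimes> i \<otimes> b))"
      using lin_finsum[OF L B_finite, of "\<lambda>i. h (c i) \<otimes> i \<otimes> b"] cc b by simp
    also have "\<dots> = (\<Oplus>\<^bsub>S\<^esub>i\<in>B. c i \<otimes>\<^bsub>S\<^esub> L (i \<otimes> b))"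
      using cc b linD[OF L] by (intro R.finsum_cong') (auto simp: S.m_assoc)
    finally show ?thesis .
  qed
  have "\<exists>d\<in>carrier A. \<forall>b'\<in>B. L (b' \<otimes> d) = (if b' = b then \<one>\<^bsub>S\<^esub> else \<zero>\<^bsub>S\<^esub>)" if "b \<in> B" for b
  proof -
    have "\<exists>c\<in>B \<rightarrow> carrier S. \<forall>b'\<in>B. (\<Oplus>\<^bsub>S\<^esub>i\<in>B. c i \<otimes>\<^bsub>S\<^esub> L (i \<otimes> b')) = (if b' = b then \<one>\<^bsub>S\<^esub> else \<zero>\<^bsub>S\<^esub>)"
    proof (rule R.independent_spans[OF m B_finite B_finite refl])
      fix c assume c: "c \<in> B \<rightarrow> carrier S" "\<And>b. b \<in> B \<Longrightarrow> (\<Oplus>\<^bsub>S\<^esub>i\<in>B. c i \<otimes>\<^bsub>S\<^esub> L (i \<otimes> b)) \<in> ?m"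
      have cc: "i \<in> B \<Longrightarrow> c i \<in> carrier S" for i using c(1) by auto
      define a where "a = (\<Oplus>i\<in>B. h (c i) \<otimes> i)"
      have a: "a \<in> carrier A" using cc by (auto simp: a_def intro!: S.finsum_closed)
      have "L (a \<otimes> x) \<in> ?m" if x: "x \<in> carrier A" for x
        unfolding lin_expand[OF lin_mult[OF L a] x]
      proof (rule R.ideal_finsum[OF m])
        fix b assume b: "b \<in> B"
        then have "L (a \<otimes> b) \<in> ?m" using c(2) sumL[OF c(1)] by (simp add: a_def)
        then show "coord x b \<otimes>\<^bsub>S\<^esub> L (a \<otimes> b) \<in> ?m" using x b by (intro R.ideal_mult[OF m]) auto
      qed
      then have "a \<in> extend ?m" using nondeg[OF a] by blast
      moreover have "coord a i = c i" if "i \<in> B" for i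
        using cc by (intro coord_eqI[OF _ _ that]) (auto simp: a_def)
      ultimately show "\<forall>i\<in>B. c i \<in> ?m" by (simp add: extend_def)
    qed (use linD[OF L] in auto)
    then obtain c where c: "c \<in> B \<rightarrow> carrier S"
      "\<And>b'. b' \<in> B \<Longrightarrow> (\<Oplus>\<^bsub>S\<^esub>i\<in>B. c i \<otimes>\<^bsub>S\<^esub> L (i \<otimes> b')) = (if b' = b then \<one>\<^bsub>S\<^esub> else \<zero>\<^bsub>S\<^esub>)" by blast
    have a: "(\<Oplus>i\<in>B. h (c i) \<otimes> i) \<in> carrier A" using c(1) by (auto simp: Pi_iff intro!: S.finsum_closed)
    show ?thesis
      using sumL[OF c(1)] c(2) a by (intro bexI[OF _ a]) (auto simp: S.m_comm)
  qed
  then show ?thesis using that by metis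
qed

text \<open>The ring \<open>A\<close> is Gorenstein relative to \<open>S\<close>: the pairing \<open>L (a x)\<close> identifies \<open>A\<close> with its dual, so
  the map \<open>x \<mapsto> L (a (e x))\<close>, which vanishes on \<open>I\<close>, is given by an element of the annihilator of \<open>I\<close>.\<close>

lemma annihilator_lift:
  assumes L: "lin L"
    and d: "\<And>b. b \<in> B \<Longrightarrow> d b \<in> carrier A"
    "\<And>b b'. b \<in> B \<Longrightarrow> b' \<in> B \<Longrightarrow> L (b' \<otimes> d b) = (if b' = b then \<one>\<^bsub>S\<^esub> else \<zero>\<^bsub>S\<^esub>)"
    and I: "ideal I A"
    and e: "\<And>x. x \<in> carrier A \<Longrightarrow> e x \<in> carrier A"
      "\<And>x y. x \<in> carrier A \<Longrightarrow> y \<in> carrier A \<Longrightarrow> e (x \<oplus> y) = e x \<oplus> e y"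
      "\<And>s x. s \<in> carrier S \<Longrightarrow> x \<in> carrier A \<Longrightarrow> e (h s \<otimes> x) = h s \<otimes> e x"
      "\<And>x. x \<in> I \<Longrightarrow> e x = \<zero>" "\<And>x. x \<in> carrier A \<Longrightarrow> x \<ominus> e x \<in> I"
    and J: "ideal J S"
    and a: "a \<in> carrier A" "\<And>i. i \<in> I \<Longrightarrow> a \<otimes> i \<in> extend J"
  shows "\<exists>a'\<in>annihilator A I. a \<ominus> a' \<in> extend J"
proof -
  \<comment> \<open>Pairing \<open>x\<close> with the dual basis element \<open>d b\<close> returns
    the coordinate of \<open>x\<close> at \<open>b\<close>.\<close>
  have in_extend: "x \<in> extend K" if x: "x \<in> carrier A" and "\<And>y. y \<in> carrier A \<Longrightarrow> L (x \<otimes> y) \<in> K" for x K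
  proof -
    have "L (x \<otimes> d b) = coord x b" if b: "b \<in> B" for b
    proof -
      have "lin (\<lambda>x. L (x \<otimes> d b))"
        using linD[OF L] d(1)[OF b] by (auto simp: lin_def S.l_distr S.m_assoc)
      then have "L (x \<otimes> d b) = (\<Oplus>\<^bsub>S\<^esub>b'\<in>B. coord x b' \<otimes>\<^bsub>S\<^esub> L (b' \<otimes> d b))"
        using lin_expand x by blast
      also have "\<dots> = (\<Oplus>\<^bsub>S\<^esub>b'\<in>B. if b = b' then coord x b' else \<zero>\<^bsub>S\<^esub>)"
        using d(2)[OF b] x by (intro R.finsum_cong') auto
      also have "\<dots> = coord x b" using R.finsum_singleton[OF b B_finite, of "coord x"] x by auto
      finally show ?thesis .
    qed
    then show ?thesis using that d(1) unfolding extend_def by auto metis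
  qed
  define F where "F = (\<lambda>x. L (a \<otimes> e x))"
  have F: "lin F" using linD[OF lin_mult[OF L a(1)]] e(1-3) by (auto simp: lin_def F_def)
  \<comment> \<open>The element that represents the functional \<open>F\<close> through the form,
    read off from the dual basis.\<close>
  define a' where "a' = (\<Oplus>b\<in>B. h (F b) \<otimes> d b)"
  have a': "a' \<in> carrier A" using linD(1)[OF F] d(1) by (auto simp: a'_def intro!: S.finsum_closed)
  have rep: "L (a' \<otimes> x) = F x" if x: "x \<in> carrier A" for x
  proof -
    have "L (a' \<otimes> b') = F b'" if b': "b' \<in> B" for b'
    proof -
      have "b' \<otimes> a' = (\<Oplus>b\<in>B. b' \<otimes> (h (F b) \<otimes> d b))"
        unfolding a'_def using linD(1)[OF F] d(1) b' by (intro S.finsum_rdistr B_finite) auto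
      then have "L (b' \<otimes> a') = (\<Oplus>\<^bsub>S\<^esub>b\<in>B. L (b' \<otimes> (h (F b) \<otimes> d b)))"
        using lin_finsum[OF L B_finite, of "\<lambda>b. b' \<otimes> (h (F b) \<otimes> d b)"] linD(1)[OF F] d(1) b' by simp
      also have "\<dots> = (\<Oplus>\<^bsub>S\<^esub>b\<in>B. if b' = b then F b else \<zero>\<^bsub>S\<^esub>)"
        using linD[OF L] linD(1)[OF F] d b' by (intro R.finsum_cong') (auto simp: S.m_lcomm[of b'])
      also have "\<dots> = F b'" using R.finsum_singleton[OF b' B_finite, of F] linD(1)[OF F] by auto
      finally show ?thesis using S.m_comm[of a' b'] a' b' by simp
    qed
    then show ?thesis
      unfolding lin_expand[OF lin_mult[OF L a'] x] lin_expand[OF F x]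
      using x linD(1)[OF F] by (intro R.finsum_cong') auto
  qed
  have "a' \<otimes> i = \<zero>" if i: "i \<in> I" for i
  proof -
    have iA: "i \<in> carrier A" using ideal.Icarr[OF I i] .
    \<comment> \<open>With the zero ideal in \<open>in_extend\<close> this is nondegeneracy:
      multiples of \<open>i\<close> stay in \<open>I\<close>, where \<open>F\<close>
      vanishes.\<close>
    have "a' \<otimes> i \<in> extend {\<zero>\<^bsub>S\<^esub>}"
    proof (rule in_extend)
      fix y assume y: "y \<in> carrier A"
      have "L (a' \<otimes> i \<otimes> y) = F (i \<otimes> y)" using rep[of "i \<otimes> y"] a' iA y by (simp add: S.m_assoc)
      also have "\<dots> = \<zero>\<^bsub>S\<^esub>"
        using e(4)[OF ideal.I_r_closed[OF I i y]] lin_zero[OF L] a(1) by (simp add: F_def)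
      finally show "L (a' \<otimes> i \<otimes> y) \<in> {\<zero>\<^bsub>S\<^esub>}" by simp
    qed (use a' iA in simp)
    then show ?thesis by (simp add: extend_zero)
  qed
  then have "a' \<in> annihilator A I" using a' by (simp add: annihilator_def)
  moreover have "a \<ominus> a' \<in> extend J"
  proof (rule in_extend)
    fix y assume y: "y \<in> carrier A"
    have "L (a \<otimes> (y \<ominus> e y)) \<in> J" using lin_extend[OF J L a(2)[OF e(5)[OF y]]] .
    moreover have "L ((a \<ominus> a') \<otimes> y) = L (a \<otimes> (y \<ominus> e y))"
    proof -
      have "L ((a \<ominus> a') \<otimes> y) \<oplus>\<^bsub>S\<^esub> L (a' \<otimes> y) = L (a \<otimes> y)"
      proof -
        have "(a \<ominus> a') \<otimes> y \<oplus> a' \<otimes> y = a \<otimes> y" using a(1) a' y by algebra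
        then show ?thesis using linD(2)[OF L, of "(a \<ominus> a') \<otimes> y" "a' \<otimes> y"] a(1) a' y by simp
      qed
      moreover have "L (a \<otimes> (y \<ominus> e y)) \<oplus>\<^bsub>S\<^esub> F y = L (a \<otimes> y)"
      proof -
        have "a \<otimes> (y \<ominus> e y) \<oplus> a \<otimes> e y = a \<otimes> y" using a(1) e(1)[OF y] y by algebra
        then show ?thesis using linD(2)[OF L, of "a \<otimes> (y \<ominus> e y)" "a \<otimes> e y"] a(1) e(1)[OF y] y by (simp add: F_def)
      qed
      ultimately show ?thesis using rep[OF y] a(1) a' y e(1)[OF y] linD(1)[OF L] linD(1)[OF F y]
        by (metis R.add.right_cancel S.m_closed S.minus_closed)
    qed
    ultimately show "L ((a \<ominus> a') \<otimes> y) \<in> J" by simp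
  qed (use a a' in simp)
  ultimately show ?thesis by blast
qed

end

section \<open>From a one-dimensional socle to a nondegenerate form\<close>

section \<open>Socles and nondegeneracy\<close>

context cring
begin

lemma ideal_unit_cancel:
  assumes "ideal J R" "w \<in> Units R" "a \<in> carrier R" "a \<otimes> w \<in> J"
  shows "a \<in> J"
proof -
  have "(a \<otimes> w) \<otimes> inv w \<in> J" by (rule ideal.I_r_closed[OF assms(1,4)]) (use assms(2) in simp)
  also have "(a \<otimes> w) \<otimes> inv w = a"
    using assms(3) Units_closed[OF assms(2)] Units_inv_closed[OF assms(2)] Units_r_inv[OF assms(2)]
    by (simp add: m_assoc)
  finally show ?thesis .
qed

text \<open>The \<open>u i\<close> are treated one at a time: multiply by the last power of
  \<open>u N\<close> that does not push the element into \<open>J\<close>. The earlier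
  \<open>u i\<close> keep killing the result.\<close>

lemma socle_multiple:
  fixes N :: nat
  assumes J: "ideal J R" and u: "\<And>i. u i \<in> carrier R"
    and nil: "\<And>i. i < N \<Longrightarrow> \<exists>e::nat. u i [^] e \<in> J"
    and a: "a \<in> carrier R" "a \<notin> J"
  shows "\<exists>r\<in>carrier R. r \<otimes> a \<notin> J \<and> (\<forall>i<N. u i \<otimes> (r \<otimes> a) \<in> J)"
  using nil
proof (induction N)
  case 0
  then show ?case using a by (intro bexI[of _ \<one>]) auto
next
  case (Suc N)
  then obtain r where r: "r \<in> carrier R" "r \<otimes> a \<notin> J" "\<And>i. i < N \<Longrightarrow> u i \<otimes> (r \<otimes> a) \<in> J" by auto
  obtain e :: nat where "u N [^] e \<in> J" using Suc.prems by blast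
  then have ex: "u N [^] e \<otimes> (r \<otimes> a) \<in> J" using r a by (intro ideal.I_r_closed[OF J]) auto
  define k :: nat where "k = (LEAST e. u N [^] e \<otimes> (r \<otimes> a) \<in> J)"
  have k: "u N [^] k \<otimes> (r \<otimes> a) \<in> J" unfolding k_def using LeastI[of "\<lambda>e::nat. u N [^] e \<otimes> (r \<otimes> a) \<in> J", OF ex] .
  have "k \<noteq> 0"
  proof
    assume "k = 0" then show False using k r a by simp
  qed
  then obtain l where l: "k = Suc l" by (cases k) auto
  have nl: "u N [^] l \<otimes> (r \<otimes> a) \<notin> J"
    using not_less_Least[of l "\<lambda>e::nat. u N [^] e \<otimes> (r \<otimes> a) \<in> J"] l by (simp add: k_def)
  have eq: "u i \<otimes> ((u N [^] l \<otimes> r) \<otimes> a) = u N [^] l \<otimes> (u i \<otimes> (r \<otimes> a))" for i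
    using r(1) a u[of i] u[of N] by (simp add: m_ac)
  have "u i \<otimes> ((u N [^] l \<otimes> r) \<otimes> a) \<in> J" if "i < Suc N" for i
  proof (cases "i = N")
    case True
    have "u N [^] l \<otimes> (u N \<otimes> (r \<otimes> a)) = u N [^] k \<otimes> (r \<otimes> a)"
      using r(1) a u[of N] l by (simp add: m_assoc)
    then show ?thesis using k True eq[of N] by simp
  next
    case False
    then show ?thesis using r(3)[of i] that u[of N] ideal_mult[OF J] by (simp add: eq)
  qed
  moreover have "(u N [^] l \<otimes> r) \<otimes> a \<notin> J" using nl r(1) a u[of N] by (simp add: m_assoc)
  ultimately show ?case using r(1) u[of N] by (intro bexI[of _ "u N [^] l \<otimes> r"]) auto
qed

text \<open>Matches the shape of \<open>generating_family\<close>: coefficients are indexed by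
  positions, so the \<open>w i\<close> may repeat.\<close>

lemma Idl_family:
  "(\<And>i. i < n \<Longrightarrow> w i \<in> carrier R) \<Longrightarrow>
    z \<in> Idl (w ` {..<n}) \<longleftrightarrow> (\<exists>c\<in>{..<n} \<rightarrow> carrier R. z = (\<Oplus>i\<in>{..<n::nat}. c i \<otimes> w i))"
proof (induction n arbitrary: z)
  case 0 then show ?case by (auto simp: Idl_empty)
next
  case (Suc n)
  have w: "i \<in> {..<n} \<Longrightarrow> w i \<in> carrier R" "w n \<in> carrier R" for i using Suc.prems by auto
  have sum: "(\<Oplus>i\<in>{..<Suc n}. c i \<otimes> w i) = (\<Oplus>i\<in>{..<n}. c i \<otimes> w i) \<oplus> c n \<otimes> w n"
    if "c \<in> {..<Suc n} \<rightarrow> carrier R" for c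
  proof -
    have "(\<lambda>i. c i \<otimes> w i) \<in> {..<n} \<rightarrow> carrier R" "c n \<in> carrier R" using that w by (auto simp: Pi_iff)
    then show ?thesis unfolding lessThan_Suc using w
      by (subst finsum_insert) (auto simp: a_comm finsum_closed)
  qed
  have "z \<in> Idl (w ` {..<Suc n}) \<longleftrightarrow> (\<exists>j\<in>Idl (w ` {..<n}). \<exists>r\<in>carrier R. z = j \<oplus> r \<otimes> w n)"
    unfolding lessThan_Suc image_insert using w by (intro Idl_insert) auto
  also have "\<dots> \<longleftrightarrow> (\<exists>c\<in>{..<Suc n} \<rightarrow> carrier R. z = (\<Oplus>i\<in>{..<Suc n}. c i \<otimes> w i))"
  proof
    assume "\<exists>j\<in>Idl (w ` {..<n}). \<exists>r\<in>carrier R. z = j \<oplus> r \<otimes> w n"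
    then obtain j r where jr: "j \<in> Idl (w ` {..<n})" "r \<in> carrier R" "z = j \<oplus> r \<otimes> w n" by blast
    then obtain c where c: "c \<in> {..<n} \<rightarrow> carrier R" "j = (\<Oplus>i\<in>{..<n}. c i \<otimes> w i)"
      using Suc.IH[of j] w by auto
    have cu: "c(n := r) \<in> {..<Suc n} \<rightarrow> carrier R" using c(1) jr(2) by (auto simp: Pi_iff less_Suc_eq)
    have "(\<Oplus>i\<in>{..<n}. (c(n := r)) i \<otimes> w i) = j"
      unfolding c(2) using c(1) w by (intro finsum_cong') (auto simp: Pi_iff)
    then have "z = (\<Oplus>i\<in>{..<Suc n}. (c(n := r)) i \<otimes> w i)" using sum[OF cu] jr(3) by simp
    then show "\<exists>c\<in>{..<Suc n} \<rightarrow> carrier R. z = (\<Oplus>i\<in>{..<Suc n}. c i \<otimes> w i)" using cu by blast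
  next
    assume "\<exists>c\<in>{..<Suc n} \<rightarrow> carrier R. z = (\<Oplus>i\<in>{..<Suc n}. c i \<otimes> w i)"
    then obtain c where c: "c \<in> {..<Suc n} \<rightarrow> carrier R" "z = (\<Oplus>i\<in>{..<Suc n}. c i \<otimes> w i)" by blast
    then have "(\<Oplus>i\<in>{..<n}. c i \<otimes> w i) \<in> Idl (w ` {..<n})"
      using Suc.IH w by (auto intro!: bexI[of _ c])
    then show "\<exists>j\<in>Idl (w ` {..<n}). \<exists>r\<in>carrier R. z = j \<oplus> r \<otimes> w n"
      using c sum[OF c(1)] by auto
  qed
  finally show ?case .
qed

end

context free_algebra
begin

lemma hom_Units: "s \<in> Units S \<Longrightarrow> h s \<in> Units A"
proof -
  assume "s \<in> Units S"
  then obtain r where r: "r \<in> carrier S" "s \<in> carrier S" "r \<otimes>\<^bsub>S\<^esub> s = \<one>\<^bsub>S\<^esub>" "s \<otimes>\<^bsub>S\<^esub> r = \<one>\<^bsub>S\<^esub>"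
    by (auto simp: Units_def)
  have "h r \<otimes> h s = \<one>" "h s \<otimes> h r = \<one>"
    using r by (simp_all flip: hom_mult)
  then show "h s \<in> Units A" using r by (auto simp: Units_def)
qed

text \<open>The powers of \<open>u\<close> up to the rank of \<open>A\<close> are dependent modulo the maximal ideal of \<open>S\<close>, and a
  relation whose first coefficient is a unit is a unit times a power of \<open>u\<close>.\<close>

lemma nilpotent_mod_extend:
  assumes m: "ideal (carrier S - Units S) S" (is "ideal ?m S")
    and mA: "ideal (carrier A - Units A) A"
    and u: "u \<in> carrier A - Units A"
  shows "\<exists>e::nat. u [^] e \<in> extend (carrier S - Units S)"
proof -
  have uA [simp]: "u \<in> carrier A" using u by simp
  note V = extend_ideal[OF m]
  \<comment> \<open>The exponent \<open>q\<close> collects the powers of \<open>u\<close> already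
    split off. If the constant coefficient is a unit, so is the whole sum, because \<open>u\<close>
    is a nonunit; otherwise its term lies in the extended ideal and another factor \<open>u\<close>
    comes out.\<close>
  have key: "\<exists>e::nat. u [^] e \<in> extend ?m"
    if "\<And>i. i \<le> k \<Longrightarrow> c i \<in> carrier S" "u [^] q \<otimes> (\<Oplus>i\<in>{..k}. h (c i) \<otimes> u [^] i) \<in> extend ?m"
      "\<exists>i\<le>k. c i \<in> Units S" for k q :: nat and c
    using that
  proof (induction k arbitrary: c q)
    case 0
    then have "u [^] q \<otimes> h (c 0) \<in> extend ?m" "c 0 \<in> Units S" by auto
    then show ?case using S.ideal_unit_cancel[OF V hom_Units] by (intro exI[of _ q]) auto
  next
    case (Suc k)
    define T where "T = (\<Oplus>i\<in>{..k}. h (c (Suc i)) \<otimes> u [^] i)"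
    have cc: "c i \<in> carrier S" if "i \<le> Suc k" for i using Suc.prems(1) that .
    have T: "T \<in> carrier A" unfolding T_def using cc by (intro S.finsum_closed) auto
    have c0: "h (c 0) \<in> carrier A" using cc by simp
    have "(\<Oplus>i\<in>{..Suc k}. h (c i) \<otimes> u [^] i)
        = (\<Oplus>i\<in>{..k}. h (c (Suc i)) \<otimes> u [^] Suc i) \<oplus> h (c 0) \<otimes> u [^] (0::nat)"
      using cc by (subst S.finsum_Suc2) auto
    also have "(\<Oplus>i\<in>{..k}. h (c (Suc i)) \<otimes> u [^] Suc i) = T \<otimes> u"
    proof -
      have "T \<otimes> u = (\<Oplus>i\<in>{..k}. h (c (Suc i)) \<otimes> u [^] i \<otimes> u)"
        unfolding T_def using cc by (intro S.finsum_ldistr) auto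
      also have "\<dots> = (\<Oplus>i\<in>{..k}. h (c (Suc i)) \<otimes> u [^] Suc i)"
        using cc by (intro S.finsum_cong') (auto simp: S.m_assoc)
      finally show ?thesis by simp
    qed
    finally have sum: "(\<Oplus>i\<in>{..Suc k}. h (c i) \<otimes> u [^] i) = T \<otimes> u \<oplus> h (c 0)"
      using c0 by simp
    define U where "U = u [^] q"
    have U: "U \<in> carrier A" by (simp add: U_def)
    have inV: "U \<otimes> (T \<otimes> u \<oplus> h (c 0)) \<in> extend ?m"
      using Suc.prems(2) unfolding sum U_def .
    show ?case
    proof (cases "c 0 \<in> Units S")
      case True
      have "T \<otimes> u \<oplus> h (c 0) \<in> Units A"
      proof (rule ccontr)
        assume "\<not> ?thesis"
        then have "(T \<otimes> u \<oplus> h (c 0)) \<ominus> T \<otimes> u \<in> carrier A - Units A"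
          using T c0 u by (intro S.ideal_diff[OF mA] S.ideal_mult[OF mA]) auto
        moreover have "(T \<otimes> u \<oplus> h (c 0)) \<ominus> T \<otimes> u = h (c 0)" using T c0 uA by algebra
        ultimately show False using hom_Units[OF True] by simp
      qed
      from S.ideal_unit_cancel[OF V this U inV] show ?thesis unfolding U_def by blast
    next
      case False
      then have "h (c 0) \<otimes> U \<in> extend ?m" using cc[of 0] U by (intro hom_extend[OF m]) auto
      from S.ideal_diff[OF V inV this]
      have "U \<otimes> (T \<otimes> u \<oplus> h (c 0)) \<ominus> h (c 0) \<otimes> U \<in> extend ?m" .
      also have "U \<otimes> (T \<otimes> u \<oplus> h (c 0)) \<ominus> h (c 0) \<otimes> U = (U \<otimes> u) \<otimes> T"
        using U T c0 uA by algebra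
      finally have "u [^] Suc q \<otimes> (\<Oplus>i\<in>{..k}. h (c (Suc i)) \<otimes> u [^] i) \<in> extend ?m"
        by (simp add: T_def U_def)
      moreover have "\<exists>i\<le>k. c (Suc i) \<in> Units S"
      proof -
        obtain i where i: "i \<le> Suc k" "c i \<in> Units S" using Suc.prems(3) by blast
        then have "i \<noteq> 0" using False by metis
        then show ?thesis using i by (intro exI[of _ "i - 1"]) auto
      qed
      ultimately show ?thesis using Suc.IH[of "\<lambda>i. c (Suc i)" "Suc q"] cc by auto
    qed
  qed
  let ?N = "card B"
  have "\<exists>c\<in>insert ?N {..<?N} \<rightarrow> carrier S. (\<exists>i\<in>insert ?N {..<?N}. c i \<in> Units S) \<and>
     (\<forall>b\<in>B. (\<Oplus>\<^bsub>S\<^esub>i\<in>insert ?N {..<?N}. c i \<otimes>\<^bsub>S\<^esub> coord (u [^] i) b) \<in> ?m)"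
    by (rule R.dependent_of_card_less[OF m]) (auto simp: B_finite)
  moreover have "insert ?N {..<?N} = {..?N}" by auto
  ultimately obtain c where c: "\<And>i. i \<le> ?N \<Longrightarrow> c i \<in> carrier S" "\<exists>i\<le>?N. c i \<in> Units S"
    "\<And>b. b \<in> B \<Longrightarrow> (\<Oplus>\<^bsub>S\<^esub>i\<in>{..?N}. c i \<otimes>\<^bsub>S\<^esub> coord (u [^] i) b) \<in> ?m"
    by (auto simp: Pi_iff)
  let ?y = "\<Oplus>i\<in>{..?N}. h (c i) \<otimes> u [^] i"
  have y: "?y \<in> carrier A" using c(1) by (intro S.finsum_closed) auto
  have "coord ?y b \<in> ?m" if b: "b \<in> B" for b
  proof -
    have "coord ?y b = (\<Oplus>\<^bsub>S\<^esub>i\<in>{..?N}. coord (h (c i) \<otimes> u [^] i) b)"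
      using c(1) by (intro lin_finsum[OF coord_lin[OF b]]) auto
    also have "\<dots> = (\<Oplus>\<^bsub>S\<^esub>i\<in>{..?N}. c i \<otimes>\<^bsub>S\<^esub> coord (u [^] i) b)"
      using c(1) b linD(3)[OF coord_lin[OF b]] by (intro R.finsum_cong') auto
    finally show ?thesis using c(3)[OF b] by simp
  qed
  then have "?y \<in> extend ?m" using y by (simp add: extend_def)
  then show ?thesis using key[of ?N c 0] c y by simp
qed

text \<open>Every nonzero multiple that reaches the socle recovers a fixed socle element up to a
  factor, so a functional only has to be a unit on that element. The hypothesis \<open>socle\<close>
  states one-dimensionality with units of \<open>A\<close> in place of nonzero scalars.\<close>

lemma nondegenerate_functional:
  fixes N :: nat
  assumes m: "ideal (carrier S - Units S) S" (is "ideal ?m S")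
    and u: "\<And>i. u i \<in> carrier A" "carrier A - Units A = Idl (u ` {..<N})"
    and proper: "\<one> \<notin> extend (carrier S - Units S)"
    and socle: "\<And>a b. a \<in> carrier A \<Longrightarrow> b \<in> carrier A \<Longrightarrow>
      (\<And>i. i < N \<Longrightarrow> u i \<otimes> a \<in> extend (carrier S - Units S)) \<Longrightarrow>
      (\<And>i. i < N \<Longrightarrow> u i \<otimes> b \<in> extend (carrier S - Units S)) \<Longrightarrow>
      \<exists>c\<in>carrier A. \<exists>d\<in>carrier A. (c \<in> Units A \<or> d \<in> Units A) \<and> c \<otimes> a \<oplus> d \<otimes> b \<in> extend (carrier S - Units S)"
  obtains L where "lin L"
    "\<And>a. a \<in> carrier A \<Longrightarrow> a \<notin> extend (carrier S - Units S) \<Longrightarrow> \<exists>x\<in>carrier A. L (a \<otimes> x) \<in> Units S"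
proof -
  let ?V = "extend ?m"
  note V = extend_ideal[OF m]
  have uc: "u ` {..<N} \<subseteq> carrier A" using u(1) by blast
  have mA: "ideal (carrier A - Units A) A" unfolding u(2) by (rule S.genideal_ideal[OF uc])
  have nil: "\<exists>e::nat. u i [^] e \<in> ?V" if "i < N" for i
  proof -
    have "u i \<in> carrier A - Units A" unfolding u(2) using that by (intro S.Idl_memI[OF uc]) auto
    then show ?thesis by (rule nilpotent_mod_extend[OF m mA])
  qed
  have kill: "c \<otimes> x \<in> ?V" if x: "x \<in> carrier A" "\<And>i. i < N \<Longrightarrow> u i \<otimes> x \<in> ?V" and c: "c \<in> carrier A - Units A" for x c
  proof -
    let ?K = "{r \<in> carrier A. r \<otimes> x \<in> ?V}"
    have "ideal ?K A" by (rule S.colon_ideal[OF V x(1)])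
    then have "Idl (u ` {..<N}) \<subseteq> ?K" using x u(1) by (intro S.genideal_minimal) auto
    then show ?thesis using c unfolding u(2) by blast
  qed
  obtain \<sigma> where s: "\<sigma> \<in> carrier A" "\<sigma> \<notin> ?V" "\<And>i. i < N \<Longrightarrow> u i \<otimes> \<sigma> \<in> ?V"
    using S.socle_multiple[of ?V u N "\<one>", OF V u(1) nil S.one_closed proper] by auto
  \<comment> \<open>A coordinate that detects the socle element already serves as the
    functional.\<close>
  then obtain b0 where b0: "b0 \<in> B" "coord \<sigma> b0 \<notin> ?m" by (auto simp: extend_def)
  define L where "L = (\<lambda>x. coord x b0)"
  have L: "lin L" unfolding L_def by (rule coord_lin[OF b0(1)])
  have "\<exists>x\<in>carrier A. L (a \<otimes> x) \<in> Units S" if a: "a \<in> carrier A" "a \<notin> ?V" for a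
  proof -
    obtain r where r: "r \<in> carrier A" "r \<otimes> a \<notin> ?V" "\<And>i. i < N \<Longrightarrow> u i \<otimes> (r \<otimes> a) \<in> ?V"
      using S.socle_multiple[of ?V u N a, OF V u(1) nil a] by blast
    define \<tau> where "\<tau> = r \<otimes> a"
    have t: "\<tau> \<in> carrier A" "\<tau> \<notin> ?V" "\<And>i. i < N \<Longrightarrow> u i \<otimes> \<tau> \<in> ?V" using r a by (auto simp: \<tau>_def)
    obtain c d where cd: "c \<in> carrier A" "d \<in> carrier A" "c \<in> Units A \<or> d \<in> Units A"
      "c \<otimes> \<sigma> \<oplus> d \<otimes> \<tau> \<in> ?V"
      using socle[OF s(1) t(1) s(3) t(3)] by blast
    \<comment> \<open>Otherwise \<open>c\<close> would kill the first socle element, leaving a unit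
      multiple of the second one in the extended ideal.\<close>
    have "c \<in> Units A"
    proof (rule ccontr)
      assume c: "c \<notin> Units A"
      then have "c \<otimes> \<sigma> \<in> ?V" using kill[OF s(1,3)] cd(1) by blast
      from S.ideal_diff[OF V cd(4) this] have "(c \<otimes> \<sigma> \<oplus> d \<otimes> \<tau>) \<ominus> c \<otimes> \<sigma> \<in> ?V" .
      also have "(c \<otimes> \<sigma> \<oplus> d \<otimes> \<tau>) \<ominus> c \<otimes> \<sigma> = \<tau> \<otimes> d" using cd(1,2) s(1) t(1) by algebra
      finally show False using S.ideal_unit_cancel[OF V _ t(1)] t(2) c cd(3) by blast
    qed
    define c' where "c' = inv c"
    have c': "c' \<in> carrier A" "c \<otimes> c' = \<one>" using \<open>c \<in> Units A\<close> by (auto simp: c'_def)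
    \<comment> \<open>Chosen so that \<open>a\<close> times \<open>x\<close> differs from the fixed
      socle element only by \<open>v\<close>, an element of the extended ideal.\<close>
    define x where "x = r \<otimes> (\<ominus> (c' \<otimes> d))"
    have x: "x \<in> carrier A" using r(1) c'(1) cd(2) by (simp add: x_def)
    define v where "v = c' \<otimes> (c \<otimes> \<sigma> \<oplus> d \<otimes> \<tau>)"
    have v: "v \<in> ?V" "v \<in> carrier A" using S.ideal_mult[OF V cd(4) c'(1)] S.ideal_carr[OF V] by (auto simp: v_def)
    have ax: "a \<otimes> x \<in> carrier A" using a x by simp
    have "v = (c \<otimes> c') \<otimes> \<sigma> \<oplus> c' \<otimes> d \<otimes> \<tau>"
      unfolding v_def using c'(1) cd(1,2) s(1) t(1) by algebra
    also have "\<dots> = \<sigma> \<oplus> c' \<otimes> d \<otimes> \<tau>" unfolding c'(2) using s(1) by simp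
    finally have "a \<otimes> x \<oplus> v = a \<otimes> (r \<otimes> (\<ominus> (c' \<otimes> d))) \<oplus> (\<sigma> \<oplus> c' \<otimes> d \<otimes> (r \<otimes> a))"
      by (simp add: x_def \<tau>_def)
    also have "\<dots> = \<sigma>" using a(1) r(1) c'(1) cd(2) s(1) by algebra
    finally have "L \<sigma> = L (a \<otimes> x) \<oplus>\<^bsub>S\<^esub> L v" using linD(2)[OF L ax v(2)] by simp
    moreover have "L v \<in> ?m" by (rule lin_extend[OF m L v(1)])
    moreover have "L \<sigma> \<notin> ?m" using b0 by (simp add: L_def)
    ultimately have "L (a \<otimes> x) \<notin> ?m" using R.ideal_add[OF m] by metis
    then show ?thesis using linD(1)[OF L ax] x by blast
  qed
  then show ?thesis using that L by blast
qed

text \<open>On \<open>I\<close> the map sending \<open>x\<close> to \<open>x\<close> minus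
  \<open>e x\<close> is the identity. Applied to the basis expansion of \<open>z\<close>, it keeps
  the coordinates, which lie in \<open>J\<close>, and replaces each basis element by an element of
  \<open>I\<close>, which can then be written in the given generators.\<close>

lemma extend_absorb:
  fixes n :: nat
  assumes I: "ideal I A" "I = Idl (x ` {..<n})" "\<And>j. j < n \<Longrightarrow> x j \<in> carrier A"
    and e: "\<And>x. x \<in> carrier A \<Longrightarrow> e x \<in> carrier A"
      "\<And>x y. x \<in> carrier A \<Longrightarrow> y \<in> carrier A \<Longrightarrow> e (x \<oplus> y) = e x \<oplus> e y"
      "\<And>s x. s \<in> carrier S \<Longrightarrow> x \<in> carrier A \<Longrightarrow> e (h s \<otimes> x) = h s \<otimes> e x"
      "\<And>x. x \<in> I \<Longrightarrow> e x = \<zero>" "\<And>x. x \<in> carrier A \<Longrightarrow> x \<ominus> e x \<in> I"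
    and J: "ideal J S"
    and z: "z \<in> I" "z \<in> extend J"
  shows "\<exists>v\<in>{..<n} \<rightarrow> extend J. z = (\<Oplus>j\<in>{..<n}. v j \<otimes> x j)"
proof -
  note V = extend_ideal[OF J]
  have zA: "z \<in> carrier A" using z(2) by (simp add: extend_def)
  have e0: "e \<zero> = \<zero>" using e(4) S.ideal_zero[OF I(1)] by blast
  have esum: "(\<Oplus>i\<in>T. f i) \<ominus> e (\<Oplus>i\<in>T. f i) = (\<Oplus>i\<in>T. f i \<ominus> e (f i))"
    if "finite T" "\<And>i. i \<in> T \<Longrightarrow> f i \<in> carrier A" for f and T :: "'a set"
    using that
  proof (induction T)
    case (insert i T)
    define a b where ab: "a = f i" "b = (\<Oplus>i\<in>T. f i)"
    have ca: "a \<in> carrier A" "b \<in> carrier A" using insert.prems by (auto simp: ab intro!: S.finsum_closed)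
    have "(\<Oplus>i\<in>insert i T. f i) = a \<oplus> b" using insert by (auto simp: ab intro!: S.finsum_insert)
    moreover have "(\<Oplus>i\<in>insert i T. f i \<ominus> e (f i)) = (a \<ominus> e a) \<oplus> (b \<ominus> e b)"
      using insert e(1) by (subst S.finsum_insert) (auto simp: ab)
    moreover have "(a \<oplus> b) \<ominus> (e a \<oplus> e b) = (a \<ominus> e a) \<oplus> (b \<ominus> e b)"
      using ca e(1)[OF ca(1)] e(1)[OF ca(2)] by algebra
    ultimately show ?case using e(2)[OF ca] by simp
  qed (simp add: e0 S.minus_eq)
  have "\<exists>r\<in>{..<n} \<rightarrow> carrier A. b \<ominus> e b = (\<Oplus>j\<in>{..<n}. r j \<otimes> x j)" if "b \<in> B" for b
    using e(5)[of b] that S.Idl_family[of n x] I(3) unfolding I(2) by auto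
  then obtain r where r: "\<And>b. b \<in> B \<Longrightarrow> r b \<in> {..<n} \<rightarrow> carrier A"
    "\<And>b. b \<in> B \<Longrightarrow> b \<ominus> e b = (\<Oplus>j\<in>{..<n}. r b j \<otimes> x j)" by metis
  have rc: "b \<in> B \<Longrightarrow> j < n \<Longrightarrow> r b j \<in> carrier A" for b j using r(1) by blast
  define v where "v = (\<lambda>j. \<Oplus>b\<in>B. h (coord z b) \<otimes> r b j)"
  have vV: "v j \<in> extend J" if "j < n" for j
    unfolding v_def
    using z(2) that rc by (intro S.ideal_finsum[OF V] hom_extend[OF J]) (auto simp: extend_def)
  have "z = z \<ominus> e z" using e(4)[OF z(1)] zA by (simp add: S.minus_eq)
  also have "\<dots> = (\<Oplus>b\<in>B. h (coord z b) \<otimes> b) \<ominus> e (\<Oplus>b\<in>B. h (coord z b) \<otimes> b)"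
    using coord_props(2)[OF zA] by simp
  also have "\<dots> = (\<Oplus>b\<in>B. h (coord z b) \<otimes> b \<ominus> e (h (coord z b) \<otimes> b))"
    using zA by (intro esum[OF B_finite]) auto
  also have "\<dots> = (\<Oplus>b\<in>B. \<Oplus>j\<in>{..<n}. h (coord z b) \<otimes> r b j \<otimes> x j)"
  proof (rule S.finsum_cong')
    fix b assume b: "b \<in> B"
    define c where "c = h (coord z b)"
    have c: "c \<in> carrier A" using zA b by (simp add: c_def)
    have "c \<otimes> b \<ominus> e (c \<otimes> b) = c \<otimes> b \<ominus> c \<otimes> e b"
      using e(3)[of "coord z b" b] zA b by (simp add: c_def)
    also have "\<dots> = c \<otimes> (b \<ominus> e b)" using c B_carrier[OF b] e(1)[OF B_carrier[OF b]] by algebra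
    also have "\<dots> = (\<Oplus>j\<in>{..<n}. c \<otimes> (r b j \<otimes> x j))"
      unfolding r(2)[OF b] using c rc[OF b] I(3) by (intro S.finsum_rdistr) auto
    also have "\<dots> = (\<Oplus>j\<in>{..<n}. c \<otimes> r b j \<otimes> x j)"
      using c rc[OF b] I(3) by (intro S.finsum_cong') (auto simp: S.m_assoc)
    finally show "h (coord z b) \<otimes> b \<ominus> e (h (coord z b) \<otimes> b)
        = (\<Oplus>j\<in>{..<n}. h (coord z b) \<otimes> r b j \<otimes> x j)" by (simp add: c_def)
  qed (use zA rc I(3) in \<open>auto intro!: S.finsum_closed\<close>)
  also have "\<dots> = (\<Oplus>j\<in>{..<n}. \<Oplus>b\<in>B. h (coord z b) \<otimes> r b j \<otimes> x j)"
    using zA rc I(3) by (intro S.finsum_swap B_finite) auto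
  also have "\<dots> = (\<Oplus>j\<in>{..<n}. v j \<otimes> x j)"
  proof (rule S.finsum_cong')
    fix j assume "j \<in> {..<n}"
    then show "(\<Oplus>b\<in>B. h (coord z b) \<otimes> r b j \<otimes> x j) = v j \<otimes> x j"
      unfolding v_def using zA rc I(3) by (intro S.finsum_ldistr[symmetric] B_finite) auto
  qed (use vV I(3) in \<open>auto simp: extend_def\<close>)
  finally show ?thesis using vV by blast
qed

end

section \<open>Fitting ideals under surjections\<close>

section \<open>Fitting ideals\<close>

context cring
begin

lemma ideal_module_simps [simp]:
  "carrier (ideal_module R J) = J" "\<zero>\<^bsub>ideal_module R J\<^esub> = \<zero>"
  "x \<oplus>\<^bsub>ideal_module R J\<^esub> y = x \<oplus> y" "c \<odot>\<^bsub>ideal_module R J\<^esub> x = c \<otimes> x"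
  by (simp_all add: ideal_module_def)

lemma ideal_module_abelian_monoid:
  assumes J: "ideal J R"
  shows "abelian_monoid (ideal_module R J)"
  by (rule abelian_monoidI)
     (use ideal_carr[OF J] in \<open>auto simp: ideal_add[OF J] ideal_zero[OF J] a_assoc intro: a_comm\<close>)

lemma ideal_module_finsum:
  assumes J: "ideal J R" and "finite T" "\<And>i. i \<in> T \<Longrightarrow> f i \<in> J"
  shows "(\<Oplus>\<^bsub>ideal_module R J\<^esub>i\<in>T. f i) = (\<Oplus>i\<in>T. f i)"
  using assms(2,3)
proof (induction T)
  case empty
  interpret M: abelian_monoid "ideal_module R J" by (rule ideal_module_abelian_monoid[OF J])
  show ?case using M.finsum_empty[of f] by simp
next
  case (insert i T)
  interpret M: abelian_monoid "ideal_module R J" by (rule ideal_module_abelian_monoid[OF J])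
  have "f \<in> T \<rightarrow> carrier (ideal_module R J)" "f i \<in> carrier (ideal_module R J)" "f \<in> T \<rightarrow> carrier R" "f i \<in> carrier R"
    using insert.prems ideal_carr[OF J] by auto
  then show ?case using insert by (simp add: M.finsum_insert)
qed

lemma ideal_module_combination:
  fixes n :: nat
  assumes "ideal J R" "\<forall>i<n. x i \<in> J" "c \<in> {..<n} \<rightarrow> carrier R"
  shows "(\<Oplus>\<^bsub>ideal_module R J\<^esub>i\<in>{..<n}. c i \<odot>\<^bsub>ideal_module R J\<^esub> x i) = (\<Oplus>i\<in>{..<n}. c i \<otimes> x i)"
  unfolding ideal_module_simps
  by (rule ideal_module_finsum[OF assms(1)]) (use assms ideal_mult[OF assms(1)] in auto)

lemma generating_family_ideal_iff:
  assumes J: "ideal J R"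
  shows "generating_family R (ideal_module R J) n x \<longleftrightarrow> (\<forall>i<n. x i \<in> J) \<and> J = Idl (x ` {..<n})"
proof (cases "\<forall>i<n. x i \<in> J")
  case True
  then have xc: "i < n \<Longrightarrow> x i \<in> carrier R" for i using ideal_carr[OF J] by blast
  note sum = ideal_module_combination[OF J True]
  have "generating_family R (ideal_module R J) n x \<longleftrightarrow>
      (\<forall>m\<in>J. \<exists>c\<in>{..<n} \<rightarrow> carrier R. m = (\<Oplus>i\<in>{..<n}. c i \<otimes> x i))"
  proof -
    have e: "(\<exists>c. c \<in> {..<n} \<rightarrow> carrier R \<and>
          m = (\<Oplus>\<^bsub>ideal_module R J\<^esub>i\<in>{..<n}. c i \<odot>\<^bsub>ideal_module R J\<^esub> x i))
        \<longleftrightarrow> (\<exists>c\<in>{..<n} \<rightarrow> carrier R. m = (\<Oplus>i\<in>{..<n}. c i \<otimes> x i))" for m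
      unfolding Bex_def by (intro ex_cong1 conj_cong refl) (simp only: sum)
    show ?thesis unfolding generating_family_def e ideal_module_simps(1) using True by auto
  qed
  also have "\<dots> \<longleftrightarrow> J \<subseteq> Idl (x ` {..<n})" using Idl_family[OF xc, of n] by auto
  also have "\<dots> \<longleftrightarrow> J = Idl (x ` {..<n})"
    using genideal_minimal[OF J, of "x ` {..<n}"] True by auto
  finally show ?thesis using True by simp
next
  case False
  then show ?thesis by (auto simp: generating_family_def Pi_iff)
qed

text \<open>The data behind one generator of the Fitting ideal of \<open>J\<close>, with the module
  operations already replaced by those of the ring.\<close>

definition relation_matrix :: "'a set \<Rightarrow> nat \<Rightarrow> (nat \<Rightarrow> 'a) \<Rightarrow> (nat \<Rightarrow> nat \<Rightarrow> 'a) \<Rightarrow> bool" where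
  "relation_matrix J n x U \<longleftrightarrow> (\<forall>i<n. x i \<in> J) \<and> J = Idl (x ` {..<n}) \<and>
     (\<forall>i<n. (\<forall>j<n. U i j \<in> carrier R) \<and> (\<Oplus>j\<in>{..<n}. U i j \<otimes> x j) = \<zero>)"

lemma fitting_ideal_eq:
  assumes J: "ideal J R"
  shows "fitting_ideal R (ideal_module R J) = Idl {ring_det R n U | n x U. relation_matrix J n x U}"
proof -
  have "(generating_family R (ideal_module R J) n x \<and>
       (\<forall>i<n. U i \<in> {..<n} \<rightarrow> carrier R \<and>
          (\<Oplus>\<^bsub>ideal_module R J\<^esub>j\<in>{..<n}. U i j \<odot>\<^bsub>ideal_module R J\<^esub> x j) = \<zero>\<^bsub>ideal_module R J\<^esub>))
      \<longleftrightarrow> relation_matrix J n x U" for n x U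
  proof (cases "\<forall>i<n. x i \<in> J")
    case True
    note sum = ideal_module_combination[OF J True]
    show ?thesis
      unfolding relation_matrix_def generating_family_ideal_iff[OF J]
      using sum by (auto simp: Pi_iff simp del: ideal_module_simps(4))
  next
    case False
    then show ?thesis unfolding relation_matrix_def generating_family_ideal_iff[OF J] by blast
  qed
  then show ?thesis unfolding fitting_ideal_def by simp
qed

lemma ring_det_closed:
  assumes "\<And>i j. i < n \<Longrightarrow> j < n \<Longrightarrow> U i j \<in> carrier R"
  shows "ring_det R n U \<in> carrier R"
proof -
  have "(\<Otimes>i\<in>{..<n}. U i (\<sigma> i)) \<in> carrier R" if "\<sigma> permutes {..<n}" for \<sigma>
    using assms permutes_in_image[OF that] by (intro finprod_closed) auto
  then show ?thesis unfolding ring_det_def by (intro finsum_closed) auto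
qed

lemma ring_det_cong:
  assumes "\<And>i j. i < n \<Longrightarrow> j < n \<Longrightarrow> U i j \<in> carrier R" "\<And>i j. i < n \<Longrightarrow> j < n \<Longrightarrow> U i j = U' i j"
  shows "ring_det R n U = ring_det R n U'"
proof -
  have *: "(\<Otimes>i\<in>{..<n}. U i (\<sigma> i)) = (\<Otimes>i\<in>{..<n}. U' i (\<sigma> i))" "(\<Otimes>i\<in>{..<n}. U i (\<sigma> i)) \<in> carrier R"
    if "\<sigma> permutes {..<n}" for \<sigma>
  proof -
    have "\<sigma> i < n" if "i < n" for i using permutes_in_image[OF \<open>\<sigma> permutes {..<n}\<close>, of i] that by simp
    then show "(\<Otimes>i\<in>{..<n}. U i (\<sigma> i)) = (\<Otimes>i\<in>{..<n}. U' i (\<sigma> i))" "(\<Otimes>i\<in>{..<n}. U i (\<sigma> i)) \<in> carrier R"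
      using assms by (auto intro!: finprod_cong' finprod_closed)
  qed
  show ?thesis unfolding ring_det_def
  proof (rule finsum_cong')
    show "(\<lambda>\<sigma>. if evenperm \<sigma> then \<Otimes>i\<in>{..<n}. U' i (\<sigma> i) else \<ominus> (\<Otimes>i\<in>{..<n}. U' i (\<sigma> i)))
      \<in> {\<sigma>. \<sigma> permutes {..<n}} \<rightarrow> carrier R"
    proof
      fix \<sigma> assume "\<sigma> \<in> {\<sigma>. \<sigma> permutes {..<n}}"
      then have "(\<Otimes>i\<in>{..<n}. U' i (\<sigma> i)) \<in> carrier R" using *[of \<sigma>] by simp
      then show "(if evenperm \<sigma> then \<Otimes>i\<in>{..<n}. U' i (\<sigma> i) else \<ominus> (\<Otimes>i\<in>{..<n}. U' i (\<sigma> i))) \<in> carrier R" by simp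
    qed
  qed (use *(1) in auto)
qed

text \<open>The superfluous generators are removed one at a time.\<close>

lemma nakayama_family:
  fixes n :: nat
  assumes V: "ideal V R" "\<And>v. v \<in> V \<Longrightarrow> \<one> \<ominus> v \<in> Units R"
    and I: "ideal I R"
    and absorb: "\<And>n x z. (\<forall>i<n. x i \<in> I) \<Longrightarrow> I = Idl (x ` {..<n}) \<Longrightarrow> z \<in> I \<Longrightarrow> z \<in> V \<Longrightarrow>
      \<exists>v\<in>{..<n::nat} \<rightarrow> V. z = (\<Oplus>j\<in>{..<n}. v j \<otimes> x j)"
    and fg: "finite Y" "I = Idl Y" "Y \<subseteq> carrier R"
    and x: "\<And>i. i < n \<Longrightarrow> x i \<in> I" "\<And>z. z \<in> I \<Longrightarrow> \<exists>y\<in>Idl (x ` {..<n}). z \<ominus> y \<in> V"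
  shows "I = Idl (x ` {..<n})"
proof -
  obtain f and k :: nat where f: "Y = f ` {..<k}" using fg(1) by (metis finite_imp_nat_seg_image_inj_on lessThan_def)
  define w where "w = (\<lambda>j. if j < n then x j else f (j - n))"
  have Y: "y \<in> I" if "y \<in> Y" for y using fg that Idl_memI by blast
  have shrink: "I = Idl (w ` {..<n}) \<longleftrightarrow> True"
    if "I = Idl (w ` {..<n + m})" "\<And>j. j < n + m \<Longrightarrow> w j \<in> I" for m
    using that
  proof (induction m)
    case (Suc m)
    have wc: "j < n + Suc m \<Longrightarrow> w j \<in> carrier R" for j using Suc.prems(2) ideal_carr[OF I] by blast
    have sub: "w ` {..<n + m} \<subseteq> carrier R" using wc by auto
    let ?N = "Idl (w ` {..<n + m})"
    note N = genideal_ideal[OF sub]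
    have wI: "w (n + m) \<in> I" using Suc.prems(2) by simp
    note wmc = ideal_carr[OF I wI]
    obtain y where y: "y \<in> Idl (x ` {..<n})" "w (n + m) \<ominus> y \<in> V" using x(2)[OF wI] by blast
    have "x ` {..<n} \<subseteq> w ` {..<n + m}" by (auto simp: w_def image_iff intro!: bexI)
    then have yN: "y \<in> ?N" using y(1) sub by (meson subset_Idl_subset subsetD)
    have "y \<in> I" using y(1) x(1) genideal_minimal[OF I, of "x ` {..<n}"] by auto
    then have "w (n + m) \<ominus> y \<in> I" using ideal_diff[OF I wI] by blast
    from absorb[OF _ Suc.prems(1) this y(2)] Suc.prems(2)
    obtain v where v: "v \<in> {..<n + Suc m} \<rightarrow> V" "w (n + m) \<ominus> y = (\<Oplus>j\<in>{..<n + Suc m}. v j \<otimes> w j)" by blast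
    have vc: "j < n + Suc m \<Longrightarrow> v j \<in> carrier R" for j using v(1) ideal_carr[OF V(1)] by blast
    define s where "s = (\<Oplus>j\<in>{..<n + m}. v j \<otimes> w j)"
    have sN: "s \<in> ?N" unfolding s_def
      using vc by (intro ideal_finsum[OF N] ideal_mult[OF N] Idl_memI[OF sub]) auto
    have cs: "s \<in> carrier R" "y \<in> carrier R" using ideal_carr[OF N] sN yN by auto
    have vm: "v (n + m) \<in> V" "v (n + m) \<in> carrier R" using v(1) vc by auto
    have "w (n + m) \<ominus> y = v (n + m) \<otimes> w (n + m) \<oplus> s"
      unfolding v(2) s_def add_Suc_right lessThan_Suc
      using vc wc by (subst finsum_insert) auto
    then have "w (n + m) = v (n + m) \<otimes> w (n + m) \<oplus> s \<oplus> y"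
      using add_diff_cancel_right[OF wmc cs(2)] by simp
    \<comment> \<open>The last generator occurs on both sides. Its coefficient lies in
      \<open>V\<close>, so one minus it is a unit, and the generator lies in the ideal of the
      earlier ones.\<close>
    then have "w (n + m) \<otimes> (\<one> \<ominus> v (n + m)) = (v (n + m) \<otimes> w (n + m) \<oplus> s \<oplus> y) \<ominus> v (n + m) \<otimes> w (n + m)"
      using wmc vm(2) cs by (simp add: minus_eq r_distr r_minus m_comm)
    also have "\<dots> = s \<oplus> y" using wmc vm(2) cs by algebra
    also have "\<dots> \<in> ?N" using ideal_add[OF N sN yN] .
    finally have "w (n + m) \<in> ?N" using ideal_unit_cancel[OF N V(2)[OF vm(1)] wmc] by blast
    then have "w ` {..<n + Suc m} \<subseteq> ?N"
      using Idl_memI[OF sub] by (auto simp: less_Suc_eq)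
    then have "I \<subseteq> ?N" using Suc.prems(1) genideal_minimal[OF N] by blast
    moreover have "?N \<subseteq> I" by (rule genideal_minimal[OF I]) (use Suc.prems(2) in auto)
    ultimately have "I = ?N" by (rule equalityI)
    then show ?case by (rule Suc.IH) (use Suc.prems(2) in auto)
  qed simp
  have wI: "w j \<in> I" if "j < n + k" for j
    using that x(1) Y f by (auto simp: w_def)
  have "Y \<subseteq> w ` {..<n + k}"
  proof
    fix y assume "y \<in> Y"
    then obtain i where "i < k" "y = f i" using f by auto
    then show "y \<in> w ` {..<n + k}" by (intro image_eqI[of _ _ "n + i"]) (auto simp: w_def)
  qed
  moreover have wsub: "w ` {..<n + k} \<subseteq> carrier R" using wI ideal_carr[OF I] by blast
  ultimately have "I \<subseteq> Idl (w ` {..<n + k})" using fg(2) subset_Idl_subset[OF wsub] by blast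
  moreover have "Idl (w ` {..<n + k}) \<subseteq> I" by (rule genideal_minimal[OF I]) (use wI in auto)
  ultimately have "I = Idl (w ` {..<n + k})" by (rule equalityI)
  from shrink[OF this wI] have "I = Idl (w ` {..<n})" by simp
  moreover have "w ` {..<n} = x ` {..<n}" by (auto simp: w_def)
  ultimately show ?thesis by simp
qed

end

lemma (in ring) eq_add_self_zero:
  assumes "a \<in> carrier R" "b \<in> carrier R" "a = b \<oplus> a"
  shows "b = \<zero>"
proof -
  have "b = (b \<oplus> a) \<ominus> a" using assms(1,2) by algebra
  also have "\<dots> = a \<ominus> a" using assms(3) by simp
  finally show ?thesis using assms(1) by (simp add: minus_eq r_neg)
qed

locale surjective_hom = ring_hom_cring R Q q for R :: "('a, 'm) ring_scheme" (structure) and Q :: "('b, 'k) ring_scheme" and q +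
  assumes surj: "q ` carrier R = carrier Q"
begin

lemma image_ideal:
  assumes J: "ideal J R"
  shows "ideal (q ` J) Q"
proof (rule S.ideal_closureI)
  note Jc [simp] = R.ideal_carr[OF J]
  show "q ` J \<subseteq> carrier Q" by auto
  show "\<zero>\<^bsub>Q\<^esub> \<in> q ` J" using R.ideal_zero[OF J] by (intro image_eqI[of _ _ \<zero>]) auto
  show "a \<oplus>\<^bsub>Q\<^esub> b \<in> q ` J" if ab: "a \<in> q ` J" "b \<in> q ` J" for a b
  proof -
    obtain a' b' where "a' \<in> J" "a = q a'" "b' \<in> J" "b = q b'" using ab by blast
    then have "a \<oplus>\<^bsub>Q\<^esub> b = q (a' \<oplus> b')" "a' \<oplus> b' \<in> J" using R.ideal_add[OF J] by auto
    then show ?thesis by blast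
  qed
  show "y \<otimes>\<^bsub>Q\<^esub> a \<in> q ` J" if aJ: "a \<in> q ` J" and yQ: "y \<in> carrier Q" for a y
  proof -
    obtain a' y' where ay: "a' \<in> J" "a = q a'" "y' \<in> carrier R" "y = q y'" using aJ yQ surj by blast
    then have "y \<otimes>\<^bsub>Q\<^esub> a = q (y' \<otimes> a')" by auto
    then show ?thesis using R.ideal_mult[OF J ay(1,3)] by blast
  qed
qed

lemma image_Idl:
  assumes Y: "Y \<subseteq> carrier R"
  shows "q ` (Idl Y) = Idl\<^bsub>Q\<^esub> (q ` Y)"
proof
  have qY: "q ` Y \<subseteq> carrier Q" using Y by auto
  have "Idl Y \<subseteq> {r \<in> carrier R. q r \<in> Idl\<^bsub>Q\<^esub> (q ` Y)}"
    by (rule R.genideal_minimal[OF ring.ideal_vimage[OF S.genideal_ideal[OF qY]]])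
       (use Y S.Idl_memI[OF qY] in auto)
  then show "q ` (Idl Y) \<subseteq> Idl\<^bsub>Q\<^esub> (q ` Y)" by blast
  show "Idl\<^bsub>Q\<^esub> (q ` Y) \<subseteq> q ` (Idl Y)"
    by (rule S.genideal_minimal[OF image_ideal[OF R.genideal_ideal[OF Y]]])
       (use R.Idl_memI[OF Y] in blast)
qed

lemma hom_ring_det:
  assumes U: "\<And>i j. i < n \<Longrightarrow> j < n \<Longrightarrow> U i j \<in> carrier R"
  shows "q (ring_det R n U) = ring_det Q n (\<lambda>i j. q (U i j))"
proof -
  have *: "(\<Otimes>i\<in>{..<n}. U i (\<sigma> i)) \<in> carrier R"
      "q (\<Otimes>i\<in>{..<n}. U i (\<sigma> i)) = (\<Otimes>\<^bsub>Q\<^esub>i\<in>{..<n}. q (U i (\<sigma> i)))" if "\<sigma> permutes {..<n}" for \<sigma>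
  proof -
    have "\<sigma> i < n" if "i < n" for i using permutes_in_image[OF \<open>\<sigma> permutes {..<n}\<close>, of i] that by simp
    then have "(\<lambda>i. U i (\<sigma> i)) \<in> {..<n} \<rightarrow> carrier R" using U by auto
    then show "(\<Otimes>i\<in>{..<n}. U i (\<sigma> i)) \<in> carrier R"
      "q (\<Otimes>i\<in>{..<n}. U i (\<sigma> i)) = (\<Otimes>\<^bsub>Q\<^esub>i\<in>{..<n}. q (U i (\<sigma> i)))"
      using hom_finprod[of "\<lambda>i. U i (\<sigma> i)" "{..<n}"] by (auto simp: comp_def intro: R.finprod_closed)
  qed
  let ?f = "\<lambda>\<sigma>. if evenperm \<sigma> then \<Otimes>i\<in>{..<n}. U i (\<sigma> i) else \<ominus> (\<Otimes>i\<in>{..<n}. U i (\<sigma> i))"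
  have "q (ring_det R n U) = (\<Oplus>\<^bsub>Q\<^esub>\<sigma>\<in>{\<sigma>. \<sigma> permutes {..<n}}. q (?f \<sigma>))"
    unfolding ring_det_def using hom_finsum[of ?f "{\<sigma>. \<sigma> permutes {..<n}}"] * by (auto simp: comp_def)
  also have "\<dots> = ring_det Q n (\<lambda>i j. q (U i j))"
    unfolding ring_det_def
  proof (rule S.finsum_cong')
    show "(\<lambda>\<sigma>. if evenperm \<sigma> then \<Otimes>\<^bsub>Q\<^esub>i\<in>{..<n}. q (U i (\<sigma> i)) else \<ominus>\<^bsub>Q\<^esub> (\<Otimes>\<^bsub>Q\<^esub>i\<in>{..<n}. q (U i (\<sigma> i))))
      \<in> {\<sigma>. \<sigma> permutes {..<n}} \<rightarrow> carrier Q"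
    proof
      fix \<sigma> assume "\<sigma> \<in> {\<sigma>. \<sigma> permutes {..<n}}"
      then have "(\<Otimes>\<^bsub>Q\<^esub>i\<in>{..<n}. q (U i (\<sigma> i))) \<in> carrier Q" using *[of \<sigma>] by (metis hom_closed mem_Collect_eq)
      then show "(if evenperm \<sigma> then \<Otimes>\<^bsub>Q\<^esub>i\<in>{..<n}. q (U i (\<sigma> i)) else \<ominus>\<^bsub>Q\<^esub> (\<Otimes>\<^bsub>Q\<^esub>i\<in>{..<n}. q (U i (\<sigma> i)))) \<in> carrier Q"
        by simp
    qed
  qed (use * in auto)
  finally show ?thesis .
qed

text \<open>The generating sets of determinants are shown to correspond, so no comparison of
  presentations is needed. The hypothesis \<open>absorb\<close> says that \<open>I\<close> meets the
  kernel of \<open>q\<close> only in (ker q) I, with coefficients on any prescribed generating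
  family.\<close>

theorem fitting_ideal_image:
  assumes V: "\<And>v. v \<in> carrier R \<Longrightarrow> q v = \<zero>\<^bsub>Q\<^esub> \<Longrightarrow> \<one> \<ominus> v \<in> Units R"
    and I: "ideal I R" and fg: "finite Y" "I = Idl Y" "Y \<subseteq> carrier R"
    and absorb: "\<And>n x z. (\<forall>i<n. x i \<in> I) \<Longrightarrow> I = Idl (x ` {..<n}) \<Longrightarrow> z \<in> I \<Longrightarrow> q z = \<zero>\<^bsub>Q\<^esub> \<Longrightarrow>
      \<exists>v. (\<forall>j<n. v j \<in> carrier R \<and> q (v j) = \<zero>\<^bsub>Q\<^esub>) \<and> z = (\<Oplus>j\<in>{..<n::nat}. v j \<otimes> x j)"
  shows "fitting_ideal Q (ideal_module Q (q ` I)) = q ` fitting_ideal R (ideal_module R I)"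
proof -
  note qI = image_ideal[OF I]
  let ?V = "a_kernel R Q q"
  have Vmem: "v \<in> ?V \<longleftrightarrow> v \<in> carrier R \<and> q v = \<zero>\<^bsub>Q\<^esub>" for v
    unfolding a_kernel_def' by blast
  note [simp] = R.ideal_carr[OF I]
  note Vid = ring.kernel_is_ideal
  define D where "D = {ring_det R n U | n x U. R.relation_matrix I n x U}"
  define D' where "D' = {ring_det Q n U | n x U. S.relation_matrix (q ` I) n x U}"
  have Dc: "D \<subseteq> carrier R"
    using R.ring_det_closed by (auto simp: D_def R.relation_matrix_def)
  have "q ` D = D'"
  proof (intro equalityI subsetI)
    fix y assume "y \<in> q ` D"
    then obtain n x U where *: "y = q (ring_det R n U)" "R.relation_matrix I n x U" by (auto simp: D_def)
    have U: "\<And>i j. i < n \<Longrightarrow> j < n \<Longrightarrow> U i j \<in> carrier R" and x: "\<And>i. i < n \<Longrightarrow> x i \<in> I" "I = Idl (x ` {..<n})"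
      using *(2) by (auto simp: R.relation_matrix_def)
    have xs: "x ` {..<n} \<subseteq> carrier R" using x(1) by auto
    have "S.relation_matrix (q ` I) n (\<lambda>i. q (x i)) (\<lambda>i j. q (U i j))"
      unfolding S.relation_matrix_def
    proof (intro conjI allI impI)
      show "q ` I = Idl\<^bsub>Q\<^esub> ((\<lambda>i. q (x i)) ` {..<n})"
        using image_Idl[OF xs] x(2) by (simp add: image_image)
      fix i assume i: "i < n"
      have "(\<Oplus>\<^bsub>Q\<^esub>j\<in>{..<n}. q (U i j) \<otimes>\<^bsub>Q\<^esub> q (x j)) = (\<Oplus>\<^bsub>Q\<^esub>j\<in>{..<n}. q (U i j \<otimes> x j))"
        using U[OF i] x(1) by (intro S.finsum_cong') auto
      also have "\<dots> = q (\<Oplus>j\<in>{..<n}. U i j \<otimes> x j)"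
        using hom_finsum[of "\<lambda>j. U i j \<otimes> x j" "{..<n}"] U[OF i] x(1) by (auto simp: comp_def)
      also have "\<dots> = \<zero>\<^bsub>Q\<^esub>" using *(2) i by (simp add: R.relation_matrix_def)
      finally show "(\<Oplus>\<^bsub>Q\<^esub>j\<in>{..<n}. q (U i j) \<otimes>\<^bsub>Q\<^esub> q (x j)) = \<zero>\<^bsub>Q\<^esub>" .
    qed (use U x(1) in auto)
    moreover have "y = ring_det Q n (\<lambda>i j. q (U i j))" unfolding *(1) by (rule hom_ring_det) (rule U)
    ultimately show "y \<in> D'" unfolding D'_def by blast
  next
    fix y assume "y \<in> D'"
    then obtain n x' U' where *: "y = ring_det Q n U'" "S.relation_matrix (q ` I) n x' U'" by (auto simp: D'_def)
    have U': "\<And>i j. i < n \<Longrightarrow> j < n \<Longrightarrow> U' i j \<in> carrier Q"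
      and x': "\<And>i. i < n \<Longrightarrow> x' i \<in> q ` I" "q ` I = Idl\<^bsub>Q\<^esub> (x' ` {..<n})"
      using *(2) by (auto simp: S.relation_matrix_def)
    define x where "x = (\<lambda>i. SOME a. a \<in> I \<and> q a = x' i)"
    have x: "x i \<in> I" "q (x i) = x' i" if i: "i < n" for i
    proof -
      obtain a where "a \<in> I \<and> q a = x' i" using x'(1)[OF i] by (elim imageE) simp
      then have "x i \<in> I \<and> q (x i) = x' i" unfolding x_def by (rule someI)
      then show "x i \<in> I" "q (x i) = x' i" by simp_all
    qed
    have xs: "x ` {..<n} \<subseteq> carrier R" using x(1) by auto
    have qx: "q ` (x ` {..<n}) = x' ` {..<n}" using x(2) by (auto simp: image_image)
    \<comment> \<open>Arbitrary lifts generate \<open>I\<close> up to elements of the kernel, which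
      Nakayama's lemma removes.\<close>
    have gen: "I = Idl (x ` {..<n})"
    proof (rule R.nakayama_family[OF Vid _ I _ fg x(1)])
      show "\<one> \<ominus> v \<in> Units R" if "v \<in> ?V" for v using V that by (simp add: Vmem)
      show "\<exists>v\<in>{..<m} \<rightarrow> ?V. z = (\<Oplus>j\<in>{..<m}. v j \<otimes> w j)"
        if "\<forall>i<m. w i \<in> I" "I = Idl (w ` {..<m})" "z \<in> I" "z \<in> ?V" for m :: nat and w z
        using absorb[OF that(1-3)] that(4) by (auto simp: Vmem Pi_iff Bex_def)
      show "\<exists>y\<in>Idl (x ` {..<n}). z \<ominus> y \<in> ?V" if z: "z \<in> I" for z
      proof -
        have "q z \<in> q ` (Idl (x ` {..<n}))" unfolding image_Idl[OF xs] qx using x'(2) z by blast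
        then obtain y where y: "y \<in> Idl (x ` {..<n})" "q z = q y" by blast
        have "y \<in> carrier R" using R.Idl_subset_carrier[OF xs y(1)] .
        then have "q (z \<ominus> y) = \<zero>\<^bsub>Q\<^esub>" using y(2) z by (simp add: R.minus_eq S.r_neg)
        then have "z \<ominus> y \<in> ?V" using z \<open>y \<in> carrier R\<close> by (simp add: Vmem)
        then show ?thesis using y(1) by blast
      qed
    qed
    define U where "U = (\<lambda>i j. SOME a. a \<in> carrier R \<and> q a = U' i j)"
    have U: "U i j \<in> carrier R" "q (U i j) = U' i j" if ij: "i < n" "j < n" for i j
    proof -
      have "U' i j \<in> q ` carrier R" using U'[OF ij] by (simp only: surj)
      then obtain a where "a \<in> carrier R \<and> q a = U' i j" by (elim imageE) simp
      then have "U i j \<in> carrier R \<and> q (U i j) = U' i j" unfolding U_def by (rule someI)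
      then show "U i j \<in> carrier R" "q (U i j) = U' i j" by simp_all
    qed
    have "\<exists>v. (\<forall>j<n. v j \<in> carrier R \<and> q (v j) = \<zero>\<^bsub>Q\<^esub>) \<and>
        (\<Oplus>j\<in>{..<n}. U i j \<otimes> x j) = (\<Oplus>j\<in>{..<n}. v j \<otimes> x j)" if i: "i < n" for i
    proof (rule absorb)
      show "(\<Oplus>j\<in>{..<n}. U i j \<otimes> x j) \<in> I"
        using U(1)[OF i] x(1) by (intro R.ideal_finsum[OF I] R.ideal_mult[OF I]) auto
      have "q (\<Oplus>j\<in>{..<n}. U i j \<otimes> x j) = (\<Oplus>\<^bsub>Q\<^esub>j\<in>{..<n}. q (U i j \<otimes> x j))"
        using hom_finsum[of "\<lambda>j. U i j \<otimes> x j" "{..<n}"] U(1)[OF i] x(1) by (auto simp: comp_def)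
      also have "\<dots> = (\<Oplus>\<^bsub>Q\<^esub>j\<in>{..<n}. U' i j \<otimes>\<^bsub>Q\<^esub> x' j)"
        using U[OF i] x U'[OF i] x'(1) by (intro S.finsum_cong') (auto, metis R.ideal_carr[OF I] S.m_closed hom_closed)
      also have "\<dots> = \<zero>\<^bsub>Q\<^esub>" using *(2) i by (simp add: S.relation_matrix_def)
      finally show "q (\<Oplus>j\<in>{..<n}. U i j \<otimes> x j) = \<zero>\<^bsub>Q\<^esub>" .
    qed (use x gen in auto)
    then obtain v where v: "\<And>i j. i < n \<Longrightarrow> j < n \<Longrightarrow> v i j \<in> carrier R \<and> q (v i j) = \<zero>\<^bsub>Q\<^esub>"
      "\<And>i. i < n \<Longrightarrow> (\<Oplus>j\<in>{..<n}. U i j \<otimes> x j) = (\<Oplus>j\<in>{..<n}. v i j \<otimes> x j)"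
      by metis
    \<comment> \<open>A lifted relation has a value in \<open>I\<close> and in the kernel of
      \<open>q\<close>. \<open>absorb\<close> writes that value with coefficients \<open>v\<close>
      from the kernel; subtracting them makes the relation exact without changing any image in
      \<open>Q\<close>.\<close>
    define W where "W = (\<lambda>i j. U i j \<ominus> v i j)"
    have W: "W i j \<in> carrier R" "q (W i j) = U' i j" if "i < n" "j < n" for i j
      using U[OF that] v(1)[OF that] U'[OF that] by (auto simp: W_def R.minus_eq)
    have rel: "(\<Oplus>j\<in>{..<n}. W i j \<otimes> x j) = \<zero>" if i: "i < n" for i
    proof -
      have Wx: "(\<lambda>j. W i j \<otimes> x j) \<in> {..<n} \<rightarrow> carrier R" and vx: "(\<lambda>j. v i j \<otimes> x j) \<in> {..<n} \<rightarrow> carrier R"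
        using W(1)[OF i] v(1)[OF i] x(1) by auto
      have "(\<Oplus>j\<in>{..<n}. U i j \<otimes> x j) = (\<Oplus>j\<in>{..<n}. W i j \<otimes> x j \<oplus> v i j \<otimes> x j)"
      proof (rule R.finsum_cong')
        fix j assume "j \<in> {..<n}"
        then have c: "U i j \<in> carrier R" "v i j \<in> carrier R" "x j \<in> carrier R" using U(1) v(1) x(1) i by auto
        show "U i j \<otimes> x j = W i j \<otimes> x j \<oplus> v i j \<otimes> x j" unfolding W_def using c by algebra
      qed (use Wx vx in auto)
      also have "\<dots> = (\<Oplus>j\<in>{..<n}. W i j \<otimes> x j) \<oplus> (\<Oplus>j\<in>{..<n}. v i j \<otimes> x j)"
        using Wx vx by (rule R.finsum_addf)
      finally show ?thesis unfolding v(2)[OF i]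
        by (rule R.eq_add_self_zero[OF R.finsum_closed[OF vx] R.finsum_closed[OF Wx]])
    qed
    have "R.relation_matrix I n x W" using W(1) rel x(1) gen by (simp add: R.relation_matrix_def)
    moreover have "q (ring_det R n W) = ring_det Q n (\<lambda>i j. q (W i j))" by (rule hom_ring_det) (rule W(1))
    moreover have "\<dots> = y" unfolding *(1) by (rule S.ring_det_cong) (use W U' in auto)
    ultimately show "y \<in> q ` D" by (auto simp: D_def)
  qed
  then show ?thesis
    unfolding R.fitting_ideal_eq[OF I] S.fitting_ideal_eq[OF qI]
    using image_Idl[OF Dc] by (simp add: D_def D'_def)
qed

end

section \<open>The perfect pairing on a complete intersection\<close>

section \<open>Complete intersections\<close>

context surjective_hom
begin

text \<open>The correspondence between ideals of the quotient and ideals containing the kernel. It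
  turns membership questions in the power series ring into questions about extended ideals of
  \<open>A\<close>.\<close>

lemma Idl_union_kernel:
  assumes F: "F \<subseteq> carrier R" "a_kernel R Q q = Idl F" and Y: "Y \<subseteq> carrier R"
  shows "x \<in> Idl (F \<union> Y) \<longleftrightarrow> x \<in> carrier R \<and> q x \<in> Idl\<^bsub>Q\<^esub> (q ` Y)"
proof
  have FY: "F \<union> Y \<subseteq> carrier R" using F Y by blast
  note K = R.genideal_ideal[OF FY]
  have qY: "q ` Y \<subseteq> carrier Q" using Y by auto
  have ker: "a \<in> a_kernel R Q q \<longleftrightarrow> a \<in> carrier R \<and> q a = \<zero>\<^bsub>Q\<^esub>" for a
    unfolding a_kernel_def' by blast
  {
    assume x: "x \<in> Idl (F \<union> Y)"
    have "Idl (F \<union> Y) \<subseteq> {r \<in> carrier R. q r \<in> Idl\<^bsub>Q\<^esub> (q ` Y)}"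
    proof (rule R.genideal_minimal[OF ring.ideal_vimage[OF S.genideal_ideal[OF qY]]], rule subsetI)
      fix a assume "a \<in> F \<union> Y"
      then consider "a \<in> F" | "a \<in> Y" by blast
      then show "a \<in> {r \<in> carrier R. q r \<in> Idl\<^bsub>Q\<^esub> (q ` Y)}"
      proof cases
        case 1
        then have "a \<in> a_kernel R Q q" using R.Idl_memI[OF F(1)] F(2) by simp
        then show ?thesis using ker[of a] S.ideal_zero[OF S.genideal_ideal[OF qY]] by simp
      next
        case 2
        then show ?thesis using Y S.Idl_memI[OF qY] by auto
      qed
    qed
    then show "x \<in> carrier R \<and> q x \<in> Idl\<^bsub>Q\<^esub> (q ` Y)" using x by blast
  }
  assume x: "x \<in> carrier R \<and> q x \<in> Idl\<^bsub>Q\<^esub> (q ` Y)"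
  then obtain y where y: "y \<in> Idl Y" "q x = q y" unfolding image_Idl[OF Y, symmetric] by blast
  have yc: "y \<in> carrier R" using R.Idl_subset_carrier[OF Y y(1)] .
  have "q (x \<ominus> y) = \<zero>\<^bsub>Q\<^esub>" using x yc y(2) by (simp add: R.minus_eq S.r_neg)
  then have "x \<ominus> y \<in> a_kernel R Q q" using ker x yc by simp
  then have "x \<ominus> y \<in> Idl F" using F(2) by simp
  moreover have "Idl F \<subseteq> Idl (F \<union> Y)" "Idl Y \<subseteq> Idl (F \<union> Y)"
    using R.subset_Idl_subset[OF FY] by blast+
  ultimately have "(x \<ominus> y) \<oplus> y \<in> Idl (F \<union> Y)" using y(1) by (intro R.ideal_add[OF K]) auto
  then show "x \<in> Idl (F \<union> Y)" using R.add_diff_cancel_right[of x y] x yc by simp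
qed

end

lemma (in cring) unit_in_ideal:
  assumes "ideal J R" "u \<in> J" "u \<in> Units R"
  shows "J = carrier R"
proof -
  have "inv u \<otimes> u \<in> J" using assms by (intro ideal_mult) auto
  then have "\<one> \<in> J" using assms(3) by simp
  then show ?thesis by (rule ideal.one_imp_carrier[OF assms(1)])
qed

locale ci_algebra = free_algebra "power_series_ring \<O> d" A h B
  for \<O> :: "'o ring" and d and A :: "('a, 'k) ring_scheme" (structure) and h and B +
  fixes \<pi> :: 'o and \<alpha> :: "'o \<Rightarrow> 'a"
  assumes O_cring: "cring \<O>" and pi_closed: "\<pi> \<in> carrier \<O>"
    and pi_regular: "\<And>a. a \<in> carrier \<O> \<Longrightarrow> \<pi> \<otimes>\<^bsub>\<O>\<^esub> a = \<zero>\<^bsub>\<O>\<^esub> \<Longrightarrow> a = \<zero>\<^bsub>\<O>\<^esub>"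
    and pi_nonunits: "carrier \<O> - Units \<O> = PIdl\<^bsub>\<O>\<^esub> \<pi>"
    and nontrivial: "\<one> \<noteq> \<zero>"
    and ci: "complete_intersection \<O> A \<alpha>"
begin

lemma uniformizer_locale: "power_series_uniformizer \<O> \<pi>"
  using O_cring pi_closed pi_regular pi_nonunits
  by (simp add: power_series_uniformizer_def power_series_uniformizer_axioms_def power_series_def)

abbreviation "SS \<equiv> power_series_ring \<O> d"
abbreviation "mS \<equiv> carrier SS - Units SS"

sublocale SP: power_series_uniformizer \<O> d \<pi>
  by (rule uniformizer_locale)

lemma mS_Idl: "mS = Idl\<^bsub>SS\<^esub> (ps_param \<O> d \<pi> ` {..<Suc d})"
  by (rule SP.Idl_param[symmetric])

lemma param_subset: "ps_param \<O> d \<pi> ` T \<subseteq> carrier SS"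
  using SP.param_closed by blast

lemma mS_ideal: "ideal mS SS"
  unfolding mS_Idl by (rule R.genideal_ideal[OF param_subset])

text \<open>A basis element has coordinate one at itself, and the basis is nonempty because
  \<open>A\<close> is nonzero.\<close>

lemma one_notin_extend: "\<one> \<notin> extend mS"
proof
  assume "\<one> \<in> extend mS"
  then have all: "extend mS = carrier A" by (rule ideal.one_imp_carrier[OF extend_ideal[OF mS_ideal]])
  have "B = {}"
  proof (rule ccontr)
    assume "B \<noteq> {}"
    then obtain b where b: "b \<in> B" by blast
    then have "b \<in> extend mS" using all by simp
    then have "coord b b \<in> mS" using b by (simp add: extend_def)
    then show False using coord_basis[OF b b] by simp
  qed
  then show False using coord_props(2)[OF S.one_closed] nontrivial by simp
qed

text \<open>Locality of \<open>A\<close>, the last conclusion, comes from the same presentation: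
  \<open>A\<close> is a quotient of a local ring whose maximal ideal contains the kernel.\<close>

lemma exists_perfect_pairing:
  obtains L \<delta> where "lin L" "\<And>b. b \<in> B \<Longrightarrow> \<delta> b \<in> carrier A"
    "\<And>b b'. b \<in> B \<Longrightarrow> b' \<in> B \<Longrightarrow> L (b' \<otimes> \<delta> b) = (if b' = b then \<one>\<^bsub>SS\<^esub> else \<zero>\<^bsub>SS\<^esub>)"
    "ideal (carrier A - Units A) A"
proof -
  obtain n fs \<psi> where ci': "regular_sequence (power_series_ring \<O> n) fs"
    "algebra_hom \<O> (power_series_ring \<O> n) (ps_const \<O>) A \<alpha> \<psi>"
    "\<psi> ` carrier (power_series_ring \<O> n) = carrier A"
    "a_kernel (power_series_ring \<O> n) A \<psi> = Idl\<^bsub>power_series_ring \<O> n\<^esub> (set fs)"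
    using ci unfolding complete_intersection_def by blast
  interpret PP: power_series_uniformizer \<O> n \<pi> by (rule uniformizer_locale)
  let ?P = "power_series_ring \<O> n" and ?t = "ps_param \<O> n \<pi>" and ?y = "ps_param \<O> d \<pi>"
  interpret psi: surjective_hom ?P A \<psi>
    using ci'(2,3) PP.ps_cring S.cring_axioms
    by (intro surjective_hom.intro ring_hom_cring.intro ring_hom_cring_axioms.intro surjective_hom_axioms.intro)
       (auto simp: algebra_hom_def)
  \<comment> \<open>Lifts to \<open>?P\<close> of the images in \<open>A\<close> of the parameters
    of \<open>SS\<close>; index \<open>d\<close> belongs to the uniformizer.\<close>
  define g where "g = (\<lambda>i. SOME f. f \<in> carrier ?P \<and> \<psi> f = h (?y i))"
  have g: "g i \<in> carrier ?P" "\<psi> (g i) = h (?y i)" for i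
  proof -
    have "h (?y i) \<in> \<psi> ` carrier ?P" using SP.param_closed[of i] by (simp only: ci'(3)) simp
    then obtain f where "f \<in> carrier ?P \<and> \<psi> f = h (?y i)" by (elim imageE) simp
    then have "g i \<in> carrier ?P \<and> \<psi> (g i) = h (?y i)" unfolding g_def
      by (rule someI[where P = "\<lambda>f. f \<in> carrier ?P \<and> \<psi> f = h (?y i)"])
    then show "g i \<in> carrier ?P" "\<psi> (g i) = h (?y i)" by simp_all
  qed
  have fs: "set fs \<subseteq> carrier ?P" using ci'(1) by (simp add: regular_sequence_def)
  define J where "J = (\<lambda>i. Idl\<^bsub>SS\<^esub> (?y ` {..<i}))"
  have J: "ideal (J i) SS" for i unfolding J_def by (rule R.genideal_ideal[OF param_subset])
  \<comment> \<open>Since \<open>fs\<close> generates the kernel, ideals of \<open>?P\<close> that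
    contain \<open>fs\<close> are compared with extended ideals of \<open>A\<close>.\<close>
  have key: "x \<in> Idl\<^bsub>?P\<^esub> (set fs \<union> g ` {..<i}) \<longleftrightarrow> x \<in> carrier ?P \<and> \<psi> x \<in> extend (J i)" for x i
  proof -
    have e: "\<psi> ` g ` {..<i} = h ` ?y ` {..<i}" using g(2) by (simp add: image_image)
    have gi: "g ` {..<i} \<subseteq> carrier ?P" using g(1) by blast
    show ?thesis
      unfolding psi.Idl_union_kernel[OF fs ci'(4) gi] e J_def extend_Idl[OF param_subset] ..
  qed
  define zs where "zs = fs @ map g [0..<Suc d]"
  have set_zs: "set zs = set fs \<union> g ` {..<Suc d}"
    by (simp add: zs_def atLeast0LessThan del: upt_Suc)
  have zs_c: "set zs \<subseteq> carrier ?P" using fs g(1) by (auto simp: set_zs)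
  have mem_zs: "x \<in> Idl\<^bsub>?P\<^esub> (set zs) \<longleftrightarrow> x \<in> carrier ?P \<and> \<psi> x \<in> extend mS" for x
    unfolding set_zs key mS_Idl J_def ..
  have zs_proper: "Idl\<^bsub>?P\<^esub> (set zs) \<noteq> carrier ?P"
    using mem_zs[of "\<one>\<^bsub>?P\<^esub>"] one_notin_extend by auto
  have zs_reg: "regular_sequence ?P zs"
    unfolding regular_sequence_def
  proof (intro conjI allI impI ballI zs_c zs_proper)
    fix i a assume i: "i < length zs" and a: "a \<in> carrier ?P"
      and za: "zs ! i \<otimes>\<^bsub>?P\<^esub> a \<in> Idl\<^bsub>?P\<^esub> (set (take i zs))"
    show "a \<in> Idl\<^bsub>?P\<^esub> (set (take i zs))"
    proof (cases "i < length fs")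
      case True
      then show ?thesis using ci'(1) za a by (auto simp: zs_def regular_sequence_def nth_append)
    next
      case False
      define k where "k = i - length fs"
      have k: "k < Suc d" "i = length fs + k" using False i by (auto simp: k_def zs_def)
      have "set (take i zs) = set fs \<union> g ` {..<k}" "zs ! i = g k"
        using k by (auto simp: zs_def take_map nth_append simp del: upt_Suc)
      then have "g k \<otimes>\<^bsub>?P\<^esub> a \<in> Idl\<^bsub>?P\<^esub> (set fs \<union> g ` {..<k})" using za by simp
      then have e: "h (?y k) \<otimes> \<psi> a \<in> extend (J k)" using key g a by simp
      have "\<psi> a \<in> extend (J k)"
      proof -
        \<comment> \<open>Freeness of \<open>A\<close>: the parameter \<open>?y k\<close> acts on
          each coordinate separately, so its regularity on \<open>A\<close> is its regularity in
          \<open>SS\<close>.\<close>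
        have "coord (\<psi> a) b \<in> J k" if b: "b \<in> B" for b
        proof -
          have "coord (h (?y k) \<otimes> \<psi> a) b \<in> J k" using e b by (simp add: extend_def)
          then have "?y k \<otimes>\<^bsub>SS\<^esub> coord (\<psi> a) b \<in> J k"
            using linD(3)[OF coord_lin[OF b] SP.param_closed[of k], of "\<psi> a"] a by simp
          then show ?thesis using SP.param_regular[OF k(1), of "coord (\<psi> a) b"] a b by (simp add: J_def)
        qed
        then show ?thesis using a by (simp add: extend_def)
      qed
      then have "a \<in> Idl\<^bsub>?P\<^esub> (set fs \<union> g ` {..<k})" using key a by blast
      then show ?thesis using \<open>set (take i zs) = set fs \<union> g ` {..<k}\<close> by simp
    qed
  qed
  have M: "Idl\<^bsub>?P\<^esub> (?t ` {..<Suc n}) = carrier ?P - Units ?P" by (rule PP.Idl_param)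
  have tc: "?t ` {..<Suc n} \<subseteq> carrier ?P" using PP.param_closed by blast
  have Mid: "ideal (carrier ?P - Units ?P) ?P" unfolding M[symmetric] by (rule PP.P.genideal_ideal[OF tc])
  \<comment> \<open>A proper ideal contains no unit; \<open>socle_dependent\<close> asks for the
    sequence inside the maximal ideal in order to bound its length.\<close>
  have zs_M: "set zs \<subseteq> carrier ?P - Units ?P"
  proof
    fix z assume z: "z \<in> set zs"
    have "z \<notin> Units ?P"
    proof
      assume "z \<in> Units ?P"
      then have "Idl\<^bsub>?P\<^esub> (set zs) = carrier ?P"
        using PP.P.unit_in_ideal[OF PP.P.genideal_ideal[OF zs_c] PP.P.Idl_memI[OF zs_c z]] by blast
      then show False using zs_proper by simp
    qed
    then show "z \<in> carrier ?P - Units ?P" using z zs_c by blast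
  qed
  have kerM: "a_kernel ?P A \<psi> \<subseteq> carrier ?P - Units ?P"
    unfolding ci'(4) using zs_M by (intro PP.P.genideal_minimal[OF Mid]) (auto simp: set_zs)
  have ker: "a \<in> a_kernel ?P A \<psi> \<longleftrightarrow> a \<in> carrier ?P \<and> \<psi> a = \<zero>" for a
    unfolding a_kernel_def' by blast
  have psi_unit: "\<psi> f \<in> Units A" if fU: "f \<in> Units ?P" for f
  proof -
    obtain f' where f': "f' \<in> carrier ?P" "f \<in> carrier ?P" "f' \<otimes>\<^bsub>?P\<^esub> f = \<one>\<^bsub>?P\<^esub>"
      using fU by (auto simp: Units_def)
    then have "\<psi> f' \<otimes> \<psi> f = \<one>" by (simp flip: psi.hom_mult)
    then show ?thesis using f' S.m_comm[of "\<psi> f" "\<psi> f'"] by (auto simp: Units_def intro!: bexI[of _ "\<psi> f'"])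
  qed
  have psi_nonunit: "\<psi> f \<notin> Units A" if f: "f \<in> carrier ?P" "f \<notin> Units ?P" for f
  proof
    assume "\<psi> f \<in> Units A"
    then obtain y where "y \<in> carrier A" "y \<otimes> \<psi> f = \<one>" by (auto simp: Units_def)
    moreover have "y \<in> \<psi> ` carrier ?P" using \<open>y \<in> carrier A\<close> by (simp only: ci'(3))
    ultimately obtain f' where f': "f' \<in> carrier ?P" "\<psi> f' \<otimes> \<psi> f = \<one>" by (elim imageE) simp
    \<comment> \<open>If the image of a nonunit \<open>f\<close> were invertible, one would be the
      sum of a kernel element and a multiple of \<open>f\<close>, both nonunits.\<close>
    have "\<psi> (\<one>\<^bsub>?P\<^esub> \<ominus>\<^bsub>?P\<^esub> f' \<otimes>\<^bsub>?P\<^esub> f) = \<zero>" using f' f(1) by (simp add: PP.P.minus_eq S.r_neg)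
    then have "\<one>\<^bsub>?P\<^esub> \<ominus>\<^bsub>?P\<^esub> f' \<otimes>\<^bsub>?P\<^esub> f \<in> carrier ?P - Units ?P" using ker kerM f' f(1) by blast
    moreover have "f' \<otimes>\<^bsub>?P\<^esub> f \<in> carrier ?P - Units ?P" using f f' by (intro PP.P.ideal_mult[OF Mid]) auto
    ultimately have "(\<one>\<^bsub>?P\<^esub> \<ominus>\<^bsub>?P\<^esub> f' \<otimes>\<^bsub>?P\<^esub> f) \<oplus>\<^bsub>?P\<^esub> f' \<otimes>\<^bsub>?P\<^esub> f \<in> carrier ?P - Units ?P"
      by (rule PP.P.ideal_add[OF Mid])
    then show False using PP.P.add_diff_cancel_right[of "\<one>\<^bsub>?P\<^esub>" "f' \<otimes>\<^bsub>?P\<^esub> f"] f' f(1) by simp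
  qed
  define u where "u = (\<lambda>i. \<psi> (?t i))"
  have u: "u i \<in> carrier A" for i using PP.param_closed by (simp add: u_def)
  have mA: "carrier A - Units A = Idl (u ` {..<Suc n})"
  proof -
    have "Idl (u ` {..<Suc n}) = \<psi> ` (carrier ?P - Units ?P)"
      unfolding M[symmetric] psi.image_Idl[OF tc] by (simp add: u_def image_image)
    moreover have "carrier A - Units A \<subseteq> \<psi> ` (carrier ?P - Units ?P)"
    proof
      fix x assume x: "x \<in> carrier A - Units A"
      then have "x \<in> \<psi> ` carrier ?P" unfolding ci'(3) by simp
      then obtain f where "f \<in> carrier ?P" "x = \<psi> f" by blast
      then show "x \<in> \<psi> ` (carrier ?P - Units ?P)" using psi_unit[of f] x by auto
    qed
    moreover have "\<psi> ` (carrier ?P - Units ?P) \<subseteq> carrier A - Units A"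
      by (rule image_subsetI) (use psi_nonunit in auto)
    ultimately show ?thesis by simp
  qed
  have mA_ideal: "ideal (carrier A - Units A) A"
    unfolding mA using u by (intro S.genideal_ideal) blast
  have socle: "\<exists>c\<in>carrier A. \<exists>c'\<in>carrier A. (c \<in> Units A \<or> c' \<in> Units A) \<and> c \<otimes> a \<oplus> c' \<otimes> b \<in> extend mS"
    if a: "a \<in> carrier A" and b: "b \<in> carrier A"
      and ua: "\<And>i. i < Suc n \<Longrightarrow> u i \<otimes> a \<in> extend mS" and ub: "\<And>i. i < Suc n \<Longrightarrow> u i \<otimes> b \<in> extend mS" for a b
  proof -
    have "a \<in> \<psi> ` carrier ?P" "b \<in> \<psi> ` carrier ?P" using a b by (simp_all only: ci'(3))
    \<comment> \<open>The socle condition is pulled back to the power series ring, where the Koszul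
      argument lives; units are preserved on the way back to \<open>A\<close>.\<close>
    then obtain a' b' where ab: "a' \<in> carrier ?P" "a = \<psi> a'" "b' \<in> carrier ?P" "b = \<psi> b'" by blast
    have "?t i \<otimes>\<^bsub>?P\<^esub> a' \<in> Idl\<^bsub>?P\<^esub> (set zs)" "?t i \<otimes>\<^bsub>?P\<^esub> b' \<in> Idl\<^bsub>?P\<^esub> (set zs)" if "i < Suc n" for i
      using ua[OF that] ub[OF that] ab PP.param_closed[of i] by (auto simp: mem_zs u_def)
    then have "\<exists>c\<in>carrier ?P. \<exists>c'\<in>carrier ?P. \<not> (c \<in> Idl\<^bsub>?P\<^esub> (?t ` {..<Suc n}) \<and> c' \<in> Idl\<^bsub>?P\<^esub> (?t ` {..<Suc n})) \<and>
        c \<otimes>\<^bsub>?P\<^esub> a' \<oplus>\<^bsub>?P\<^esub> c' \<otimes>\<^bsub>?P\<^esub> b' \<in> Idl\<^bsub>?P\<^esub> (set zs)"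
      using ab zs_reg zs_M PP.param_regular by (intro PP.P.socle_dependent) (auto simp: M)
    then obtain c c' where c: "c \<in> carrier ?P" "c' \<in> carrier ?P" "c \<in> Units ?P \<or> c' \<in> Units ?P"
      "c \<otimes>\<^bsub>?P\<^esub> a' \<oplus>\<^bsub>?P\<^esub> c' \<otimes>\<^bsub>?P\<^esub> b' \<in> Idl\<^bsub>?P\<^esub> (set zs)" unfolding M by blast
    have "\<psi> c \<otimes> a \<oplus> \<psi> c' \<otimes> b \<in> extend mS" using c ab by (simp add: mem_zs)
    then show ?thesis using c psi_unit by blast
  qed
  obtain L where L: "lin L"
    "\<And>a. a \<in> carrier A \<Longrightarrow> a \<notin> extend mS \<Longrightarrow> \<exists>x\<in>carrier A. L (a \<otimes> x) \<in> Units SS"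
    using nondegenerate_functional[OF mS_ideal u mA one_notin_extend socle] by blast
  obtain \<delta> where "\<And>b. b \<in> B \<Longrightarrow> \<delta> b \<in> carrier A"
    "\<And>b b'. b \<in> B \<Longrightarrow> b' \<in> B \<Longrightarrow> L (b' \<otimes> \<delta> b) = (if b' = b then \<one>\<^bsub>SS\<^esub> else \<zero>\<^bsub>SS\<^esub>)"
    using perfect_pairing[OF mS_ideal L] by blast
  with L(1) mA_ideal that show ?thesis by blast
qed

end

section \<open>Passage to the quotient by the variables and descent of the invariant\<close>

section \<open>Reduction modulo the variables\<close>

text \<open>The image of the coset is a singleton, which is what \<open>the_elem\<close>
  needs.\<close>

lemma induced_map_coset:
  assumes "cring A" "ideal V A" "x \<in> carrier A" "\<And>v. v \<in> V \<Longrightarrow> f (v \<oplus>\<^bsub>A\<^esub> x) = f x"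
  shows "induced_map f (V +>\<^bsub>A\<^esub> x) = f x"
proof -
  interpret A: cring A by fact
  have "f ` (V +>\<^bsub>A\<^esub> x) = (\<lambda>v. f (v \<oplus>\<^bsub>A\<^esub> x)) ` V" by (auto simp: a_r_coset_def')
  also have "\<dots> = {f x}" using assms(4) A.ideal_zero[OF assms(2)] by force
  finally show ?thesis by (simp add: induced_map_def)
qed

context cring
begin

lemma coset_eq_iff:
  "ideal V R \<Longrightarrow> a \<in> carrier R \<Longrightarrow> b \<in> carrier R \<Longrightarrow> V +> a = V +> b \<longleftrightarrow> a \<ominus> b \<in> V"
  using quotient_eq_iff_same_a_r_cos by blast

lemma coset_eq_ideal_iff: "ideal V R \<Longrightarrow> a \<in> carrier R \<Longrightarrow> V +> a = V \<longleftrightarrow> a \<in> V"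
  using a_rcos_zero[of V a] ideal.rcos_const_imp_mem[of V R a] by metis

lemma quotient_carrier: "carrier (R Quot V) = (\<lambda>a. V +> a) ` carrier R"
  by (auto simp: FactRing_def A_RCOSETS_def')

lemma quotient_zero: "\<zero>\<^bsub>R Quot V\<^esub> = V"
  by (simp add: FactRing_def)

lemma quotient_surjective_hom:
  assumes V: "ideal V R"
  shows "surjective_hom R (R Quot V) (\<lambda>a. V +> a)"
  using ideal.quotient_is_cring[OF V cring_axioms] ideal.rcos_ring_hom[OF V] cring_axioms quotient_carrier[of V]
  by (intro surjective_hom.intro ring_hom_cring.intro ring_hom_cring_axioms.intro surjective_hom_axioms.intro) auto

end

lemma restrict_scalars_finsum: "finsum (restrict_scalars f A) = finsum A"
  by (intro ext) (simp add: finsum_def finprod_def restrict_scalars_def)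

lemma finite_free_map_free_algebra:
  assumes "cring \<O>" "cring A" "finite_free_map \<O> d A \<alpha> h"
  obtains B where "free_algebra (power_series_ring \<O> d) A h B"
proof -
  have "power_series \<O>" using assms(1) by (simp add: power_series_def)
  then have S: "cring (power_series_ring \<O> d)" by (rule power_series.ps_cring)
  have hom: "h \<in> ring_hom (power_series_ring \<O> d) A"
    using assms(3) by (simp add: finite_free_map_def algebra_hom_def)
  have ops: "carrier (restrict_scalars h A) = carrier A" "s \<odot>\<^bsub>restrict_scalars h A\<^esub> x = h s \<otimes>\<^bsub>A\<^esub> x" for s x
    by (simp_all add: restrict_scalars_def)
  obtain B where B: "finite B" "B \<subseteq> carrier A"
    "\<forall>x\<in>carrier A. \<exists>!c. c \<in> B \<rightarrow>\<^sub>E carrier (power_series_ring \<O> d) \<and> x = (\<Oplus>\<^bsub>A\<^esub>b\<in>B. h (c b) \<otimes>\<^bsub>A\<^esub> b)"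
    using assms(3) unfolding finite_free_map_def finite_free_def ops restrict_scalars_finsum by blast
  then have "free_algebra (power_series_ring \<O> d) A h B"
    using S assms(2) hom
    by (intro free_algebra.intro ring_hom_cring.intro ring_hom_cring_axioms.intro free_algebra_axioms.intro) auto
  then show ?thesis by (rule that)
qed

context ci_algebra
begin

text \<open>Freeness of \<open>R\<close> over the power series ring gives a linear section of the
  surjection: lift a basis arbitrarily and extend. Its composite with the surjection is linear over
  power series, though not over \<open>A\<close>.\<close>

lemma linear_projection:
  assumes "surjective_hom A R \<phi>" "free_algebra SS R \<theta> B'"
    and compat: "\<And>s. s \<in> carrier SS \<Longrightarrow> \<phi> (h s) = \<theta> s"
  obtains e where "\<And>x. x \<in> carrier A \<Longrightarrow> e x \<in> carrier A"
      "\<And>x y. x \<in> carrier A \<Longrightarrow> y \<in> carrier A \<Longrightarrow> e (x \<oplus> y) = e x \<oplus> e y"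
      "\<And>s x. s \<in> carrier SS \<Longrightarrow> x \<in> carrier A \<Longrightarrow> e (h s \<otimes> x) = h s \<otimes> e x"
      "\<And>x. x \<in> a_kernel A R \<phi> \<Longrightarrow> e x = \<zero>"
      "\<And>x. x \<in> carrier A \<Longrightarrow> x \<ominus> e x \<in> a_kernel A R \<phi>"
proof -
  interpret phi: surjective_hom A R \<phi> by fact
  interpret FR: free_algebra SS R \<theta> B' by fact
  define l where "l = (\<lambda>b. SOME x. x \<in> carrier A \<and> \<phi> x = b)"
  have l: "l b \<in> carrier A" "\<phi> (l b) = b" if b: "b \<in> B'" for b
  proof -
    have "b \<in> \<phi> ` carrier A" using FR.B_carrier[OF b] by (simp only: phi.surj)
    then obtain x where "x \<in> carrier A \<and> \<phi> x = b" by (elim imageE) simp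
    then have "l b \<in> carrier A \<and> \<phi> (l b) = b"
      unfolding l_def by (rule someI[where P = "\<lambda>x. x \<in> carrier A \<and> \<phi> x = b"])
    then show "l b \<in> carrier A" "\<phi> (l b) = b" by simp_all
  qed
  define s where "s = (\<lambda>r. \<Oplus>b\<in>B'. h (FR.coord r b) \<otimes> l b)"
  have s: "s r \<in> carrier A" if "r \<in> carrier R" for r
    using that l unfolding s_def by (intro S.finsum_closed) auto
  have s_add: "s (r \<oplus>\<^bsub>R\<^esub> r') = s r \<oplus> s r'" if r: "r \<in> carrier R" "r' \<in> carrier R" for r r'
  proof -
    have "s (r \<oplus>\<^bsub>R\<^esub> r') = (\<Oplus>b\<in>B'. h (FR.coord r b) \<otimes> l b \<oplus> h (FR.coord r' b) \<otimes> l b)"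
      unfolding s_def
    proof (rule S.finsum_cong')
      fix b assume b: "b \<in> B'"
      show "h (FR.coord (r \<oplus>\<^bsub>R\<^esub> r') b) \<otimes> l b = h (FR.coord r b) \<otimes> l b \<oplus> h (FR.coord r' b) \<otimes> l b"
        using FR.linD(2)[OF FR.coord_lin[OF b] r] l(1)[OF b] r b by (simp add: S.l_distr)
    qed (use r l in auto)
    also have "\<dots> = s r \<oplus> s r'" unfolding s_def using r l by (intro S.finsum_addf) auto
    finally show ?thesis .
  qed
  have s_smult: "s (\<theta> c \<otimes>\<^bsub>R\<^esub> r) = h c \<otimes> s r" if c: "c \<in> carrier SS" and r: "r \<in> carrier R" for c r
  proof -
    have "s (\<theta> c \<otimes>\<^bsub>R\<^esub> r) = (\<Oplus>b\<in>B'. h c \<otimes> (h (FR.coord r b) \<otimes> l b))"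
      unfolding s_def
    proof (rule S.finsum_cong')
      fix b assume b: "b \<in> B'"
      show "h (FR.coord (\<theta> c \<otimes>\<^bsub>R\<^esub> r) b) \<otimes> l b = h c \<otimes> (h (FR.coord r b) \<otimes> l b)"
        using FR.linD(3)[OF FR.coord_lin[OF b] c r] l(1)[OF b] r b c by (simp add: S.m_assoc)
    qed (use r c l in auto)
    also have "\<dots> = h c \<otimes> s r"
      unfolding s_def using r c l by (intro S.finsum_rdistr[symmetric] FR.B_finite) auto
    finally show ?thesis .
  qed
  have phi_s: "\<phi> (s r) = r" if r: "r \<in> carrier R" for r
  proof -
    have "\<phi> (s r) = (\<Oplus>\<^bsub>R\<^esub>b\<in>B'. \<phi> (h (FR.coord r b) \<otimes> l b))"
      unfolding s_def using phi.hom_finsum[of "\<lambda>b. h (FR.coord r b) \<otimes> l b" B'] r l by (auto simp: comp_def)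
    also have "\<dots> = (\<Oplus>\<^bsub>R\<^esub>b\<in>B'. \<theta> (FR.coord r b) \<otimes>\<^bsub>R\<^esub> b)"
      using r l compat by (intro phi.S.finsum_cong') auto
    also have "\<dots> = r" using FR.coord_props(2)[OF r] by simp
    finally show ?thesis .
  qed
  have ker: "x \<in> a_kernel A R \<phi> \<longleftrightarrow> x \<in> carrier A \<and> \<phi> x = \<zero>\<^bsub>R\<^esub>" for x
    unfolding a_kernel_def' by blast
  have s0: "s \<zero>\<^bsub>R\<^esub> = \<zero>"
    using S.eq_add_self_zero[OF s s, of "\<zero>\<^bsub>R\<^esub>" "\<zero>\<^bsub>R\<^esub>"] s_add[of "\<zero>\<^bsub>R\<^esub>" "\<zero>\<^bsub>R\<^esub>"] by simp
  show ?thesis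
  proof (rule that[of "\<lambda>x. s (\<phi> x)"])
    show "s (\<phi> (h c \<otimes> x)) = h c \<otimes> s (\<phi> x)" if "c \<in> carrier SS" "x \<in> carrier A" for c x
      using that s_smult compat by simp
    show "x \<ominus> s (\<phi> x) \<in> a_kernel A R \<phi>" if "x \<in> carrier A" for x
      using that s phi_s by (simp add: ker S.minus_eq phi.S.r_neg)
  qed (use s s_add s0 ker in auto)
qed

text \<open>Both claims become statements about the ideal \<open>V\<close> of \<open>A\<close> once
  \<open>K\<close> is recognized as the image of \<open>I\<close>. The annihilators are then
  compared by \<open>annihilator_lift\<close>, and the Fitting ideals by
  \<open>fitting_ideal_image\<close> with \<open>extend_absorb\<close> as its absorption
  property.\<close>

theorem reduction:
  assumes phi: "surjective_hom A R \<phi>" and FR: "free_algebra SS R \<theta> B'"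
    and compat: "\<And>s. s \<in> carrier SS \<Longrightarrow> \<phi> (h s) = \<theta> s"
    and noeth: "noetherian_ring A"
    and I: "I = a_kernel A R \<phi>"
    and V: "V = variable_ideal \<O> d A h" and W: "W = variable_ideal \<O> d R \<theta>"
    and K: "K = a_kernel (A Quot V) (R Quot W) (induced_quot_map R W \<phi>)"
  shows "ideal V A" "annihilator (A Quot V) K = (\<lambda>x. V +> x) ` annihilator A I"
    "fitting_ideal (A Quot V) (ideal_module (A Quot V) K) = (\<lambda>x. V +> x) ` fitting_ideal A (ideal_module A I)"
proof -
  interpret phi: surjective_hom A R \<phi> by fact
  let ?Y = "ps_var \<O> ` {..<d}"
  define J where "J = Idl\<^bsub>SS\<^esub> ?Y"
  have Y: "?Y \<subseteq> carrier SS" using SP.ps_var_closed by auto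
  have J: "ideal J SS" unfolding J_def by (rule R.genideal_ideal[OF Y])
  have hY: "h ` ?Y \<subseteq> carrier A" using Y by auto
  have V': "V = extend J" "V = Idl (h ` ?Y)"
  proof -
    have "{h (ps_var \<O> i) | i. i < d} = h ` ?Y" by auto
    then show "V = Idl (h ` ?Y)" unfolding V variable_ideal_def by simp
    then show "V = extend J" unfolding J_def extend_Idl[OF Y] .
  qed
  show Vid: "ideal V A" unfolding V'(1) by (rule extend_ideal[OF J])
  \<comment> \<open>By compatibility of the two structure maps the variables of \<open>R\<close> are
    images of those of \<open>A\<close>; this is what makes \<open>K\<close> no larger than the
    image of \<open>I\<close>.\<close>
  have W': "W = \<phi> ` V"
  proof -
    have "{\<theta> (ps_var \<O> i) | i. i < d} = \<theta> ` ?Y" by auto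
    also have "\<dots> = \<phi> ` h ` ?Y" unfolding image_image[of \<phi> h] using compat Y by (intro image_cong) auto
    finally have "{\<theta> (ps_var \<O> i) | i. i < d} = \<phi> ` h ` ?Y" .
    then show ?thesis unfolding W variable_ideal_def V'(2) phi.image_Idl[OF hY] by simp
  qed
  have Wid: "ideal W R" unfolding W' by (rule phi.image_ideal[OF Vid])
  let ?Q = "A Quot V" and ?q = "\<lambda>x. V +> x"
  interpret q: surjective_hom A ?Q ?q by (rule S.quotient_surjective_hom[OF Vid])
  have q0: "?q a = \<zero>\<^bsub>?Q\<^esub> \<longleftrightarrow> a \<in> V" if "a \<in> carrier A" for a
    using S.coset_eq_ideal_iff[OF Vid that] by (simp add: S.quotient_zero)
  have ker: "x \<in> I \<longleftrightarrow> x \<in> carrier A \<and> \<phi> x = \<zero>\<^bsub>R\<^esub>" for x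
    unfolding I a_kernel_def' by blast
  have Iid: "ideal I A" unfolding I by (rule phi.ring.kernel_is_ideal)
  have ind: "induced_quot_map R W \<phi> (?q a) = W +>\<^bsub>R\<^esub> \<phi> a" if a: "a \<in> carrier A" for a
    unfolding induced_quot_map_def
  proof (rule induced_map_coset[OF S.cring_axioms Vid a])
    fix v assume v: "v \<in> V"
    then have vc: "v \<in> carrier A" using S.ideal_carr[OF Vid] by simp
    have "\<phi> (v \<oplus> a) \<ominus>\<^bsub>R\<^esub> \<phi> a = \<phi> v"
    proof -
      have "\<phi> v \<in> carrier R" "\<phi> a \<in> carrier R" using vc a by auto
      then have "(\<phi> v \<oplus>\<^bsub>R\<^esub> \<phi> a) \<ominus>\<^bsub>R\<^esub> \<phi> a = \<phi> v" by algebra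
      then show ?thesis using vc a by simp
    qed
    then show "W +>\<^bsub>R\<^esub> \<phi> (v \<oplus> a) = W +>\<^bsub>R\<^esub> \<phi> a"
      using phi.S.coset_eq_iff[OF Wid, of "\<phi> (v \<oplus> a)" "\<phi> a"] v vc a W' by simp
  qed
  have K': "K = ?q ` I"
  proof (intro equalityI subsetI)
    fix U assume "U \<in> K"
    then have U: "U \<in> carrier ?Q" "induced_quot_map R W \<phi> U = W"
      unfolding K a_kernel_def' phi.S.quotient_zero by auto
    then obtain a where a: "a \<in> carrier A" "U = ?q a" unfolding S.quotient_carrier by blast
    then have "W +>\<^bsub>R\<^esub> \<phi> a = W" using U(2) ind by simp
    then have "\<phi> a \<in> \<phi> ` V" using phi.S.coset_eq_ideal_iff[OF Wid, of "\<phi> a"] a W' by simp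
    \<comment> \<open>Correcting the representative \<open>a\<close> by \<open>v\<close> does not
      change its coset and moves it into \<open>I\<close>.\<close>
    then obtain v where v: "v \<in> V" "\<phi> a = \<phi> v" by blast
    have vc: "v \<in> carrier A" using S.ideal_carr[OF Vid v(1)] .
    have "a \<ominus> v \<in> I" using a vc v(2) by (simp add: ker S.minus_eq phi.S.r_neg)
    moreover have "?q a = ?q (a \<ominus> v)"
    proof -
      have "a \<ominus> (a \<ominus> v) = v" using a(1) vc by algebra
      then show ?thesis using S.coset_eq_iff[OF Vid a(1), of "a \<ominus> v"] a(1) vc v(1) by simp
    qed
    ultimately show "U \<in> ?q ` I" using a(2) by blast
  next
    fix U assume "U \<in> ?q ` I"
    then obtain i where i: "i \<in> I" "U = ?q i" by blast
    have ic: "i \<in> carrier A" "\<phi> i = \<zero>\<^bsub>R\<^esub>" using i(1) ker by auto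
    have "induced_quot_map R W \<phi> U = W"
      unfolding i(2) ind[OF ic(1)] using phi.S.coset_eq_ideal_iff[OF Wid] phi.S.ideal_zero[OF Wid] by (simp add: ic(2))
    then show "U \<in> K" unfolding K a_kernel_def' phi.S.quotient_zero using i(2) ic(1) S.quotient_carrier by blast
  qed
  obtain L \<delta> where L: "lin L" "\<And>b. b \<in> B \<Longrightarrow> \<delta> b \<in> carrier A"
    "\<And>b b'. b \<in> B \<Longrightarrow> b' \<in> B \<Longrightarrow> L (b' \<otimes> \<delta> b) = (if b' = b then \<one>\<^bsub>SS\<^esub> else \<zero>\<^bsub>SS\<^esub>)"
    and mA: "ideal (carrier A - Units A) A"
    using exists_perfect_pairing by blast
  obtain e where e: "\<And>x. x \<in> carrier A \<Longrightarrow> e x \<in> carrier A"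
      "\<And>x y. x \<in> carrier A \<Longrightarrow> y \<in> carrier A \<Longrightarrow> e (x \<oplus> y) = e x \<oplus> e y"
      "\<And>s x. s \<in> carrier SS \<Longrightarrow> x \<in> carrier A \<Longrightarrow> e (h s \<otimes> x) = h s \<otimes> e x"
      "\<And>x. x \<in> I \<Longrightarrow> e x = \<zero>" "\<And>x. x \<in> carrier A \<Longrightarrow> x \<ominus> e x \<in> I"
    unfolding I using linear_projection[OF phi FR compat] by blast
  show "annihilator ?Q K = ?q ` annihilator A I"
  proof (intro equalityI subsetI)
    fix U assume "U \<in> annihilator ?Q K"
    then have U: "U \<in> carrier ?Q" "\<And>i. i \<in> I \<Longrightarrow> U \<otimes>\<^bsub>?Q\<^esub> ?q i = \<zero>\<^bsub>?Q\<^esub>"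
      by (auto simp: annihilator_def K')
    then obtain a where a: "a \<in> carrier A" "U = ?q a" unfolding S.quotient_carrier by blast
    have "a \<otimes> i \<in> extend J" if "i \<in> I" for i
    proof -
      have i: "i \<in> carrier A" using ker that by blast
      then have "?q (a \<otimes> i) = \<zero>\<^bsub>?Q\<^esub>" using U(2)[OF that] a by simp
      then show ?thesis using q0[of "a \<otimes> i"] a(1) i by (simp add: V'(1))
    qed
    from annihilator_lift[OF L Iid e J a(1) this]
    obtain a' where a': "a' \<in> annihilator A I" "a \<ominus> a' \<in> V" unfolding V'(1) by blast
    then have "?q a = ?q a'" using S.coset_eq_iff[OF Vid a(1), of a'] by (simp add: annihilator_def)
    then show "U \<in> ?q ` annihilator A I" using a'(1) a(2) by blast
  next
    fix U assume "U \<in> ?q ` annihilator A I"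
    then obtain a where a: "a \<in> annihilator A I" "U = ?q a" by blast
    then have ac: "a \<in> carrier A" by (simp add: annihilator_def)
    have "?q a \<otimes>\<^bsub>?Q\<^esub> ?q i = \<zero>\<^bsub>?Q\<^esub>" if "i \<in> I" for i
    proof -
      have "i \<in> carrier A" using ker that by blast
      then have "?q a \<otimes>\<^bsub>?Q\<^esub> ?q i = ?q (a \<otimes> i)" using ac by simp
      also have "a \<otimes> i = \<zero>" using a(1) that by (simp add: annihilator_def)
      finally show ?thesis by simp
    qed
    then show "U \<in> annihilator ?Q K" using a(2) ac by (auto simp: annihilator_def K')
  qed
  obtain Z where Z: "finite Z" "I = Idl Z" "Z \<subseteq> carrier A"
    using noetherian_ring.finetely_gen[OF noeth Iid] by blast
  show "fitting_ideal ?Q (ideal_module ?Q K) = ?q ` fitting_ideal A (ideal_module A I)"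
    unfolding K'
  proof (rule q.fitting_ideal_image[OF _ Iid Z])
    fix v assume v: "v \<in> carrier A" "?q v = \<zero>\<^bsub>?Q\<^esub>"
    then have vV: "v \<in> V" using q0 by simp
    \<comment> \<open>The variables are among the parameters, so \<open>V\<close> lies in a proper
      ideal of the local ring \<open>A\<close>. Its elements are nonunits, as Nakayama's lemma
      requires.\<close>
    have "V \<subseteq> extend mS"
    proof -
      have "?Y \<subseteq> ps_param \<O> d \<pi> ` {..<Suc d}" by (auto simp: ps_param_def image_iff intro!: bexI)
      then have "J \<subseteq> mS" unfolding J_def mS_Idl by (rule R.subset_Idl_subset[OF param_subset])
      then show ?thesis unfolding V'(1) extend_def by blast
    qed
    then have vm: "v \<in> extend mS" using vV by blast
    have "v \<notin> Units A"
    proof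
      assume "v \<in> Units A"
      then have "extend mS = carrier A" by (rule S.unit_in_ideal[OF extend_ideal[OF mS_ideal] vm])
      then show False using one_notin_extend by simp
    qed
    then have vA: "v \<in> carrier A - Units A" using v(1) by simp
    show "\<one> \<ominus> v \<in> Units A"
    proof (rule ccontr)
      assume "\<one> \<ominus> v \<notin> Units A"
      then have "\<one> \<ominus> v \<in> carrier A - Units A" using v(1) by simp
      from S.ideal_add[OF mA this vA] show False using S.add_diff_cancel_right[of "\<one>" v] v(1) by simp
    qed
  next
    fix n :: nat and x z assume x: "\<forall>i<n. x i \<in> I" "I = Idl (x ` {..<n})" and z: "z \<in> I" "?q z = \<zero>\<^bsub>?Q\<^esub>"
    have xc: "x j \<in> carrier A" if "j < n" for j using x(1) that ker by blast
    have "z \<in> extend J" using q0 z ker by (simp add: V'(1))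
    from extend_absorb[OF Iid x(2) xc e J z(1) this]
    obtain v where v: "v \<in> {..<n} \<rightarrow> V" "z = (\<Oplus>j\<in>{..<n}. v j \<otimes> x j)" unfolding V'(1) by blast
    have "v j \<in> carrier A \<and> ?q (v j) = \<zero>\<^bsub>?Q\<^esub>" if "j < n" for j
    proof -
      have "v j \<in> V" using v(1) that by auto
      then show ?thesis using q0 S.ideal_carr[OF Vid] by blast
    qed
    then show "\<exists>v. (\<forall>j<n. v j \<in> carrier A \<and> ?q (v j) = \<zero>\<^bsub>?Q\<^esub>) \<and> z = (\<Oplus>j\<in>{..<n}. v j \<otimes> x j)"
      using v(2) by blast
  qed
qed

end

lemma local_ring_nontrivial:
  assumes "local_ring A"
  shows "\<one>\<^bsub>A\<^esub> \<noteq> \<zero>\<^bsub>A\<^esub>"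
proof
  assume 1: "\<one>\<^bsub>A\<^esub> = \<zero>\<^bsub>A\<^esub>"
  obtain M where M: "maximalideal M A" using assms unfolding local_ring_def by blast
  interpret M: maximalideal M A by (rule M)
  have "\<one>\<^bsub>A\<^esub> \<in> M" unfolding 1
    using assms cring.ideal_zero[OF _ M.is_ideal] by (simp add: local_ring_def)
  then show False using M.one_imp_carrier M.I_notcarr by simp
qed

lemma (in cring) fitting_ideal_subset:
  assumes "ideal J R"
  shows "fitting_ideal R (ideal_module R J) \<subseteq> carrier R"
proof -
  have "{ring_det R n U | n x U. relation_matrix J n x U} \<subseteq> carrier R"
    by (auto simp: relation_matrix_def intro!: ring_det_closed)
  then show ?thesis unfolding fitting_ideal_eq[OF assms] using ideal_carr[OF genideal_ideal] by blast
qed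

text \<open>The augmentation kills the images of the variables, so it factors through the quotient
  and takes the same values on cosets. The images of annihilator and Fitting ideal in the base ring
  are therefore unchanged by reduction.\<close>

lemma theta_reduction:
  fixes \<O> :: "'o ring" and A :: "'q ring" and R :: "'r ring"
  assumes O: "cring \<O>" "\<pi> \<in> carrier \<O>" "\<forall>a\<in>carrier \<O>. \<pi> \<otimes>\<^bsub>\<O>\<^esub> a = \<zero>\<^bsub>\<O>\<^esub> \<longrightarrow> a = \<zero>\<^bsub>\<O>\<^esub>"
      "carrier \<O> - Units \<O> = PIdl\<^bsub>\<O>\<^esub> \<pi>"
    and R: "cnl_algebra \<O> R \<alpha>" and A: "cnl_algebra \<O> A \<alpha>t" "complete_intersection \<O> A \<alpha>t"
    and phi: "algebra_hom \<O> A \<alpha>t R \<alpha> \<phi>" "\<phi> ` carrier A = carrier R" and I: "I = a_kernel A R \<phi>"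
    and lam: "augmentation \<O> R \<alpha> lam"
    and th: "finite_free_map \<O> d R \<alpha> \<theta>" "\<forall>i<d. \<theta> (ps_var \<O> i) \<in> a_kernel R \<O> lam"
    and tht: "finite_free_map \<O> d A \<alpha>t \<theta>t"
    and compat: "\<forall>s\<in>carrier (power_series_ring \<O> d). \<phi> (\<theta>t s) = \<theta> s"
    and Q: "Q = variable_quotient \<O> d A \<theta>t"
    and K: "K = a_kernel Q (variable_quotient \<O> d R \<theta>) (induced_quot_map R (variable_ideal \<O> d R \<theta>) \<phi>)"
  shows "annihilator Q K = (\<lambda>x. variable_ideal \<O> d A \<theta>t +>\<^bsub>A\<^esub> x) ` annihilator A I"
    "fitting_ideal Q (ideal_module Q K)
      = (\<lambda>x. variable_ideal \<O> d A \<theta>t +>\<^bsub>A\<^esub> x) ` fitting_ideal A (ideal_module A I)"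
    "C1_module \<O> Q K (induced_map (lam \<circ> \<phi>)) = C1_module \<O> A I (lam \<circ> \<phi>)"
proof -
  have "local_ring A" "local_ring R" "noetherian_ring A" using R A(1) by (simp_all add: cnl_algebra_def)
  then have cA: "cring A" "cring R" "noetherian_ring A" "\<one>\<^bsub>A\<^esub> \<noteq> \<zero>\<^bsub>A\<^esub>"
    using local_ring_nontrivial[of A] by (simp_all add: local_ring_def)
  interpret A: cring A by (rule cA(1))
  interpret O: cring \<O> by (rule O(1))
  obtain B where B: "free_algebra (power_series_ring \<O> d) A \<theta>t B"
    using finite_free_map_free_algebra[OF O(1) cA(1) tht] .
  obtain B' where B': "free_algebra (power_series_ring \<O> d) R \<theta> B'"
    using finite_free_map_free_algebra[OF O(1) cA(2) th(1)] .
  interpret F: ci_algebra \<O> d A \<theta>t B \<pi> \<alpha>t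
    using B O cA(4) A(2) by (intro ci_algebra.intro ci_algebra_axioms.intro) auto
  interpret phi: surjective_hom A R \<phi>
    using phi cA
    by (intro surjective_hom.intro ring_hom_cring.intro ring_hom_cring_axioms.intro surjective_hom_axioms.intro)
       (auto simp: algebra_hom_def)
  define V where "V = variable_ideal \<O> d A \<theta>t"
  have Q': "Q = A Quot V" by (simp add: Q variable_quotient_def V_def)
  have K': "K = a_kernel (A Quot V) (R Quot variable_ideal \<O> d R \<theta>) (induced_quot_map R (variable_ideal \<O> d R \<theta>) \<phi>)"
    unfolding K Q' by (simp add: variable_quotient_def)
  have comp: "\<phi> (\<theta>t s) = \<theta> s" if "s \<in> carrier (power_series_ring \<O> d)" for s using compat that by blast
  note red = F.reduction[OF phi.surjective_hom_axioms B' comp cA(3) I V_def refl K']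
  show 1: "annihilator Q K = (\<lambda>x. variable_ideal \<O> d A \<theta>t +>\<^bsub>A\<^esub> x) ` annihilator A I"
    using red(2) by (simp add: Q' V_def)
  show 2: "fitting_ideal Q (ideal_module Q K)
      = (\<lambda>x. variable_ideal \<O> d A \<theta>t +>\<^bsub>A\<^esub> x) ` fitting_ideal A (ideal_module A I)"
    using red(3) by (simp add: Q' V_def)
  have lam_hom: "lam \<in> ring_hom R \<O>" using lam by (simp add: augmentation_def algebra_hom_def)
  interpret lam: ring_hom_cring R \<O> lam
    using cA(2) O(1) lam_hom by (intro ring_hom_cring.intro ring_hom_cring_axioms.intro)
  interpret lamt: ring_hom_cring A \<O> "lam \<circ> \<phi>"
    using cA(1) O(1) ring_hom_trans[OF phi.homh lam_hom] by (intro ring_hom_cring.intro ring_hom_cring_axioms.intro)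
  \<comment> \<open>It suffices to check generators, whose images in \<open>R\<close> lie in the
    kernel of \<open>lam\<close>.\<close>
  have "V \<subseteq> {a \<in> carrier A. (lam \<circ> \<phi>) a \<in> {\<zero>\<^bsub>\<O>\<^esub>}}"
    unfolding V_def variable_ideal_def
  proof (rule A.genideal_minimal[OF lamt.ring.ideal_vimage[OF O.zeroideal]], rule subsetI)
    fix y assume "y \<in> {\<theta>t (ps_var \<O> i) | i. i < d}"
    then obtain i where i: "i < d" "y = \<theta>t (ps_var \<O> i)" by blast
    have "ps_var \<O> i \<in> carrier (power_series_ring \<O> d)" by (rule F.SP.ps_var_closed[OF i(1)])
    then have "y \<in> carrier A" "\<phi> y = \<theta> (ps_var \<O> i)" using i(2) comp by auto
    moreover have "lam (\<theta> (ps_var \<O> i)) = \<zero>\<^bsub>\<O>\<^esub>" using th(2) i(1) unfolding a_kernel_def' by blast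
    ultimately show "y \<in> {a \<in> carrier A. (lam \<circ> \<phi>) a \<in> {\<zero>\<^bsub>\<O>\<^esub>}}" by simp
  qed
  then have ind: "induced_map (lam \<circ> \<phi>) (V +>\<^bsub>A\<^esub> x) = (lam \<circ> \<phi>) x" if x: "x \<in> carrier A" for x
  proof (intro induced_map_coset[OF cA(1) red(1) x])
    fix v assume "v \<in> V"
    then have "v \<in> carrier A" "(lam \<circ> \<phi>) v = \<zero>\<^bsub>\<O>\<^esub>" using \<open>V \<subseteq> _\<close> by auto
    then show "(lam \<circ> \<phi>) (v \<oplus>\<^bsub>A\<^esub> x) = (lam \<circ> \<phi>) x" using lamt.hom_add[of v x] lamt.hom_closed[OF x] x by simp
  qed
  have img: "induced_map (lam \<circ> \<phi>) ` (\<lambda>x. V +>\<^bsub>A\<^esub> x) ` T = (lam \<circ> \<phi>) ` T" if "T \<subseteq> carrier A" for T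
    unfolding image_image by (rule image_cong[OF refl]) (use ind that in blast)
  have "ideal I A" unfolding I by (rule phi.ring.kernel_is_ideal)
  then have "fitting_ideal A (ideal_module A I) \<subseteq> carrier A" by (rule A.fitting_ideal_subset)
  moreover have "annihilator A I \<subseteq> carrier A" by (auto simp: annihilator_def)
  ultimately show "C1_module \<O> Q K (induced_map (lam \<circ> \<phi>)) = C1_module \<O> A I (lam \<circ> \<phi>)"
    unfolding C1_module_def 1 2 V_def[symmetric] by (simp only: img)
qed

text \<open>Multiplication is that of the field \<open>E\<close>, so the nonzero
  \<open>\<pi>\<close> can be cancelled. The ring axioms are read off from the module structure
  contained in flatness.\<close>

lemma ring_of_integers_uniformizer:
  assumes "finite_padic_extension p E \<iota>" "\<O> = ring_of_integers p E \<iota>" "uniformizer \<O> \<pi>"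
    and "flat_module \<O> M"
  shows "cring \<O>" "\<pi> \<in> carrier \<O>" "\<forall>a\<in>carrier \<O>. \<pi> \<otimes>\<^bsub>\<O>\<^esub> a = \<zero>\<^bsub>\<O>\<^esub> \<longrightarrow> a = \<zero>\<^bsub>\<O>\<^esub>"
    "carrier \<O> - Units \<O> = PIdl\<^bsub>\<O>\<^esub> \<pi>"
proof -
  show "cring \<O>" using assms(4) by (simp add: flat_module_def module_def)
  show pi: "\<pi> \<in> carrier \<O>" "carrier \<O> - Units \<O> = PIdl\<^bsub>\<O>\<^esub> \<pi>" using assms(3) by (auto simp: uniformizer_def)
  interpret E: field E using assms(1) by (simp add: finite_padic_extension_def)
  have O: "carrier \<O> \<subseteq> carrier E" "monoid.mult \<O> = monoid.mult E" "\<zero>\<^bsub>\<O>\<^esub> = \<zero>\<^bsub>E\<^esub>"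
    unfolding assms(2) by (auto simp: ring_of_integers_def)
  show "\<forall>a\<in>carrier \<O>. \<pi> \<otimes>\<^bsub>\<O>\<^esub> a = \<zero>\<^bsub>\<O>\<^esub> \<longrightarrow> a = \<zero>\<^bsub>\<O>\<^esub>"
    using assms(3) pi(1) O E.integral[of \<pi>] by (auto simp: uniformizer_def)
qed

theorem theorem3p8:
  fixes p d :: nat
    and E \<O> :: "'e ring" and \<iota> :: "(nat \<Rightarrow> rat) set \<Rightarrow> 'e" and \<pi> :: 'e
    and R :: "'r ring" and \<alpha> :: "'e \<Rightarrow> 'r" and lam :: "'r \<Rightarrow> 'e"
    and Rt :: "'q ring" and \<alpha>t :: "'e \<Rightarrow> 'q" and I :: "'q set" and \<phi> :: "'q \<Rightarrow> 'r"
    and \<theta> :: "(nat multiset \<Rightarrow> 'e) \<Rightarrow> 'r" and \<theta>t :: "(nat multiset \<Rightarrow> 'e) \<Rightarrow> 'q"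
    and Rt\<theta> :: "'q set ring" and R\<theta> :: "'r set ring"
    and \<pi>\<theta> :: "'q \<Rightarrow> 'q set" and \<phi>\<theta> :: "'q set \<Rightarrow> 'r set" and I\<theta> :: "'q set set"
    and lamt :: "'q \<Rightarrow> 'e" and lamt\<theta> :: "'q set \<Rightarrow> 'e"
  assumes "finite_padic_extension p E \<iota>"
    and "\<O> = ring_of_integers p E \<iota>"
    and "uniformizer \<O> \<pi>"
    and "cnl_algebra \<O> R \<alpha>"
    and "flat_module \<O> (restrict_scalars \<alpha> R)"
    and "cohen_macaulay R"
    and "relative_dimension R d"
    and "augmentation \<O> R \<alpha> lam"
    and "generically_smooth_at E \<O> \<pi> R \<alpha> lam"
    and "property_P \<O> d R \<alpha> lam \<theta>"
    and "property_CI E \<O> \<pi> d R \<alpha> lam Rt \<alpha>t I \<phi>"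
    and "finite_free_map \<O> d Rt \<alpha>t \<theta>t"
    and "\<forall>s\<in>carrier (power_series_ring \<O> d). \<phi> (\<theta>t s) = \<theta> s"
    and "Rt\<theta> = variable_quotient \<O> d Rt \<theta>t"
    and "\<pi>\<theta> = (\<lambda>x. variable_ideal \<O> d Rt \<theta>t +>\<^bsub>Rt\<^esub> x)"
    and "R\<theta> = variable_quotient \<O> d R \<theta>"
    and "\<phi>\<theta> = induced_quot_map R (variable_ideal \<O> d R \<theta>) \<phi>"
    and "I\<theta> = a_kernel Rt\<theta> R\<theta> \<phi>\<theta>"
    and "lamt = lam \<circ> \<phi>"
    and "lamt\<theta> = induced_map lamt"
  shows "annihilator Rt\<theta> I\<theta> = \<pi>\<theta> ` annihilator Rt I
    \<and> fitting_ideal Rt\<theta> (ideal_module Rt\<theta> I\<theta>) = \<pi>\<theta> ` fitting_ideal Rt (ideal_module Rt I)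
    \<and> C1_module \<O> Rt\<theta> I\<theta> lamt\<theta> = C1_module \<O> Rt I lamt
    \<and> (\<forall>\<theta>' \<theta>t'.
           property_P \<O> d R \<alpha> lam \<theta>' \<and> finite_free_map \<O> d Rt \<alpha>t \<theta>t' \<and>
           (\<forall>s\<in>carrier (power_series_ring \<O> d). \<phi> (\<theta>t' s) = \<theta>' s) \<longrightarrow>
           C1_theta \<O> d R lam Rt \<phi> \<theta>' \<theta>t' = C1_module \<O> Rt\<theta> I\<theta> lamt\<theta>)"
  proof -
  have P: "finite_free_map \<O> d R \<alpha> \<theta>" "\<forall>i<d. \<theta> (ps_var \<O> i) \<in> a_kernel R \<O> lam"
    if "property_P \<O> d R \<alpha> lam \<theta>" for \<theta>
    using that by (simp_all add: property_P_def)
  have CI: "cnl_algebra \<O> Rt \<alpha>t" "complete_intersection \<O> Rt \<alpha>t" "algebra_hom \<O> Rt \<alpha>t R \<alpha> \<phi>"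
    "\<phi> ` carrier Rt = carrier R" "I = a_kernel Rt R \<phi>"
    using assms(11) by (simp_all add: property_CI_def)
  \<comment> \<open>Left open in the pair of structure maps, because it is applied to the given pair
    and again to an arbitrary second one.\<close>
  note red = theta_reduction[OF ring_of_integers_uniformizer[OF assms(1-3,5)] assms(4) CI assms(8)]
  note main = red[OF P[OF assms(10)] assms(12,13,14) assms(18)[unfolded assms(16,17)]]
  \<comment> \<open>Both sides equal the module computed in \<open>Rt\<close> from \<open>I\<close>
    and \<open>lamt\<close>, in which neither structure map occurs.\<close>
  have "C1_theta \<O> d R lam Rt \<phi> \<theta>' \<theta>t' = C1_module \<O> Rt\<theta> I\<theta> lamt\<theta>"
    if "property_P \<O> d R \<alpha> lam \<theta>'" "finite_free_map \<O> d Rt \<alpha>t \<theta>t'"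
      "\<forall>s\<in>carrier (power_series_ring \<O> d). \<phi> (\<theta>t' s) = \<theta>' s" for \<theta>' \<theta>t'
    unfolding C1_theta_def assms(19,20) main(3) by (rule red(3)[OF P[OF that(1)] that(2,3) refl refl])
  then show ?thesis
    using main by (simp add: assms(15,19,20))
qed

end
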